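(* Let $R$ be a (commutative integral) domain and let $M$ be a $w$-strongly flat $R$-module. Then $M_{\mathfrak p}$ is a strongly flat $R_{\mathfrak p}$-module for all prime $w$-ideals $\mathfrak p$ of $R$.
   Context: All rings are commutative with identity and all modules are unitary. A $\mathrm{GV}$-ideal of $R$ is a finitely generated ideal $J$ such that the natural map $R\to\operatorname{Hom}_R(J,R)$, $r\mapsto(a\mapsto ra)$, is an isomorphism; $\mathrm{GV}(R)$ is the set of all $\mathrm{GV}$-ideals. An $R$-module $M$ is $\mathrm{GV}$-torsion if every $x\in M$ satisfies $Jx=0$ for some $J\in\mathrm{GV}(R)$, and $\mathrm{GV}$-torsion-free if $x\in M$ and $Jx=0$ for some $J\in\mathrm{GV}(R)$ imply $x=0$. A $w$-module is a $\mathrm{GV}$-torsion-free module $M$ with $\operatorname{Ext}^1_R(R/J,M)=0$ for all $J\in\mathrm{GV}(R)$; a $w$-ideal is an ideal of $R$ that is a $w$-module; a prime $w$-ideal is a prime ideal that is a $w$-ideal. For a domain $R$ with field of quotients $Q$: an $R$-module $C$ is Matlis-cotorsion if $\operatorname{Ext}^1_R(Q,C)=0$; an $R$-module $M$ is strongly flat if $\operatorname{Ext}^1_R(M,C)=0$ for all Matlis-cotorsion $R$-modules $C$, and $w$-strongly flat if $\operatorname{Ext}^1_R(M,C)$ is $\mathrm{GV}$-torsion for all Matlis-cotorsion $R$-modules $C$. (Strong flatness of $M_{\mathfrak p}$ is over the domain $R_{\mathfrak p}$, whose field of quotients is also $Q$.) *)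

theory Defs
  imports "HOL-Algebra.Module" "HOL-Algebra.Ideal"
begin

section \<open>Modules\<close>

text \<open>
  The record \<^typ>\<open>('a, 'b) module\<close> extends a ring record. The locale \<^locale>\<open>module\<close>
  imposes no condition on the fields \<open>mult\<close> and \<open>one\<close>, so they carry no information and are left
  undefined in the constructions below. A submodule \<open>N\<close> of \<open>M\<close> is regarded as a module by
  replacing the carrier of \<open>M\<close>.
\<close>

definition self_module :: "('a, 'x) ring_scheme \<Rightarrow> ('a, 'a) module" where
  "self_module R = \<lparr>carrier = carrier R, mult = undefined, one = undefined,
     zero = \<zero>\<^bsub>R\<^esub>, add = add R, smult = mult R\<rparr>"

definition quot_module :: "('a, 'm, 'y) module_scheme \<Rightarrow> 'm set \<Rightarrow> ('a, 'm set) module" where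
  "quot_module M N = \<lparr>carrier = a_rcosets\<^bsub>M\<^esub> N, mult = undefined, one = undefined,
     zero = N, add = (<+>\<^bsub>M\<^esub>), smult = (\<lambda>r X. \<Union>x\<in>X. N +>\<^bsub>M\<^esub> (r \<odot>\<^bsub>M\<^esub> x))\<rparr>"

definition zero_module :: "('a, 'm, 'y) module_scheme \<Rightarrow> bool" where
  "zero_module M \<longleftrightarrow> carrier M = {\<zero>\<^bsub>M\<^esub>}"

definition mod_hom :: "('a, 'x) ring_scheme \<Rightarrow> ('a, 'm, 'y) module_scheme \<Rightarrow>
    ('a, 'n, 'z) module_scheme \<Rightarrow> ('m \<Rightarrow> 'n) set" where
  "mod_hom R M N = {f \<in> carrier M \<rightarrow>\<^sub>E carrier N.
     (\<forall>x\<in>carrier M. \<forall>y\<in>carrier M. f (x \<oplus>\<^bsub>M\<^esub> y) = f x \<oplus>\<^bsub>N\<^esub> f y) \<and>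
     (\<forall>r\<in>carrier R. \<forall>x\<in>carrier M. f (r \<odot>\<^bsub>M\<^esub> x) = r \<odot>\<^bsub>N\<^esub> f x)}"

definition mod_iso :: "('a, 'x) ring_scheme \<Rightarrow> ('a, 'm, 'y) module_scheme \<Rightarrow>
    ('a, 'n, 'z) module_scheme \<Rightarrow> ('m \<Rightarrow> 'n) set" where
  "mod_iso R M N = {f \<in> mod_hom R M N. bij_betw f (carrier M) (carrier N)}"

definition Hom_module :: "('a, 'x) ring_scheme \<Rightarrow> ('a, 'm, 'y) module_scheme \<Rightarrow>
    ('a, 'n, 'z) module_scheme \<Rightarrow> ('a, 'm \<Rightarrow> 'n) module" where
  "Hom_module R M N = \<lparr>carrier = mod_hom R M N, mult = undefined, one = undefined,
     zero = (\<lambda>x\<in>carrier M. \<zero>\<^bsub>N\<^esub>),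
     add = (\<lambda>f g. \<lambda>x\<in>carrier M. f x \<oplus>\<^bsub>N\<^esub> g x),
     smult = (\<lambda>r f. \<lambda>x\<in>carrier M. r \<odot>\<^bsub>N\<^esub> f x)\<rparr>"

section \<open>Ext\<close>

definition free_module :: "('a, 'x) ring_scheme \<Rightarrow> 'b set \<Rightarrow> ('a, 'b \<Rightarrow> 'a) module" where
  "free_module R B = \<lparr>carrier = {f \<in> B \<rightarrow>\<^sub>E carrier R. finite {b \<in> B. f b \<noteq> \<zero>\<^bsub>R\<^esub>}},
     mult = undefined, one = undefined,
     zero = (\<lambda>b\<in>B. \<zero>\<^bsub>R\<^esub>),
     add = (\<lambda>f g. \<lambda>b\<in>B. f b \<oplus>\<^bsub>R\<^esub> g b),
     smult = (\<lambda>r f. \<lambda>b\<in>B. r \<otimes>\<^bsub>R\<^esub> f b)\<rparr>"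

text \<open>
  For a subset \<open>B\<close> of a module \<open>N\<close>: the linear map from the free module on \<open>B\<close> to \<open>N\<close> that sends
  each basis vector to the corresponding element of \<open>B\<close>, and its kernel.
\<close>

definition eval_map :: "('a, 'x) ring_scheme \<Rightarrow> ('a, 'm, 'y) module_scheme \<Rightarrow> 'm set \<Rightarrow>
    ('m \<Rightarrow> 'a) \<Rightarrow> 'm" where
  "eval_map R N B = (\<lambda>f\<in>carrier (free_module R B).
     \<Oplus>\<^bsub>N\<^esub>b\<in>{b \<in> B. f b \<noteq> \<zero>\<^bsub>R\<^esub>}. f b \<odot>\<^bsub>N\<^esub> b)"

definition eval_kernel :: "('a, 'x) ring_scheme \<Rightarrow> ('a, 'm, 'y) module_scheme \<Rightarrow> 'm set \<Rightarrow>
    ('m \<Rightarrow> 'a) set" where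
  "eval_kernel R N B = {f \<in> carrier (free_module R B). eval_map R N B f = \<zero>\<^bsub>N\<^esub>}"

text \<open>
  \<open>\<dots> \<rightarrow> F\<^sub>2 \<rightarrow> F\<^sub>1 \<rightarrow> F\<^sub>0 \<rightarrow> M \<rightarrow> 0\<close> is the standard free resolution of \<open>M\<close>: \<open>F\<^sub>0\<close> is free on the
  elements of \<open>M\<close>, and \<open>F\<^sub>n\<^sub>+\<^sub>1\<close> is free on the elements of the kernel of the preceding map.
  The module \<open>Ext\<^sup>1(M, C)\<close> is the first cohomology of \<open>Hom(F, C)\<close>.
\<close>

definition Ext1 :: "('a, 'x) ring_scheme \<Rightarrow> ('a, 'm, 'y) module_scheme \<Rightarrow>
    ('a, 'c, 'z) module_scheme \<Rightarrow> ('a, ((('m \<Rightarrow> 'a) \<Rightarrow> 'a) \<Rightarrow> 'c) set) module" where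
  "Ext1 R M C =
     (let F0 = free_module R (carrier M);
          K0 = eval_kernel R M (carrier M);
          F1 = free_module R K0;
          d1 = eval_map R F0 K0;
          K1 = eval_kernel R F0 K0;
          F2 = free_module R K1;
          d2 = eval_map R F1 K1;
          Z = {f \<in> mod_hom R F1 C. compose (carrier F2) f d2 = (\<lambda>x\<in>carrier F2. \<zero>\<^bsub>C\<^esub>)};
          B = {compose (carrier F1) g d1 | g. g \<in> mod_hom R F0 C}
      in quot_module ((Hom_module R F1 C)\<lparr>carrier := Z\<rparr>) B)"

section \<open>Localization and the field of quotients\<close>

definition loc_rel :: "('a, 'x) ring_scheme \<Rightarrow> 'a set \<Rightarrow> ('a, 'm, 'y) module_scheme \<Rightarrow>
    (('m \<times> 'a) \<times> ('m \<times> 'a)) set" where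
  "loc_rel R S M = {((x, s), (y, t)). x \<in> carrier M \<and> y \<in> carrier M \<and> s \<in> S \<and> t \<in> S \<and>
     (\<exists>u\<in>S. u \<odot>\<^bsub>M\<^esub> (t \<odot>\<^bsub>M\<^esub> x) = u \<odot>\<^bsub>M\<^esub> (s \<odot>\<^bsub>M\<^esub> y))}"

definition loc_frac :: "('a, 'x) ring_scheme \<Rightarrow> 'a set \<Rightarrow> ('a, 'm, 'y) module_scheme \<Rightarrow>
    'm \<Rightarrow> 'a \<Rightarrow> ('m \<times> 'a) set" where
  "loc_frac R S M x s = loc_rel R S M `` {(x, s)}"

text \<open>
  In the following two definitions the unions range over all representatives of the given
  fractions; all of them yield the same class.
\<close>

definition loc_ring :: "('a, 'x) ring_scheme \<Rightarrow> 'a set \<Rightarrow> ('a \<times> 'a) set ring" where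
  "loc_ring R S =
     \<lparr>carrier = (carrier R \<times> S) // loc_rel R S (self_module R),
      mult = (\<lambda>X Y. \<Union>(a, s)\<in>X. \<Union>(b, t)\<in>Y.
        loc_frac R S (self_module R) (a \<otimes>\<^bsub>R\<^esub> b) (s \<otimes>\<^bsub>R\<^esub> t)),
      one = loc_frac R S (self_module R) \<one>\<^bsub>R\<^esub> \<one>\<^bsub>R\<^esub>,
      zero = loc_frac R S (self_module R) \<zero>\<^bsub>R\<^esub> \<one>\<^bsub>R\<^esub>,
      add = (\<lambda>X Y. \<Union>(a, s)\<in>X. \<Union>(b, t)\<in>Y.
        loc_frac R S (self_module R) ((t \<otimes>\<^bsub>R\<^esub> a) \<oplus>\<^bsub>R\<^esub> (s \<otimes>\<^bsub>R\<^esub> b)) (s \<otimes>\<^bsub>R\<^esub> t))\<rparr>"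

definition loc_module :: "('a, 'x) ring_scheme \<Rightarrow> 'a set \<Rightarrow> ('a, 'm, 'y) module_scheme \<Rightarrow>
    (('a \<times> 'a) set, ('m \<times> 'a) set) module" where
  "loc_module R S M =
     \<lparr>carrier = (carrier M \<times> S) // loc_rel R S M,
      mult = undefined, one = undefined,
      zero = loc_frac R S M \<zero>\<^bsub>M\<^esub> \<one>\<^bsub>R\<^esub>,
      add = (\<lambda>X Y. \<Union>(x, s)\<in>X. \<Union>(y, t)\<in>Y.
        loc_frac R S M ((t \<odot>\<^bsub>M\<^esub> x) \<oplus>\<^bsub>M\<^esub> (s \<odot>\<^bsub>M\<^esub> y)) (s \<otimes>\<^bsub>R\<^esub> t)),
      smult = (\<lambda>X Y. \<Union>(a, s)\<in>X. \<Union>(y, t)\<in>Y.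
        loc_frac R S M (a \<odot>\<^bsub>M\<^esub> y) (s \<otimes>\<^bsub>R\<^esub> t))\<rparr>"

definition prime_loc_ring :: "('a, 'x) ring_scheme \<Rightarrow> 'a set \<Rightarrow> ('a \<times> 'a) set ring" where
  "prime_loc_ring R P = loc_ring R (carrier R - P)"

definition prime_loc_module :: "('a, 'x) ring_scheme \<Rightarrow> 'a set \<Rightarrow> ('a, 'm, 'y) module_scheme \<Rightarrow>
    (('a \<times> 'a) set, ('m \<times> 'a) set) module" where
  "prime_loc_module R P M = loc_module R (carrier R - P) M"

definition quotient_field :: "('a, 'x) ring_scheme \<Rightarrow> ('a \<times> 'a) set ring" where
  "quotient_field R = loc_ring R (carrier R - {\<zero>\<^bsub>R\<^esub>})"

text \<open>The field of quotients of a domain, as a module over that domain.\<close>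

definition quotient_field_module :: "('a, 'x) ring_scheme \<Rightarrow> ('a, ('a \<times> 'a) set) module" where
  "quotient_field_module R =
     \<lparr>carrier = carrier (quotient_field R), mult = undefined, one = undefined,
      zero = \<zero>\<^bsub>quotient_field R\<^esub>, add = add (quotient_field R),
      smult = (\<lambda>r X. loc_frac R (carrier R - {\<zero>\<^bsub>R\<^esub>}) (self_module R) r \<one>\<^bsub>R\<^esub> \<otimes>\<^bsub>quotient_field R\<^esub> X)\<rparr>"

section \<open>GV-ideals and w-modules\<close>

definition GV_ideals :: "('a, 'x) ring_scheme \<Rightarrow> 'a set set" where
  "GV_ideals R = {J. ideal J R \<and> (\<exists>A. finite A \<and> A \<subseteq> carrier R \<and> J = Idl\<^bsub>R\<^esub> A) \<and>
     (\<lambda>r\<in>carrier R. \<lambda>a\<in>J. r \<otimes>\<^bsub>R\<^esub> a) \<in>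
       mod_iso R (self_module R) (Hom_module R ((self_module R)\<lparr>carrier := J\<rparr>) (self_module R))}"

definition GV_torsion :: "('a, 'x) ring_scheme \<Rightarrow> ('a, 'm, 'y) module_scheme \<Rightarrow> bool" where
  "GV_torsion R M \<longleftrightarrow> (\<forall>x\<in>carrier M. \<exists>J\<in>GV_ideals R. \<forall>a\<in>J. a \<odot>\<^bsub>M\<^esub> x = \<zero>\<^bsub>M\<^esub>)"

definition GV_torsion_free :: "('a, 'x) ring_scheme \<Rightarrow> ('a, 'm, 'y) module_scheme \<Rightarrow> bool" where
  "GV_torsion_free R M \<longleftrightarrow> (\<forall>x\<in>carrier M.
     (\<exists>J\<in>GV_ideals R. \<forall>a\<in>J. a \<odot>\<^bsub>M\<^esub> x = \<zero>\<^bsub>M\<^esub>) \<longrightarrow> x = \<zero>\<^bsub>M\<^esub>)"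

definition w_module :: "('a, 'x) ring_scheme \<Rightarrow> ('a, 'm, 'y) module_scheme \<Rightarrow> bool" where
  "w_module R M \<longleftrightarrow> module R M \<and> GV_torsion_free R M \<and>
     (\<forall>J\<in>GV_ideals R. zero_module (Ext1 R (quot_module (self_module R) J) M))"

definition w_ideal :: "'a set \<Rightarrow> ('a, 'x) ring_scheme \<Rightarrow> bool" where
  "w_ideal I R \<longleftrightarrow> ideal I R \<and> w_module R ((self_module R)\<lparr>carrier := I\<rparr>)"

definition prime_w_ideal :: "'a set \<Rightarrow> ('a, 'x) ring_scheme \<Rightarrow> bool" where
  "prime_w_ideal P R \<longleftrightarrow> primeideal P R \<and> w_ideal P R"

section \<open>Strongly flat and w-strongly flat modules\<close>

definition matlis_cotorsion :: "('a, 'x) ring_scheme \<Rightarrow> ('a, 'c, 'z) module_scheme \<Rightarrow> bool" where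
  "matlis_cotorsion R C \<longleftrightarrow> module R C \<and> zero_module (Ext1 R (quotient_field_module R) C)"

text \<open>
  HOL has no quantification over types inside a formula, so the test modules \<open>C\<close> of the next two
  notions range over all modules whose elements come from an arbitrary type \<^typ>\<open>'c\<close>, which is an
  explicit parameter and plays the role of the universe.
\<close>

definition strongly_flat ::
    "'c itself \<Rightarrow> ('a, 'x) ring_scheme \<Rightarrow> ('a, 'm, 'y) module_scheme \<Rightarrow> bool" where
  "strongly_flat _ R M \<longleftrightarrow> domain R \<and> module R M \<and>
     (\<forall>C :: ('a, 'c) module. matlis_cotorsion R C \<longrightarrow> zero_module (Ext1 R M C))"

definition w_strongly_flat ::
    "'c itself \<Rightarrow> ('a, 'x) ring_scheme \<Rightarrow> ('a, 'm, 'y) module_scheme \<Rightarrow> bool" where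
  "w_strongly_flat _ R M \<longleftrightarrow> domain R \<and> module R M \<and>
     (\<forall>C :: ('a, 'c) module. matlis_cotorsion R C \<longrightarrow> GV_torsion R (Ext1 R M C))"

end

theory Submission
  imports Defs
begin

text \<open>
  Write \<open>R\<^sub>P\<close> for the localization of \<open>R\<close> at a prime w-ideal \<open>P\<close>, and let \<open>C\<close> be a Matlis-cotorsion
  module over \<open>R\<^sub>P\<close>. The claim is \<open>Ext\<^sup>1(M\<^sub>P, C) = 0\<close> over \<open>R\<^sub>P\<close>, and the proof compares extension
  modules over \<open>R\<^sub>P\<close> with those over \<open>R\<close>, where \<open>C\<close> is regarded as an \<open>R\<close>-module by restriction of
  scalars. For an \<open>R\<close>-module \<open>X\<close> one has \<open>Ext\<^sup>1(X, C) = 0\<close> over \<open>R\<close> if and only if \<open>Ext\<^sup>1(X\<^sub>P, C) = 0\<close>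
  over \<open>R\<^sub>P\<close>. The two directions are the lemmas \<open>Ext1_localization\<close> and \<open>Ext1_of_localization\<close>.
  
  This equivalence is used twice. The field of quotients \<open>Q\<close> of \<open>R\<close> is also the one of \<open>R\<^sub>P\<close>
  (\<open>module_localization_quotient_field\<close>), so \<open>C\<close> is Matlis-cotorsion over \<open>R\<close>, and the hypothesis on
  \<open>M\<close> makes \<open>Ext\<^sup>1(M, C)\<close> a GV-torsion module. A GV-ideal \<open>J\<close> is not contained in \<open>P\<close>
  (\<open>GV_ideal_not_subset_prime_w_ideal\<close>), so every class in \<open>Ext\<^sup>1(M, C)\<close> is annihilated by an element
  outside \<open>P\<close>. Such elements act invertibly on \<open>C\<close>, hence on \<open>Ext\<^sup>1(M, C)\<close>, which must therefore vanish
  (\<open>Ext1_zero_if_GV_torsion\<close>). The second use of the equivalence, now for \<open>M\<close>, finishes the proof.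
  
  All of this rests on a description of \<open>Ext\<^sup>1\<close> by extension problems. By \<open>zero_module_Ext1_iff\<close> the
  module \<open>Ext\<^sup>1(M, C)\<close> vanishes if and only if all homomorphisms to \<open>C\<close> from the kernel of the free cover
  of \<open>M\<close> extend to the cover, and by \<open>Ext1_zero_extend\<close> the same then holds for every surjection onto
  \<open>M\<close>. Such extension problems are transported between \<open>R\<close> and \<open>R\<^sub>P\<close> by the universal property of
  localization (\<open>module_localization_extend\<close>).
\<close>

section \<open>Homomorphisms, submodules and quotient modules\<close>

lemma mod_hom_closed: "f \<in> mod_hom R M N \<Longrightarrow> x \<in> carrier M \<Longrightarrow> f x \<in> carrier N"
  by (auto simp: mod_hom_def)

lemma mod_hom_add: "f \<in> mod_hom R M N \<Longrightarrow> x \<in> carrier M \<Longrightarrow> y \<in> carrier M \<Longrightarrow>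
    f (x \<oplus>\<^bsub>M\<^esub> y) = f x \<oplus>\<^bsub>N\<^esub> f y"
  by (auto simp: mod_hom_def)

lemma mod_hom_smult: "f \<in> mod_hom R M N \<Longrightarrow> r \<in> carrier R \<Longrightarrow> x \<in> carrier M \<Longrightarrow>
    f (r \<odot>\<^bsub>M\<^esub> x) = r \<odot>\<^bsub>N\<^esub> f x"
  by (auto simp: mod_hom_def)

lemma mod_hom_restrictI:
  assumes "module R M"
    and "\<And>x. x \<in> carrier M \<Longrightarrow> f x \<in> carrier N"
    and "\<And>x y. x \<in> carrier M \<Longrightarrow> y \<in> carrier M \<Longrightarrow> f (x \<oplus>\<^bsub>M\<^esub> y) = f x \<oplus>\<^bsub>N\<^esub> f y"
    and "\<And>r x. r \<in> carrier R \<Longrightarrow> x \<in> carrier M \<Longrightarrow> f (r \<odot>\<^bsub>M\<^esub> x) = r \<odot>\<^bsub>N\<^esub> f x"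
  shows "(\<lambda>x\<in>carrier M. f x) \<in> mod_hom R M N"
proof -
  interpret M: module R M by fact
  show ?thesis unfolding mod_hom_def using assms(2-4) by auto
qed

lemma mod_hom_zero:
  assumes "module R M" "module R N" "f \<in> mod_hom R M N"
  shows "f \<zero>\<^bsub>M\<^esub> = \<zero>\<^bsub>N\<^esub>"
proof -
  interpret M: module R M by fact
  interpret N: module R N by fact
  show ?thesis
    using mod_hom_smult[OF assms(3), of "\<zero>\<^bsub>R\<^esub>" "\<zero>\<^bsub>M\<^esub>"] mod_hom_closed[OF assms(3), of "\<zero>\<^bsub>M\<^esub>"]
    by simp
qed

lemma mod_hom_neg:
  assumes "module R M" "module R N" "f \<in> mod_hom R M N" "x \<in> carrier M"
  shows "f (\<ominus>\<^bsub>M\<^esub> x) = \<ominus>\<^bsub>N\<^esub> f x"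
proof -
  interpret M: module R M by fact
  interpret N: module R N by fact
  have "\<ominus>\<^bsub>M\<^esub> x = (\<ominus>\<^bsub>R\<^esub> \<one>\<^bsub>R\<^esub>) \<odot>\<^bsub>M\<^esub> x" using assms(4) by (simp add: M.smult_l_minus)
  then show ?thesis using assms(4)
    by (simp add: mod_hom_smult[OF assms(3)] mod_hom_closed[OF assms(3)] N.smult_l_minus)
qed

lemma mod_hom_minus:
  assumes "module R M" "module R N" "f \<in> mod_hom R M N" "x \<in> carrier M" "y \<in> carrier M"
  shows "f (x \<ominus>\<^bsub>M\<^esub> y) = f x \<ominus>\<^bsub>N\<^esub> f y"
proof -
  interpret M: module R M by fact
  interpret N: module R N by fact
  show ?thesis using assms(4,5)
    by (simp add: a_minus_def mod_hom_add[OF assms(3)] mod_hom_neg[OF assms(1-3)])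
qed

lemma mod_hom_finsum:
  assumes "module R M" "module R N" "f \<in> mod_hom R M N" "finite A" "g \<in> A \<rightarrow> carrier M"
  shows "f (\<Oplus>\<^bsub>M\<^esub>i\<in>A. g i) = (\<Oplus>\<^bsub>N\<^esub>i\<in>A. f (g i))"
  using assms(4,5)
proof (induction A)
  interpret M: module R M by fact
  interpret N: module R N by fact
  case empty
  show ?case by (simp add: mod_hom_zero[OF assms(1-3)])
next
  interpret M: module R M by fact
  interpret N: module R N by fact
  case (insert a A)
  then show ?case
    by (simp add: Pi_def mod_hom_add[OF assms(3)] mod_hom_closed[OF assms(3)])
qed

lemma mod_hom_compose:
  assumes "module R M" "f \<in> mod_hom R M N" "g \<in> mod_hom R N P"
  shows "compose (carrier M) g f \<in> mod_hom R M P"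
  unfolding compose_def
  by (rule mod_hom_restrictI[OF assms(1)])
    (simp_all add: mod_hom_closed[OF assms(3)] mod_hom_closed[OF assms(2)]
      mod_hom_add[OF assms(3)] mod_hom_add[OF assms(2)]
      mod_hom_smult[OF assms(3)] mod_hom_smult[OF assms(2)])

lemma mod_hom_pointwise_add:
  assumes "module R M" "module R N" "f \<in> mod_hom R M N" "g \<in> mod_hom R M N"
  shows "(\<lambda>x\<in>carrier M. f x \<oplus>\<^bsub>N\<^esub> g x) \<in> mod_hom R M N"
proof -
  interpret N: module R N by fact
  show ?thesis
    by (rule mod_hom_restrictI[OF assms(1)])
      (simp_all add: mod_hom_closed[OF assms(3)] mod_hom_closed[OF assms(4)]
      mod_hom_add[OF assms(3)] mod_hom_add[OF assms(4)]
      mod_hom_smult[OF assms(3)] mod_hom_smult[OF assms(4)] N.M.a_ac N.smult_r_distr)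
qed

lemma mod_hom_pointwise_smult:
  assumes "module R M" "module R N" "f \<in> mod_hom R M N" "a \<in> carrier R"
  shows "(\<lambda>x\<in>carrier M. a \<odot>\<^bsub>N\<^esub> f x) \<in> mod_hom R M N"
proof -
  interpret N: module R N by fact
  show ?thesis using assms(4)
    by (intro mod_hom_restrictI[OF assms(1)])
      (simp_all add: mod_hom_closed[OF assms(3)] 
      mod_hom_add[OF assms(3)] mod_hom_smult[OF assms(3)] N.smult_r_distr
      N.smult_assoc1[symmetric] N.R.m_comm)
qed

lemma mod_hom_restrict_carrier:
  assumes "f \<in> mod_hom R M N" "K \<subseteq> carrier M" "\<And>x. x \<in> K \<Longrightarrow> f x \<in> L"
    "module R (M\<lparr>carrier := K\<rparr>)"
  shows "(\<lambda>x\<in>K. f x) \<in> mod_hom R (M\<lparr>carrier := K\<rparr>) (N\<lparr>carrier := L\<rparr>)"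
  using mod_hom_restrictI[OF assms(4), of f "N\<lparr>carrier := L\<rparr>"] assms(1-3)
  by (auto simp: mod_hom_def subset_iff)

lemma module_restrict_carrier:
  assumes "module R M" "K \<subseteq> carrier M" "\<zero>\<^bsub>M\<^esub> \<in> K"
    "\<And>x y. x \<in> K \<Longrightarrow> y \<in> K \<Longrightarrow> x \<oplus>\<^bsub>M\<^esub> y \<in> K"
    "\<And>r x. r \<in> carrier R \<Longrightarrow> x \<in> K \<Longrightarrow> r \<odot>\<^bsub>M\<^esub> x \<in> K"
  shows "module R (M\<lparr>carrier := K\<rparr>)"
proof -
  interpret M: module R M by fact
  have "\<ominus>\<^bsub>M\<^esub> x \<in> K" if "x \<in> K" for x
    using assms(5)[of "\<ominus>\<^bsub>R\<^esub> \<one>\<^bsub>R\<^esub>" x] assms(2) that by (auto simp: M.smult_l_minus)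
  then have "submodule K R M"
    using assms by (intro M.submoduleI) auto
  then show ?thesis by (rule submodule.submodule_is_module) fact
qed

lemma module_kernel:
  assumes "module R M" "module R N" "f \<in> mod_hom R M N"
  shows "module R (M\<lparr>carrier := {x \<in> carrier M. f x = \<zero>\<^bsub>N\<^esub>}\<rparr>)"
proof -
  interpret M: module R M by fact
  interpret N: module R N by fact
  show ?thesis
    by (rule module_restrict_carrier[OF assms(1)])
      (auto simp: mod_hom_zero[OF assms] mod_hom_add[OF assms(3)] mod_hom_smult[OF assms(3)])
qed

lemma (in abelian_group) minus_eq_zero_iff:
  "x \<in> carrier G \<Longrightarrow> y \<in> carrier G \<Longrightarrow> x \<ominus> y = \<zero> \<longleftrightarrow> x = y"
  by (metis a_minus_def add.inv_closed minus_equality minus_minus r_neg)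

text \<open>
  Every module axiom is an identity, or asserts an inverse, so it passes to the target of a
  surjection compatible with the operations. This spares a verification on cosets for quotient
  modules and one on cochains for the cocycles of \<^const>\<open>Ext1\<close>.
\<close>

lemma module_surj_image:
  assumes "module R M"
    and surj: "f ` carrier M = carrier N"
    and add: "\<And>x y. x \<in> carrier M \<Longrightarrow> y \<in> carrier M \<Longrightarrow> f (x \<oplus>\<^bsub>M\<^esub> y) = f x \<oplus>\<^bsub>N\<^esub> f y"
    and smult: "\<And>r x. r \<in> carrier R \<Longrightarrow> x \<in> carrier M \<Longrightarrow> f (r \<odot>\<^bsub>M\<^esub> x) = r \<odot>\<^bsub>N\<^esub> f x"
    and zero: "f \<zero>\<^bsub>M\<^esub> = \<zero>\<^bsub>N\<^esub>"
  shows "module R N"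
proof -
  interpret M: module R M by fact
  have ex: "\<exists>y\<in>carrier M. x = f y" if "x \<in> carrier N" for x using that surj by auto
  have cl: "f y \<in> carrier N" if "y \<in> carrier M" for y using that surj by auto
  have "abelian_group N"
  proof (rule abelian_groupI)
    fix x y z assume xyz: "x \<in> carrier N" "y \<in> carrier N" "z \<in> carrier N"
    then show "(x \<oplus>\<^bsub>N\<^esub> y) \<oplus>\<^bsub>N\<^esub> z = x \<oplus>\<^bsub>N\<^esub> (y \<oplus>\<^bsub>N\<^esub> z)"
      by (auto dest!: ex simp: add[symmetric] M.M.a_assoc)
  next
    fix x assume "x \<in> carrier N"
    then obtain y where y: "y \<in> carrier M" "x = f y" using ex by blast
    show "\<exists>z\<in>carrier N. z \<oplus>\<^bsub>N\<^esub> x = \<zero>\<^bsub>N\<^esub>"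
      using y by (intro bexI[of _ "f (\<ominus>\<^bsub>M\<^esub> y)"]) (simp_all add: cl add[symmetric] M.M.l_neg zero)
    show "\<zero>\<^bsub>N\<^esub> \<oplus>\<^bsub>N\<^esub> x = x" using y by (simp add: zero[symmetric] add[symmetric])
  next
    show "\<zero>\<^bsub>N\<^esub> \<in> carrier N" using cl[of "\<zero>\<^bsub>M\<^esub>"] zero by simp
  qed (auto dest!: ex simp: add[symmetric] M.M.a_comm intro!: cl)
  then show ?thesis
    by (rule moduleI[OF M.R.is_cring])
      (auto dest!: ex intro!: cl simp: add[symmetric] smult[symmetric]
        M.smult_l_distr M.smult_r_distr M.smult_assoc1)
qed

lemma module_quot_module:
  assumes "module R M" "module R (M\<lparr>carrier := K\<rparr>)" "K \<subseteq> carrier M"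
  shows "module R (quot_module M K)"
    and "(\<lambda>x\<in>carrier M. K +>\<^bsub>M\<^esub> x) \<in> mod_hom R M (quot_module M K)"
    and "x \<in> carrier M \<Longrightarrow> K +>\<^bsub>M\<^esub> x = K \<longleftrightarrow> x \<in> K"
proof -
  interpret M: module R M by fact
  have sub: "submodule K R M" by (rule M.module_incl_imp_submodule) fact+
  note subE = M.submoduleE[OF sub]
  interpret A: abelian_subgroup K M
    by (rule abelian_subgroupI3[OF additive_subgroup.intro[OF submodule.axioms(1)[OF sub]] M.M.abelian_group_axioms])
  let ?Q = "quot_module M K"
  have add: "K +>\<^bsub>M\<^esub> (x \<oplus>\<^bsub>M\<^esub> y) = (K +>\<^bsub>M\<^esub> x) \<oplus>\<^bsub>?Q\<^esub> (K +>\<^bsub>M\<^esub> y)"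
    if "x \<in> carrier M" "y \<in> carrier M" for x y
    using that by (simp add: quot_module_def A.a_rcos_sum)
  have smult: "K +>\<^bsub>M\<^esub> (r \<odot>\<^bsub>M\<^esub> x) = r \<odot>\<^bsub>?Q\<^esub> (K +>\<^bsub>M\<^esub> x)"
    if r: "r \<in> carrier R" and x: "x \<in> carrier M" for r x
  proof -
    have *: "K +>\<^bsub>M\<^esub> (r \<odot>\<^bsub>M\<^esub> y) = K +>\<^bsub>M\<^esub> (r \<odot>\<^bsub>M\<^esub> x)" if y: "y \<in> K +>\<^bsub>M\<^esub> x" for y
    proof -
      obtain k where k: "k \<in> K" "y = k \<oplus>\<^bsub>M\<^esub> x" using y by (auto simp: a_r_coset_def')
      have "r \<odot>\<^bsub>M\<^esub> y \<in> K +>\<^bsub>M\<^esub> (r \<odot>\<^bsub>M\<^esub> x)"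
        using k subE(1,4) r x by (auto simp: a_r_coset_def' M.smult_r_distr subset_iff)
      then show ?thesis
        using r x by (intro M.M.a_repr_independence[symmetric] A.a_subgroup) auto
    qed
    have "x \<in> K +>\<^bsub>M\<^esub> x" using x by (rule A.a_rcos_self)
    from UN_constant_eq[OF this ballI[OF *]] show ?thesis by (simp add: quot_module_def)
  qed
  have zero: "K +>\<^bsub>M\<^esub> \<zero>\<^bsub>M\<^esub> = \<zero>\<^bsub>?Q\<^esub>" 
    using A.a_subset by (simp add: quot_module_def)
  have carr: "(\<lambda>x. K +>\<^bsub>M\<^esub> x) ` carrier M = carrier ?Q"
    by (auto simp: quot_module_def A_RCOSETS_def')
  show "module R ?Q"
    by (rule module_surj_image[OF assms(1) carr add smult zero])
  show "(\<lambda>x\<in>carrier M. K +>\<^bsub>M\<^esub> x) \<in> mod_hom R M (quot_module M K)"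
    using carr add smult by (intro mod_hom_restrictI[OF assms(1)]) auto
  show "K +>\<^bsub>M\<^esub> x = K \<longleftrightarrow> x \<in> K" if "x \<in> carrier M"
    using A.a_rcos_self[OF that] A.a_rcos_const[of x] by blast
qed

section \<open>Free modules\<close>

lemma free_module_simps [simp]:
  "zero (free_module R B) = (\<lambda>b\<in>B. \<zero>\<^bsub>R\<^esub>)"
  "add (free_module R B) = (\<lambda>f g. \<lambda>b\<in>B. f b \<oplus>\<^bsub>R\<^esub> g b)"
  "smult (free_module R B) = (\<lambda>r f. \<lambda>b\<in>B. r \<otimes>\<^bsub>R\<^esub> f b)"
  by (simp_all add: free_module_def)

lemma free_module_carrierI:
  assumes "f \<in> B \<rightarrow>\<^sub>E carrier R" "finite A" "\<And>b. b \<in> B \<Longrightarrow> b \<notin> A \<Longrightarrow> f b = \<zero>\<^bsub>R\<^esub>"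
  shows "f \<in> carrier (free_module R B)"
proof -
  have "{b \<in> B. f b \<noteq> \<zero>\<^bsub>R\<^esub>} \<subseteq> A" using assms(3) by blast
  then show ?thesis using assms(1,2) by (auto simp: free_module_def dest: finite_subset)
qed

lemma free_module_carrierD:
  assumes "f \<in> carrier (free_module R B)"
  shows "f \<in> B \<rightarrow>\<^sub>E carrier R" "finite {b \<in> B. f b \<noteq> \<zero>\<^bsub>R\<^esub>}"
    "b \<in> B \<Longrightarrow> f b \<in> carrier R"
  using assms by (auto simp: free_module_def)

lemma module_free_module:
  assumes "cring R"
  shows "module R (free_module R B)"
proof -
  interpret cring R by fact
  let ?F = "free_module R B"
  have add: "f \<oplus>\<^bsub>?F\<^esub> g \<in> carrier ?F" if "f \<in> carrier ?F" "g \<in> carrier ?F" for f g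
    using free_module_carrierD[OF that(1)] free_module_carrierD[OF that(2)]
    by (intro free_module_carrierI[of _ _ _ "{b \<in> B. f b \<noteq> \<zero>\<^bsub>R\<^esub>} \<union> {b \<in> B. g b \<noteq> \<zero>\<^bsub>R\<^esub>}"]) auto
  have smult: "r \<odot>\<^bsub>?F\<^esub> f \<in> carrier ?F" if "r \<in> carrier R" "f \<in> carrier ?F" for r f
    using free_module_carrierD[OF that(2)] that(1)
    by (intro free_module_carrierI[of _ _ _ "{b \<in> B. f b \<noteq> \<zero>\<^bsub>R\<^esub>}"]) auto
  have "abelian_group ?F"
  proof (rule abelian_groupI)
    fix f assume f: "f \<in> carrier ?F"
    note f' = free_module_carrierD[OF f]
    show "\<zero>\<^bsub>?F\<^esub> \<oplus>\<^bsub>?F\<^esub> f = f"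
      using f' by (intro extensionalityI[of _ B]) (auto simp: PiE_def)
    have "(\<lambda>b\<in>B. \<ominus>\<^bsub>R\<^esub> f b) \<in> carrier ?F"
      using f' by (intro free_module_carrierI[of _ _ _ "{b \<in> B. f b \<noteq> \<zero>\<^bsub>R\<^esub>}"]) auto
    then show "\<exists>g\<in>carrier ?F. g \<oplus>\<^bsub>?F\<^esub> f = \<zero>\<^bsub>?F\<^esub>"
      using f' by (intro bexI[of _ "\<lambda>b\<in>B. \<ominus>\<^bsub>R\<^esub> f b"]) (auto simp: l_neg)
  next
    show "\<zero>\<^bsub>?F\<^esub> \<in> carrier ?F" by (rule free_module_carrierI[of _ _ _ "{}"]) auto
  qed (auto simp del: free_module_simps intro: add,
      auto dest!: free_module_carrierD(3) simp: a_ac intro!: restrict_ext)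
  then show ?thesis
  proof (rule moduleI[OF assms])
    fix f assume f: "f \<in> carrier ?F"
    show "\<one>\<^bsub>R\<^esub> \<odot>\<^bsub>?F\<^esub> f = f"
      using free_module_carrierD[OF f] by (intro extensionalityI[of _ B]) (auto simp: PiE_def)
  qed (auto simp del: free_module_simps intro: smult,
      auto dest!: free_module_carrierD(3) simp: l_distr r_distr m_assoc intro!: restrict_ext)
qed

definition basis_vector :: "('a, 'x) ring_scheme \<Rightarrow> 'b set \<Rightarrow> 'b \<Rightarrow> 'b \<Rightarrow> 'a" where
  "basis_vector R B b = (\<lambda>c\<in>B. if c = b then \<one>\<^bsub>R\<^esub> else \<zero>\<^bsub>R\<^esub>)"

text \<open>
  The universal property of the free module: the linear extension of \<open>\<sigma>\<close>.
\<close>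

definition free_lift :: "('a, 'x) ring_scheme \<Rightarrow> ('a, 'm, 'y) module_scheme \<Rightarrow> 'b set \<Rightarrow>
    ('b \<Rightarrow> 'm) \<Rightarrow> ('b \<Rightarrow> 'a) \<Rightarrow> 'm" where
  "free_lift R N B \<sigma> = (\<lambda>f\<in>carrier (free_module R B).
     \<Oplus>\<^bsub>N\<^esub>b\<in>{b \<in> B. f b \<noteq> \<zero>\<^bsub>R\<^esub>}. f b \<odot>\<^bsub>N\<^esub> \<sigma> b)"

lemma eval_map_eq_free_lift: "eval_map R N B = free_lift R N B (\<lambda>b. b)"
  by (simp add: eval_map_def free_lift_def)

lemma basis_vector_closed:
  assumes "cring R"
  shows "basis_vector R B b \<in> carrier (free_module R B)"
proof -
  interpret cring R by fact
  show ?thesis unfolding basis_vector_def by (rule free_module_carrierI[of _ _ _ "{b}"]) auto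
qed

text \<open>
  The sum defining the linear extension runs over the support of \<open>f\<close>. For additivity both
  summands have to be expressed over one common finite index set.
\<close>

lemma free_lift_eq_sum:
  assumes "module R N" "\<sigma> \<in> B \<rightarrow> carrier N" "f \<in> carrier (free_module R B)"
    "finite A" "A \<subseteq> B" "\<And>b. b \<in> B \<Longrightarrow> b \<notin> A \<Longrightarrow> f b = \<zero>\<^bsub>R\<^esub>"
  shows "free_lift R N B \<sigma> f = (\<Oplus>\<^bsub>N\<^esub>b\<in>A. f b \<odot>\<^bsub>N\<^esub> \<sigma> b)"
proof -
  interpret N: module R N by fact
  have "(\<Oplus>\<^bsub>N\<^esub>b\<in>{b \<in> B. f b \<noteq> \<zero>\<^bsub>R\<^esub>}. f b \<odot>\<^bsub>N\<^esub> \<sigma> b) = (\<Oplus>\<^bsub>N\<^esub>b\<in>A. f b \<odot>\<^bsub>N\<^esub> \<sigma> b)"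
    using assms(2-6) free_module_carrierD[OF assms(3)]
    by (intro N.M.add.finprod_mono_neutral_cong_left) (auto simp: Pi_def)
  then show ?thesis using assms(3) by (simp add: free_lift_def)
qed

lemma free_lift_mod_hom:
  assumes "module R N" "\<sigma> \<in> B \<rightarrow> carrier N"
  shows "free_lift R N B \<sigma> \<in> mod_hom R (free_module R B) N"
proof -
  interpret N: module R N by fact
  interpret F: module R "free_module R B" by (rule module_free_module[OF N.R.is_cring])
  let ?F = "free_module R B"
  let ?l = "free_lift R N B \<sigma>"
  note sum = free_lift_eq_sum[OF assms]
  let ?supp = "\<lambda>f. {b \<in> B. f b \<noteq> \<zero>\<^bsub>R\<^esub>}"
  have cl: "f b \<odot>\<^bsub>N\<^esub> \<sigma> b \<in> carrier N" if "f \<in> carrier ?F" "b \<in> B" for f b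
    using that assms(2) free_module_carrierD(3)[OF that] by auto
  have "(\<lambda>f\<in>carrier ?F. ?l f) \<in> mod_hom R ?F N"
  proof (rule mod_hom_restrictI[OF F.module_axioms])
    fix f assume f: "f \<in> carrier ?F"
    show "?l f \<in> carrier N"
      using cl[OF f] f by (auto simp: free_lift_def intro!: N.M.finsum_closed)
    fix g assume g: "g \<in> carrier ?F"
    let ?A = "?supp f \<union> ?supp g"
    have A: "finite ?A" "?A \<subseteq> B"
      using free_module_carrierD(2)[OF f] free_module_carrierD(2)[OF g] by auto
    have "?l (f \<oplus>\<^bsub>?F\<^esub> g) = (\<Oplus>\<^bsub>N\<^esub>b\<in>?A. (f \<oplus>\<^bsub>?F\<^esub> g) b \<odot>\<^bsub>N\<^esub> \<sigma> b)"
      using f g A F.M.a_closed[OF f g] by (intro sum) auto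
    also have "\<dots> = (\<Oplus>\<^bsub>N\<^esub>b\<in>?A. f b \<odot>\<^bsub>N\<^esub> \<sigma> b \<oplus>\<^bsub>N\<^esub> g b \<odot>\<^bsub>N\<^esub> \<sigma> b)"
      using f g assms(2) free_module_carrierD(3)[OF f] free_module_carrierD(3)[OF g]
      by (intro N.M.finsum_cong') (auto simp: N.smult_l_distr Pi_def)
    also have "\<dots> = (\<Oplus>\<^bsub>N\<^esub>b\<in>?A. f b \<odot>\<^bsub>N\<^esub> \<sigma> b) \<oplus>\<^bsub>N\<^esub> (\<Oplus>\<^bsub>N\<^esub>b\<in>?A. g b \<odot>\<^bsub>N\<^esub> \<sigma> b)"
      using cl[OF f] cl[OF g] by (intro N.M.finsum_addf) auto
    also have "\<dots> = ?l f \<oplus>\<^bsub>N\<^esub> ?l g"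
      using sum[OF f A] sum[OF g A] by auto
    finally show "?l (f \<oplus>\<^bsub>?F\<^esub> g) = ?l f \<oplus>\<^bsub>N\<^esub> ?l g" .
  next
    fix r f assume r: "r \<in> carrier R" and f: "f \<in> carrier ?F"
    let ?A = "?supp f"
    have A: "finite ?A" "?A \<subseteq> B" using free_module_carrierD(2)[OF f] by auto
    have "?l (r \<odot>\<^bsub>?F\<^esub> f) = (\<Oplus>\<^bsub>N\<^esub>b\<in>?A. (r \<odot>\<^bsub>?F\<^esub> f) b \<odot>\<^bsub>N\<^esub> \<sigma> b)"
      using r A F.smult_closed[OF r f] by (intro sum) auto
    also have "\<dots> = (\<Oplus>\<^bsub>N\<^esub>b\<in>?A. r \<odot>\<^bsub>N\<^esub> (f b \<odot>\<^bsub>N\<^esub> \<sigma> b))"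
      using r f assms(2) free_module_carrierD(3)[OF f]
      by (intro N.M.finsum_cong') (auto simp: N.smult_assoc1 Pi_def)
    also have "\<dots> = r \<odot>\<^bsub>N\<^esub> ?l f"
      using cl[OF f] r A f by (simp add: free_lift_def N.finsum_smult_ldistr Pi_def)
    finally show "?l (r \<odot>\<^bsub>?F\<^esub> f) = r \<odot>\<^bsub>N\<^esub> ?l f" .
  qed
  moreover have "(\<lambda>f\<in>carrier ?F. ?l f) = ?l" unfolding free_lift_def by auto
  ultimately show ?thesis by simp
qed

lemma free_lift_basis_vector:
  assumes "module R N" "\<sigma> \<in> B \<rightarrow> carrier N" "b \<in> B"
  shows "free_lift R N B \<sigma> (basis_vector R B b) = \<sigma> b"
proof -
  interpret N: module R N by fact
  have "free_lift R N B \<sigma> (basis_vector R B b)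
      = (\<Oplus>\<^bsub>N\<^esub>c\<in>{b}. basis_vector R B b c \<odot>\<^bsub>N\<^esub> \<sigma> c)"
    using assms(3) 
    by (intro free_lift_eq_sum assms(1,2) basis_vector_closed N.R.is_cring) (auto simp: basis_vector_def)
  also have "\<dots> = \<sigma> b" using assms(2,3) by (auto simp: basis_vector_def Pi_def)
  finally show ?thesis .
qed

lemma eval_map_mod_hom:
  assumes "module R N" "B \<subseteq> carrier N"
  shows "eval_map R N B \<in> mod_hom R (free_module R B) N"
  unfolding eval_map_eq_free_lift using assms by (intro free_lift_mod_hom) auto

lemma eval_map_basis_vector:
  assumes "module R N" "B \<subseteq> carrier N" "b \<in> B"
  shows "eval_map R N B (basis_vector R B b) = b"
  unfolding eval_map_eq_free_lift using assms by (intro free_lift_basis_vector) auto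

lemma mod_hom_free_lift:
  assumes "module R N" "module R P" "\<pi> \<in> mod_hom R N P" "\<sigma> \<in> B \<rightarrow> carrier N"
    "x \<in> carrier (free_module R B)"
  shows "\<pi> (free_lift R N B \<sigma> x) = free_lift R P B (\<lambda>b. \<pi> (\<sigma> b)) x"
proof -
  interpret N: module R N by fact
  interpret P: module R P by fact
  note x = free_module_carrierD[OF assms(5)]
  have "\<pi> (\<Oplus>\<^bsub>N\<^esub>b\<in>{b \<in> B. x b \<noteq> \<zero>\<^bsub>R\<^esub>}. x b \<odot>\<^bsub>N\<^esub> \<sigma> b) = (\<Oplus>\<^bsub>P\<^esub>b\<in>{b \<in> B. x b \<noteq> \<zero>\<^bsub>R\<^esub>}. \<pi> (x b \<odot>\<^bsub>N\<^esub> \<sigma> b))"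
    using x assms(4) by (intro mod_hom_finsum[OF assms(1-3)]) auto
  also have "\<dots> = (\<Oplus>\<^bsub>P\<^esub>b\<in>{b \<in> B. x b \<noteq> \<zero>\<^bsub>R\<^esub>}. x b \<odot>\<^bsub>P\<^esub> \<pi> (\<sigma> b))"
    using x assms(4) mod_hom_smult[OF assms(3)] mod_hom_closed[OF assms(3)]
    by (intro P.M.finsum_cong') (auto simp: Pi_def)
  finally show ?thesis using assms(5) by (simp add: free_lift_def)
qed

section \<open>The first extension module\<close>

text \<open>
  Homomorphisms on the first syzygy (the kernel \<open>K\<^sub>0\<close> of \<open>F\<^sub>0 \<rightarrow> M\<close>) are a convenient form of the
  cocycles: since \<open>F\<^sub>1 \<rightarrow> K\<^sub>0\<close> is onto with kernel the image of \<open>F\<^sub>2\<close>, the cocycles on \<open>F\<^sub>1\<close> are exactly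
  the pullbacks of the homomorphisms on \<open>K\<^sub>0\<close>, and the coboundaries are the pullbacks of those that
  extend to \<open>F\<^sub>0\<close>. Hence \<open>Ext\<^sup>1(M, C)\<close> is the cokernel of \<open>Hom(F\<^sub>0, C) \<rightarrow> Hom(K\<^sub>0, C)\<close>.
\<close>

abbreviation ext_cover :: "('a, 'x) ring_scheme \<Rightarrow> ('a, 'm, 'y) module_scheme \<Rightarrow> ('a, 'm \<Rightarrow> 'a) module" where
  "ext_cover R M \<equiv> free_module R (carrier M)"

abbreviation ext_syzygy :: "('a, 'x) ring_scheme \<Rightarrow> ('a, 'm, 'y) module_scheme \<Rightarrow> ('a, 'm \<Rightarrow> 'a) module" where
  "ext_syzygy R M \<equiv> (ext_cover R M)\<lparr>carrier := eval_kernel R M (carrier M)\<rparr>"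

lemma module_eval_kernel:
  assumes "module R N" "B \<subseteq> carrier N"
  shows "module R ((free_module R B)\<lparr>carrier := eval_kernel R N B\<rparr>)"
proof -
  interpret N: module R N by fact
  show ?thesis unfolding eval_kernel_def
    by (rule module_kernel[OF module_free_module[OF N.R.is_cring] assms(1) eval_map_mod_hom[OF assms]])
qed

lemma eval_map_in_kernel:
  assumes "module R N" "module R P" "\<pi> \<in> mod_hom R N P" "B \<subseteq> carrier N"
    "\<And>b. b \<in> B \<Longrightarrow> \<pi> b = \<zero>\<^bsub>P\<^esub>" "x \<in> carrier (free_module R B)"
  shows "\<pi> (eval_map R N B x) = \<zero>\<^bsub>P\<^esub>"
proof -
  interpret P: module R P by fact
  have "\<pi> (eval_map R N B x) = free_lift R P B \<pi> x"
    unfolding eval_map_eq_free_lift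
    using assms(4,6) by (intro mod_hom_free_lift[OF assms(1-3)]) auto
  also have "\<dots> = \<zero>\<^bsub>P\<^esub>"
    unfolding free_lift_def restrict_apply'[OF assms(6)]
    using assms(5) free_module_carrierD(3)[OF assms(6)]
    by (intro P.M.add.finprod_one_eqI) auto
  finally show ?thesis .
qed

text \<open>
  A homomorphism on a free module that kills the relations between the elements of a submodule
  \<open>B\<close> descends to \<open>B\<close>. It is evaluated on basis vectors because these are preimages under the
  evaluation map, and two preimages of one element differ by a relation.
\<close>

lemma eval_kernel_hom_factors:
  fixes R (structure)
  assumes N: "module R N" and B: "B \<subseteq> carrier N" and C: "module R C"
    and f: "f \<in> mod_hom R (free_module R B) C"
    and vanish: "\<And>x. x \<in> eval_kernel R N B \<Longrightarrow> f x = \<zero>\<^bsub>C\<^esub>"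
    and sub: "module R (N\<lparr>carrier := B\<rparr>)"
  shows "(\<lambda>b\<in>B. f (basis_vector R B b)) \<in> mod_hom R (N\<lparr>carrier := B\<rparr>) C"
    and "x \<in> carrier (free_module R B) \<Longrightarrow> eval_map R N B x \<in> B \<Longrightarrow>
      f (basis_vector R B (eval_map R N B x)) = f x"
proof -
  interpret N: module R N by fact
  interpret C: module R C by fact
  let ?F = "free_module R B" and ?d = "eval_map R N B" and ?e = "basis_vector R B"
  interpret F: module R ?F by (rule module_free_module[OF N.R.is_cring])
  interpret S: module R "N\<lparr>carrier := B\<rparr>" by fact
  note d = eval_map_mod_hom[OF N B]
  note e = basis_vector_closed[OF N.R.is_cring, of B]
  note de = eval_map_basis_vector[OF N B]
  have same: "f x = f y" if xy: "x \<in> carrier ?F" "y \<in> carrier ?F" and "?d x = ?d y" for x y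
  proof -
    have "?d (x \<ominus>\<^bsub>?F\<^esub> y) = \<zero>\<^bsub>N\<^esub>"
      using that mod_hom_closed[OF d]
      by (simp add: mod_hom_minus[OF F.module_axioms N d] N.M.minus_eq N.M.r_neg)
    then have "f (x \<ominus>\<^bsub>?F\<^esub> y) = \<zero>\<^bsub>C\<^esub>" using xy by (intro vanish) (simp add: eval_kernel_def)
    then show ?thesis using xy mod_hom_closed[OF f]
      by (simp add: mod_hom_minus[OF F.module_axioms C f] C.M.minus_eq_zero_iff)
  qed
  show "f (?e (?d x)) = f x" if "x \<in> carrier ?F" "?d x \<in> B"
    using that by (intro same e de) auto
  have "(\<lambda>b\<in>carrier (N\<lparr>carrier := B\<rparr>). f (?e b)) \<in> mod_hom R (N\<lparr>carrier := B\<rparr>) C"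
  proof (rule mod_hom_restrictI[OF S.module_axioms])
    fix a b assume "a \<in> carrier (N\<lparr>carrier := B\<rparr>)" "b \<in> carrier (N\<lparr>carrier := B\<rparr>)"
    then have ab: "a \<in> B" "b \<in> B" "a \<oplus>\<^bsub>N\<^esub> b \<in> B" using S.M.a_closed[of a b] by auto
    have "f (?e (a \<oplus>\<^bsub>N\<^esub> b)) = f (?e a \<oplus>\<^bsub>?F\<^esub> ?e b)"
      using ab by (intro same) (simp_all del: free_module_simps add: e de mod_hom_add[OF d])
    then show "f (?e (a \<oplus>\<^bsub>N\<lparr>carrier := B\<rparr>\<^esub> b)) = f (?e a) \<oplus>\<^bsub>C\<^esub> f (?e b)"
      by (simp del: free_module_simps add: e mod_hom_add[OF f])
  next
    fix r b assume r: "r \<in> carrier R" and "b \<in> carrier (N\<lparr>carrier := B\<rparr>)"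
    then have b: "b \<in> B" "r \<odot>\<^bsub>N\<^esub> b \<in> B" using S.smult_closed[of r b] by auto
    have "f (?e (r \<odot>\<^bsub>N\<^esub> b)) = f (r \<odot>\<^bsub>?F\<^esub> ?e b)"
      using b r by (intro same) (simp_all del: free_module_simps add: e de mod_hom_smult[OF d])
    then show "f (?e (r \<odot>\<^bsub>N\<lparr>carrier := B\<rparr>\<^esub> b)) = r \<odot>\<^bsub>C\<^esub> f (?e b)"
      using r by (simp del: free_module_simps add: e mod_hom_smult[OF f])
  qed (auto simp: e mod_hom_closed[OF f])
  then show "(\<lambda>b\<in>B. f (?e b)) \<in> mod_hom R (N\<lparr>carrier := B\<rparr>) C" by simp
qed

lemma Hom_module_simps [simp]:
  "carrier (Hom_module R M N) = mod_hom R M N"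
  "zero (Hom_module R M N) = (\<lambda>x\<in>carrier M. \<zero>\<^bsub>N\<^esub>)"
  "add (Hom_module R M N) = (\<lambda>f g. \<lambda>x\<in>carrier M. f x \<oplus>\<^bsub>N\<^esub> g x)"
  "smult (Hom_module R M N) = (\<lambda>r f. \<lambda>x\<in>carrier M. r \<odot>\<^bsub>N\<^esub> f x)"
  by (simp_all add: Hom_module_def)

lemma module_Hom_module:
  assumes M: "module R M" and N: "module R N"
  shows "module R (Hom_module R M N)"
proof -
  interpret M: module R M by fact
  interpret N: module R N by fact
  note cl [simp] = mod_hom_closed[where R = R and M = M and N = N]
  note ext = extensionalityI[where A = "carrier M"]
  have mext: "f \<in> extensional (carrier M)" if "f \<in> mod_hom R M N" for f
    using that unfolding mod_hom_def PiE_def by blast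
  have zero: "(\<lambda>x\<in>carrier M. \<zero>\<^bsub>N\<^esub>) \<in> mod_hom R M N"
    by (rule mod_hom_restrictI[OF M]) auto
  have "abelian_group (Hom_module R M N)"
  proof (rule abelian_groupI)
    fix f assume f: "f \<in> carrier (Hom_module R M N)"
    then show "\<zero>\<^bsub>Hom_module R M N\<^esub> \<oplus>\<^bsub>Hom_module R M N\<^esub> f = f"
      by (intro ext) (auto simp: mext)
    show "\<exists>g\<in>carrier (Hom_module R M N). g \<oplus>\<^bsub>Hom_module R M N\<^esub> f = \<zero>\<^bsub>Hom_module R M N\<^esub>"
      using f mod_hom_pointwise_smult[OF M N, of f "\<ominus>\<^bsub>R\<^esub> \<one>\<^bsub>R\<^esub>"]
      by (intro bexI[of _ "\<lambda>x\<in>carrier M. (\<ominus>\<^bsub>R\<^esub> \<one>\<^bsub>R\<^esub>) \<odot>\<^bsub>N\<^esub> f x"] ext)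
        (auto simp: N.smult_l_minus N.M.l_neg)
  qed (auto simp: zero mod_hom_pointwise_add[OF M N] N.M.a_ac intro!: ext)
  then show ?thesis
    by (rule moduleI[OF M.R.is_cring])
      (auto simp: mext mod_hom_pointwise_smult[OF M N] N.smult_l_distr N.smult_r_distr
        N.smult_assoc1 intro!: ext)
qed

text \<open>
  Cocycles and coboundaries rewritten as pullbacks along \<open>d1\<close>. A cocycle vanishes on the kernel of
  \<open>d1\<close>, because every element \<open>z\<close> of that kernel is the image of its own basis vector in \<open>F\<^sub>2\<close>;
  therefore it descends to the syzygy.
\<close>

lemma Ext1_eq:
  assumes M: "module R M" and C: "module R C"
  defines "F0 \<equiv> ext_cover R M" and "K0 \<equiv> eval_kernel R M (carrier M)"
  defines "F1 \<equiv> free_module R K0" and "d1 \<equiv> eval_map R F0 K0"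
  shows "d1 \<in> mod_hom R F1 F0" and "\<And>x. x \<in> carrier F1 \<Longrightarrow> d1 x \<in> K0"
    and "Ext1 R M C = quot_module
      ((Hom_module R F1 C)\<lparr>carrier := (\<lambda>g. compose (carrier F1) g d1) ` mod_hom R (ext_syzygy R M) C\<rparr>)
      ((\<lambda>g. compose (carrier F1) g d1) ` mod_hom R F0 C)"
proof -
  interpret M: module R M by fact
  interpret C: module R C by fact
  interpret F0: module R F0 unfolding F0_def by (rule module_free_module[OF M.R.is_cring])
  interpret F1: module R F1 unfolding F1_def by (rule module_free_module[OF M.R.is_cring])
  define K1 where "K1 = eval_kernel R F0 K0"
  define F2 where "F2 = free_module R K1"
  define d2 where "d2 = eval_map R F1 K1"
  have K0: "K0 \<subseteq> carrier F0" by (auto simp: K0_def F0_def eval_kernel_def)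
  have K1: "K1 \<subseteq> carrier F1" by (auto simp: K1_def F1_def eval_kernel_def)
  let ?S = "F0\<lparr>carrier := K0\<rparr>"
  have S_eq: "ext_syzygy R M = ?S" by (simp add: F0_def K0_def)
  interpret S: module R ?S
    unfolding F0_def K0_def by (rule module_eval_kernel[OF M order_refl])
  show d1: "d1 \<in> mod_hom R F1 F0" unfolding d1_def F1_def
    by (rule eval_map_mod_hom[OF F0.module_axioms K0])
  have d2: "d2 \<in> mod_hom R F2 F1" unfolding d2_def F2_def
    by (rule eval_map_mod_hom[OF F1.module_axioms K1])
  have eps: "eval_map R M (carrier M) \<in> mod_hom R F0 M"
    unfolding F0_def by (rule eval_map_mod_hom[OF M order_refl])
  show d1K: "d1 x \<in> K0" if "x \<in> carrier F1" for x
  proof -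
    have "eval_map R M (carrier M) (d1 x) = \<zero>\<^bsub>M\<^esub>"
      unfolding d1_def using that K0 
      by (intro eval_map_in_kernel[OF F0.module_axioms M eps]) (auto simp: F1_def K0_def eval_kernel_def)
    then show ?thesis using mod_hom_closed[OF d1 that] by (simp add: K0_def F0_def eval_kernel_def)
  qed
  have d12: "d1 (d2 x) = \<zero>\<^bsub>F0\<^esub>" if "x \<in> carrier F2" for x
    unfolding d2_def using that K1
    by (intro eval_map_in_kernel[OF F1.module_axioms F0.module_axioms d1])
      (auto simp: F2_def K1_def eval_kernel_def d1_def)
  have d1S: "d1 \<in> mod_hom R F1 ?S"
    using d1 d1K by (auto simp: mod_hom_def PiE_def)
  have ZZ': "{f \<in> mod_hom R F1 C. compose (carrier F2) f d2 = (\<lambda>x\<in>carrier F2. \<zero>\<^bsub>C\<^esub>)}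
    = (\<lambda>g. compose (carrier F1) g d1) ` mod_hom R ?S C" (is "?Z = ?Z'")
  proof (intro subset_antisym subsetI)
    fix f assume "f \<in> ?Z"
    then have f: "f \<in> mod_hom R F1 C" and f2: "\<And>x. x \<in> carrier F2 \<Longrightarrow> f (d2 x) = \<zero>\<^bsub>C\<^esub>"
      by (auto simp: compose_def fun_eq_iff) (metis restrict_apply')
    have vanish: "f z = \<zero>\<^bsub>C\<^esub>" if "z \<in> eval_kernel R F0 K0" for z
      using f2[of "basis_vector R K1 z"] eval_map_basis_vector[OF F1.module_axioms K1] that
        basis_vector_closed[OF M.R.is_cring, of K1 z]
      by (auto simp: F2_def d2_def K1_def)
    note fact = eval_kernel_hom_factors[OF F0.module_axioms K0 C f[unfolded F1_def] vanish S.module_axioms,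
        folded F1_def d1_def]
    let ?g = "\<lambda>k\<in>K0. f (basis_vector R K0 k)"
    have "f = compose (carrier F1) ?g d1"
      using f d1K fact(2) unfolding compose_def
      by (intro extensionalityI[of f "carrier F1"]) (auto simp: mod_hom_def PiE_def)
    then show "f \<in> ?Z'" using fact(1) by blast
  next
    fix f assume "f \<in> ?Z'"
    then obtain g where g: "g \<in> mod_hom R ?S C" "f = compose (carrier F1) g d1" by auto
    have "f (d2 x) = \<zero>\<^bsub>C\<^esub>" if "x \<in> carrier F2" for x
      using that mod_hom_zero[OF S.module_axioms C g(1)] mod_hom_closed[OF d2 that] d12[OF that]
      by (simp add: g(2) compose_def)
    then show "f \<in> ?Z"
      using mod_hom_compose[OF F1.module_axioms d1S g(1)] g(2) by (auto simp: compose_def)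
  qed
  have E: "Ext1 R M C = quot_module ((Hom_module R F1 C)\<lparr>carrier := ?Z\<rparr>)
      {compose (carrier F1) g d1 | g. g \<in> mod_hom R F0 C}"
    unfolding Ext1_def Let_def d2_def F2_def K1_def d1_def F1_def K0_def F0_def by (rule refl)
  show "Ext1 R M C = quot_module
      ((Hom_module R F1 C)\<lparr>carrier := (\<lambda>g. compose (carrier F1) g d1) ` mod_hom R (ext_syzygy R M) C\<rparr>)
      ((\<lambda>g. compose (carrier F1) g d1) ` mod_hom R F0 C)"
    unfolding E ZZ' S_eq by (simp only: Setcompr_eq_image)
qed

text \<open>
  The quotient map of the cokernel just described: the coset modulo coboundaries of the cocycle to
  which \<open>f\<close> pulls back.
\<close>

definition ext_class :: "('a, 'x) ring_scheme \<Rightarrow> ('a, 'm, 'y) module_scheme \<Rightarrow>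
    ('a, 'c, 'z) module_scheme \<Rightarrow> (('m \<Rightarrow> 'a) \<Rightarrow> 'c) \<Rightarrow> ((('m \<Rightarrow> 'a) \<Rightarrow> 'a) \<Rightarrow> 'c) set" where
  "ext_class R M C f = (let F0 = ext_cover R M; K0 = eval_kernel R M (carrier M);
       F1 = free_module R K0; d1 = eval_map R F0 K0
     in (\<lambda>g. compose (carrier F1) g d1) ` mod_hom R F0 C +>\<^bsub>Hom_module R F1 C\<^esub> compose (carrier F1) f d1)"

lemma Ext1_ext_class:
  fixes R :: "('a, 'x) ring_scheme" and M :: "('a, 'm, 'y) module_scheme"
    and C :: "('a, 'c, 'z) module_scheme"
  assumes M: "module R M" and C: "module R C"
  shows "module R (Ext1 R M C)"
    and "carrier (Ext1 R M C) = ext_class R M C ` mod_hom R (ext_syzygy R M) C"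
    and "f \<in> mod_hom R (ext_syzygy R M) C \<Longrightarrow> ext_class R M C f = \<zero>\<^bsub>Ext1 R M C\<^esub> \<longleftrightarrow>
      (\<exists>g\<in>mod_hom R (ext_cover R M) C. \<forall>k\<in>carrier (ext_syzygy R M). g k = f k)"
    and "f \<in> mod_hom R (ext_syzygy R M) C \<Longrightarrow> a \<in> carrier R \<Longrightarrow>
      a \<odot>\<^bsub>Ext1 R M C\<^esub> ext_class R M C f = ext_class R M C (\<lambda>k\<in>carrier (ext_syzygy R M). a \<odot>\<^bsub>C\<^esub> f k)"
proof -
  interpret M: module R M by fact
  interpret C: module R C by fact
  define F0 where "F0 = ext_cover R M"
  define K0 where "K0 = eval_kernel R M (carrier M)"
  define F1 where "F1 = free_module R K0"
  define d1 where "d1 = eval_map R F0 K0"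
  define Z where "Z = (\<lambda>g. compose (carrier F1) g d1) ` mod_hom R (ext_syzygy R M) C"
  define B where "B = (\<lambda>g. compose (carrier F1) g d1) ` mod_hom R F0 C"
  let ?H = "Hom_module R F1 C"
  let ?HZ = "?H\<lparr>carrier := Z\<rparr>"
  interpret F0: module R F0 unfolding F0_def by (rule module_free_module[OF M.R.is_cring])
  interpret F1: module R F1 unfolding F1_def by (rule module_free_module[OF M.R.is_cring])
  have S: "module R (ext_syzygy R M)" by (rule module_eval_kernel[OF M order_refl])
  have S_eq: "ext_syzygy R M = F0\<lparr>carrier := K0\<rparr>" by (simp add: F0_def K0_def)
  have K0: "K0 \<subseteq> carrier F0" by (auto simp: K0_def F0_def eval_kernel_def)
  note d1 = Ext1_eq(1)[OF M C, folded F0_def, folded K0_def, folded F1_def d1_def]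
  note d1K = Ext1_eq(2)[OF M C, folded F0_def, folded K0_def, folded F1_def d1_def]
  have E: "Ext1 R M C = quot_module ?HZ B"
    using Ext1_eq(3)[OF M C, folded F0_def, folded K0_def, folded F1_def d1_def]
    by (simp add: Z_def B_def S_eq)
  have cls: "ext_class R M C f = B +>\<^bsub>?HZ\<^esub> compose (carrier F1) f d1" for f
    by (simp add: ext_class_def Let_def B_def F0_def K0_def F1_def d1_def a_r_coset_def')
  \<comment> \<open>The pullbacks of a whole Hom module form a module; for \<open>P\<close> the syzygy this gives the cocycles, for \<open>P = F\<^sub>0\<close> the coboundaries.\<close>
  have img: "module R (?H\<lparr>carrier := (\<lambda>g. compose (carrier F1) g d1) ` mod_hom R P C\<rparr>)"
    if P: "module R P" "\<And>x. x \<in> carrier F1 \<Longrightarrow> d1 x \<in> carrier P" for P :: "('a, 'm \<Rightarrow> 'a) module"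
  proof (rule module_surj_image[OF module_Hom_module[OF P(1) C]])
    show "(\<lambda>g. compose (carrier F1) g d1) ` carrier (Hom_module R P C)
        = carrier (?H\<lparr>carrier := (\<lambda>g. compose (carrier F1) g d1) ` mod_hom R P C\<rparr>)"
      by simp
  qed (simp_all add: compose_def P(2) cong: restrict_cong)
  have HZ: "module R ?HZ" unfolding Z_def using d1K by (intro img[OF S]) (auto simp: K0_def)
  have HB: "module R (?HZ\<lparr>carrier := B\<rparr>)"
    using img[OF F0.module_axioms mod_hom_closed[OF d1]] by (simp add: B_def)
  have e: "basis_vector R K0 k \<in> carrier F1" "d1 (basis_vector R K0 k) = k" if "k \<in> K0" for k
    using that basis_vector_closed[OF M.R.is_cring] eval_map_basis_vector[OF F0.module_axioms K0]
    by (auto simp: F1_def d1_def)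
  have BZ: "B \<subseteq> carrier ?HZ"
  proof
    fix b assume "b \<in> B"
    then obtain g where g: "g \<in> mod_hom R F0 C" "b = compose (carrier F1) g d1" by (auto simp: B_def)
    have "(\<lambda>k\<in>K0. g k) \<in> mod_hom R (ext_syzygy R M) C"
      using mod_hom_restrict_carrier[OF g(1) K0, of "carrier C"] S K0 mod_hom_closed[OF g(1)]
      by (auto simp: S_eq)
    moreover have "b = compose (carrier F1) (\<lambda>k\<in>K0. g k) d1"
      using d1K unfolding g(2) compose_def by (intro restrict_ext) auto
    ultimately show "b \<in> carrier ?HZ" by (auto simp: Z_def)
  qed
  note Q = module_quot_module[OF HZ HB BZ]
  show "module R (Ext1 R M C)" using Q(1) E by simp
  show "carrier (Ext1 R M C) = ext_class R M C ` mod_hom R (ext_syzygy R M) C"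
    unfolding E cls by (auto simp: quot_module_def A_RCOSETS_def' Z_def)
  assume f: "f \<in> mod_hom R (ext_syzygy R M) C"
  then have fZ: "compose (carrier F1) f d1 \<in> carrier ?HZ" by (auto simp: Z_def)
  have "ext_class R M C f = \<zero>\<^bsub>Ext1 R M C\<^esub> \<longleftrightarrow> compose (carrier F1) f d1 \<in> B"
    using Q(3)[OF fZ] by (simp add: E cls quot_module_def)
  also have "\<dots> \<longleftrightarrow> (\<exists>g\<in>mod_hom R F0 C. \<forall>k\<in>K0. g k = f k)"
  proof
    assume "compose (carrier F1) f d1 \<in> B"
    then obtain g where g: "g \<in> mod_hom R F0 C" "compose (carrier F1) f d1 = compose (carrier F1) g d1"
      by (auto simp: B_def)
    have "g k = f k" if "k \<in> K0" for k
      using fun_cong[OF g(2), of "basis_vector R K0 k"] e[OF that] by (simp add: compose_def)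
    then show "\<exists>g\<in>mod_hom R F0 C. \<forall>k\<in>K0. g k = f k" using g(1) by blast
  next
    assume "\<exists>g\<in>mod_hom R F0 C. \<forall>k\<in>K0. g k = f k"
    then obtain g where g: "g \<in> mod_hom R F0 C" "\<forall>k\<in>K0. g k = f k" by blast
    then have "compose (carrier F1) f d1 = compose (carrier F1) g d1"
      using d1K unfolding compose_def by (intro restrict_ext) auto
    then show "compose (carrier F1) f d1 \<in> B" using g(1) by (auto simp: B_def)
  qed
  finally show "ext_class R M C f = \<zero>\<^bsub>Ext1 R M C\<^esub> \<longleftrightarrow>
      (\<exists>g\<in>mod_hom R (ext_cover R M) C. \<forall>k\<in>carrier (ext_syzygy R M). g k = f k)"
    by (simp add: F0_def K0_def)
  assume a: "a \<in> carrier R"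
  have "compose (carrier F1) (\<lambda>k\<in>K0. a \<odot>\<^bsub>C\<^esub> f k) d1 = a \<odot>\<^bsub>?HZ\<^esub> compose (carrier F1) f d1"
    using d1K by (auto simp: compose_def intro!: restrict_ext)
  then show "a \<odot>\<^bsub>Ext1 R M C\<^esub> ext_class R M C f
      = ext_class R M C (\<lambda>k\<in>carrier (ext_syzygy R M). a \<odot>\<^bsub>C\<^esub> f k)"
    using mod_hom_smult[OF Q(2) a fZ] fZ module.smult_closed[OF HZ a fZ]
    by (simp add: E cls K0_def del: Hom_module_simps)
qed

lemma zero_module_Ext1_iff:
  assumes "module R M" "module R C"
  shows "zero_module (Ext1 R M C) \<longleftrightarrow> (\<forall>f\<in>mod_hom R (ext_syzygy R M) C.
    \<exists>g\<in>mod_hom R (ext_cover R M) C. \<forall>k\<in>carrier (ext_syzygy R M). g k = f k)"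
proof -
  note E = Ext1_ext_class[OF assms]
  interpret E: module R "Ext1 R M C" by (rule E(1))
  have "zero_module (Ext1 R M C) \<longleftrightarrow> (\<forall>x\<in>carrier (Ext1 R M C). x = \<zero>\<^bsub>Ext1 R M C\<^esub>)"
    unfolding zero_module_def using E.M.zero_closed by blast
  also have "\<dots> \<longleftrightarrow> (\<forall>f\<in>mod_hom R (ext_syzygy R M) C. ext_class R M C f = \<zero>\<^bsub>Ext1 R M C\<^esub>)"
    unfolding E(2) by (rule ball_simps(9))
  also have "\<dots> \<longleftrightarrow> (\<forall>f\<in>mod_hom R (ext_syzygy R M) C.
      \<exists>g\<in>mod_hom R (ext_cover R M) C. \<forall>k\<in>carrier (ext_syzygy R M). g k = f k)"
    by (intro ball_cong refl E(3))
  finally show ?thesis .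
qed

lemma GV_torsion_Ext1D:
  assumes "module R M" "module R C" "GV_torsion R (Ext1 R M C)" "f \<in> mod_hom R (ext_syzygy R M) C"
  shows "\<exists>J\<in>GV_ideals R. \<forall>a\<in>J. \<exists>g\<in>mod_hom R (ext_cover R M) C.
    \<forall>k\<in>carrier (ext_syzygy R M). g k = a \<odot>\<^bsub>C\<^esub> f k"
proof -
  note E = Ext1_ext_class[OF assms(1,2)]
  have "ext_class R M C f \<in> carrier (Ext1 R M C)" unfolding E(2) using assms(4) by (rule imageI)
  then obtain J where J: "J \<in> GV_ideals R" "\<And>a. a \<in> J \<Longrightarrow> a \<odot>\<^bsub>Ext1 R M C\<^esub> ext_class R M C f = \<zero>\<^bsub>Ext1 R M C\<^esub>"
    using assms(3) unfolding GV_torsion_def by blast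
  have S: "module R (ext_syzygy R M)" by (rule module_eval_kernel[OF assms(1) order_refl])
  have "\<exists>g\<in>mod_hom R (ext_cover R M) C. \<forall>k\<in>carrier (ext_syzygy R M). g k = a \<odot>\<^bsub>C\<^esub> f k"
    if a: "a \<in> J" for a
  proof -
    have "ideal J R" using J(1) by (simp add: GV_ideals_def)
    then have aR: "a \<in> carrier R" using a by (rule ideal.Icarr)
    have "ext_class R M C (\<lambda>k\<in>carrier (ext_syzygy R M). a \<odot>\<^bsub>C\<^esub> f k) = \<zero>\<^bsub>Ext1 R M C\<^esub>"
      using J(2)[OF a] E(4)[OF assms(4) aR] by (rule trans[OF sym, rotated])
    then obtain g where "g \<in> mod_hom R (ext_cover R M) C"
      "\<forall>k\<in>carrier (ext_syzygy R M). g k = (\<lambda>k\<in>carrier (ext_syzygy R M). a \<odot>\<^bsub>C\<^esub> f k) k"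
      using E(3)[OF mod_hom_pointwise_smult[OF S assms(2,4) aR]] by blast
    then show ?thesis by (intro bexI[of _ g]) simp_all
  qed
  then show ?thesis by (intro bexI[OF _ J(1)] ballI)
qed

text \<open>
  The free cover can be replaced by any surjection \<open>\<pi>\<close>. Let \<open>l\<close> be a lift to \<open>N\<close> of the
  evaluation map \<open>\<epsilon>\<close> of the free cover. By hypothesis the homomorphism \<open>f \<circ> l\<close> on the syzygy
  extends to some \<open>g\<close> on the cover. For \<open>n\<close> in \<open>N\<close> choose \<open>x\<close> in the cover with \<open>\<pi> n = \<epsilon> x\<close> and put
  \<open>h n = g x + f (n - l x)\<close>. Two choices of \<open>x\<close> differ by an element of the syzygy, where \<open>g = f \<circ> l\<close>,
  so \<open>h\<close> does not depend on the choice. It is linear since the choices may be added and scaled,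
  and it agrees with \<open>f\<close> on the kernel, where \<open>x = 0\<close> is allowed.
\<close>

lemma Ext1_zero_extend:
  assumes M: "module R M" and C: "module R C" and Z: "zero_module (Ext1 R M C)"
    and N: "module R N" and pi: "\<pi> \<in> mod_hom R N M" and surj: "carrier M \<subseteq> \<pi> ` carrier N"
    and f: "f \<in> mod_hom R (N\<lparr>carrier := {n \<in> carrier N. \<pi> n = \<zero>\<^bsub>M\<^esub>}\<rparr>) C"
  obtains h where "h \<in> mod_hom R N C" "\<And>n. n \<in> carrier N \<Longrightarrow> \<pi> n = \<zero>\<^bsub>M\<^esub> \<Longrightarrow> h n = f n"
proof -
  interpret M: module R M by fact
  interpret C: module R C by fact
  interpret N: module R N by fact
  let ?F = "ext_cover R M" and ?K = "eval_kernel R M (carrier M)"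
    and ?eps = "eval_map R M (carrier M)" and ?e = "basis_vector R (carrier M)"
  let ?ker = "{n \<in> carrier N. \<pi> n = \<zero>\<^bsub>M\<^esub>}"
  interpret F: module R ?F by (rule module_free_module[OF M.R.is_cring])
  have S: "module R (ext_syzygy R M)" by (rule module_eval_kernel[OF M order_refl])
  define \<sigma> where "\<sigma> = inv_into (carrier N) \<pi>"
  have sigma: "\<sigma> \<in> carrier M \<rightarrow> carrier N" "\<And>m. m \<in> carrier M \<Longrightarrow> \<pi> (\<sigma> m) = m"
    using surj by (auto simp: \<sigma>_def f_inv_into_f inv_into_into subset_iff)
  define l where "l = free_lift R N (carrier M) \<sigma>"
  have l: "l \<in> mod_hom R ?F N" unfolding l_def by (rule free_lift_mod_hom[OF N sigma(1)])
  have eps: "?eps \<in> mod_hom R ?F M" by (rule eval_map_mod_hom[OF M order_refl])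
  have pil: "\<pi> (l x) = ?eps x" if "x \<in> carrier ?F" for x
  proof -
    have "\<pi> (l x) = free_lift R M (carrier M) (\<lambda>b. \<pi> (\<sigma> b)) x"
      unfolding l_def by (rule mod_hom_free_lift[OF N M pi sigma(1) that])
    also have "\<dots> = ?eps x"
      unfolding eval_map_eq_free_lift free_lift_def
      using that free_module_carrierD(3)[OF that] sigma by (auto intro!: M.M.finsum_cong')
    finally show ?thesis .
  qed
  have lK: "l k \<in> ?ker" if "k \<in> ?K" for k
    using that mod_hom_closed[OF l] by (auto simp: eval_kernel_def pil)
  have "compose ?K f (\<lambda>k\<in>?K. l k) \<in> mod_hom R (ext_syzygy R M) C"
    using mod_hom_compose[OF S _ f, of "\<lambda>k\<in>?K. l k"] mod_hom_restrict_carrier[OF l _ lK S]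
    by (auto simp: eval_kernel_def)
  then obtain g where g: "g \<in> mod_hom R ?F C" "\<And>k. k \<in> ?K \<Longrightarrow> g k = f (l k)"
    using Z[unfolded zero_module_Ext1_iff[OF M C]] by (force simp: compose_def)
  have fadd: "f (x \<oplus>\<^bsub>N\<^esub> y) = f x \<oplus>\<^bsub>C\<^esub> f y" "f (x \<ominus>\<^bsub>N\<^esub> y) \<in> carrier C" "f x \<in> carrier C" if "x \<in> ?ker" "y \<in> ?ker" for x y
    using mod_hom_add[OF f, of x y] mod_hom_closed[OF f, of x] mod_hom_closed[OF f, of "x \<ominus>\<^bsub>N\<^esub> y"] that
    by (auto simp: mod_hom_minus[OF N M pi] M.M.minus_eq_zero_iff)
  define h where "h n = g (?e (\<pi> n)) \<oplus>\<^bsub>C\<^esub> f (n \<ominus>\<^bsub>N\<^esub> l (?e (\<pi> n)))" for n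
  have h: "h n = g x \<oplus>\<^bsub>C\<^esub> f (n \<ominus>\<^bsub>N\<^esub> l x)"
    if n: "n \<in> carrier N" and x: "x \<in> carrier ?F" and nx: "\<pi> n = ?eps x" for n x
  proof -
    let ?y = "?e (\<pi> n)"
    have y: "?y \<in> carrier ?F" "?eps ?y = \<pi> n"
      using basis_vector_closed[OF M.R.is_cring] eval_map_basis_vector[OF M order_refl] mod_hom_closed[OF pi n]
      by auto
    have k: "?y \<ominus>\<^bsub>?F\<^esub> x \<in> ?K"
      using x y nx mod_hom_closed[OF pi n]
      by (simp add: eval_kernel_def mod_hom_minus[OF F.module_axioms M eps] M.M.minus_eq_zero_iff)
    have ly: "l ?y \<in> carrier N" "l x \<in> carrier N" using mod_hom_closed[OF l] x y by auto
    have gy: "g ?y = g x \<oplus>\<^bsub>C\<^esub> f (l ?y \<ominus>\<^bsub>N\<^esub> l x)"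
    proof -
      have "?y = x \<oplus>\<^bsub>?F\<^esub> (?y \<ominus>\<^bsub>?F\<^esub> x)"
        using x y(1) by (simp del: free_module_simps add: F.M.minus_eq F.M.a_lcomm[of x] F.M.r_neg)
      then have "g ?y = g x \<oplus>\<^bsub>C\<^esub> g (?y \<ominus>\<^bsub>?F\<^esub> x)"
        using x y(1) mod_hom_add[OF g(1), of x "?y \<ominus>\<^bsub>?F\<^esub> x"] by simp
      then show ?thesis using g(2)[OF k] x y by (simp add: mod_hom_minus[OF F.module_axioms N l])
    qed
    have k1: "l ?y \<ominus>\<^bsub>N\<^esub> l x \<in> ?ker" and k2: "n \<ominus>\<^bsub>N\<^esub> l ?y \<in> ?ker"
      using ly n x y nx mod_hom_closed[OF pi n] mod_hom_closed[OF eps x]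
      by (auto simp: mod_hom_minus[OF N M pi] pil M.M.minus_eq_zero_iff)
    have "(l ?y \<ominus>\<^bsub>N\<^esub> l x) \<oplus>\<^bsub>N\<^esub> (n \<ominus>\<^bsub>N\<^esub> l ?y) = n \<ominus>\<^bsub>N\<^esub> l x"
      using ly n by (simp add: N.M.minus_eq N.M.a_ac N.M.r_neg N.M.r_neg1 N.M.r_neg2)
    then have "f (n \<ominus>\<^bsub>N\<^esub> l x) = f (l ?y \<ominus>\<^bsub>N\<^esub> l x) \<oplus>\<^bsub>C\<^esub> f (n \<ominus>\<^bsub>N\<^esub> l ?y)"
      using fadd(1)[OF k1 k2] by simp
    then show ?thesis unfolding h_def gy
      using fadd(3)[OF k1 k1] fadd(3)[OF k2 k2] mod_hom_closed[OF g(1) x] by (simp add: C.M.a_assoc)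
  qed
  have ex: "\<exists>x\<in>carrier ?F. \<pi> n = ?eps x" if "n \<in> carrier N" for n
    using basis_vector_closed[OF M.R.is_cring] eval_map_basis_vector[OF M order_refl] mod_hom_closed[OF pi that]
    by (intro bexI[of _ "?e (\<pi> n)"]) auto
  have nlx: "n \<ominus>\<^bsub>N\<^esub> l x \<in> ?ker" if "n \<in> carrier N" "x \<in> carrier ?F" "\<pi> n = ?eps x" for n x
    using that mod_hom_closed[OF l that(2)] mod_hom_closed[OF eps that(2)]
    by (auto simp: mod_hom_minus[OF N M pi] pil M.M.minus_eq_zero_iff)
  have "(\<lambda>n\<in>carrier N. h n) \<in> mod_hom R N C"
  proof (rule mod_hom_restrictI[OF N])
    fix n assume n: "n \<in> carrier N"
    then obtain x where x: "x \<in> carrier ?F" "\<pi> n = ?eps x" using ex by blast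
    note hn = h[OF n x] and kn = nlx[OF n x]
    have gx: "g x \<in> carrier C" and lx: "l x \<in> carrier N" using g(1) l x by (auto simp: mod_hom_closed)
    show "h n \<in> carrier C" unfolding hn using fadd(3)[OF kn kn] gx by simp
    {
      fix r assume r: "r \<in> carrier R"
      have "h (r \<odot>\<^bsub>N\<^esub> n) = g (r \<odot>\<^bsub>?F\<^esub> x) \<oplus>\<^bsub>C\<^esub> f ((r \<odot>\<^bsub>N\<^esub> n) \<ominus>\<^bsub>N\<^esub> l (r \<odot>\<^bsub>?F\<^esub> x))"
        using r n x F.smult_closed[OF r x(1)] by (intro h) (simp_all add: mod_hom_smult[OF pi] mod_hom_smult[OF eps] del: free_module_simps)
      also have "(r \<odot>\<^bsub>N\<^esub> n) \<ominus>\<^bsub>N\<^esub> l (r \<odot>\<^bsub>?F\<^esub> x) = r \<odot>\<^bsub>N\<^esub> (n \<ominus>\<^bsub>N\<^esub> l x)"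
        using r n x(1) lx by (simp add: mod_hom_smult[OF l] N.M.minus_eq N.smult_r_distr N.smult_r_minus del: free_module_simps)
      also have "f \<dots> = r \<odot>\<^bsub>C\<^esub> f (n \<ominus>\<^bsub>N\<^esub> l x)"
        using mod_hom_smult[OF f r, of "n \<ominus>\<^bsub>N\<^esub> l x"] kn by simp
      finally show "h (r \<odot>\<^bsub>N\<^esub> n) = r \<odot>\<^bsub>C\<^esub> h n"
        unfolding hn using r x(1) gx fadd(3)[OF kn kn]
        by (simp add: mod_hom_smult[OF g(1)] C.smult_r_distr del: free_module_simps)
    }
    fix n' assume n': "n' \<in> carrier N"
    then obtain x' where x': "x' \<in> carrier ?F" "\<pi> n' = ?eps x'" using ex by blast
    note hn' = h[OF n' x'] and kn' = nlx[OF n' x']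
    have gx': "g x' \<in> carrier C" and lx': "l x' \<in> carrier N" using g(1) l x' by (auto simp: mod_hom_closed)
    have "h (n \<oplus>\<^bsub>N\<^esub> n') = g (x \<oplus>\<^bsub>?F\<^esub> x') \<oplus>\<^bsub>C\<^esub> f ((n \<oplus>\<^bsub>N\<^esub> n') \<ominus>\<^bsub>N\<^esub> l (x \<oplus>\<^bsub>?F\<^esub> x'))"
      using n n' x x' F.M.a_closed[OF x(1) x'(1)]
      by (intro h) (simp_all add: mod_hom_add[OF pi] mod_hom_add[OF eps] del: free_module_simps)
    also have "(n \<oplus>\<^bsub>N\<^esub> n') \<ominus>\<^bsub>N\<^esub> l (x \<oplus>\<^bsub>?F\<^esub> x') = (n \<ominus>\<^bsub>N\<^esub> l x) \<oplus>\<^bsub>N\<^esub> (n' \<ominus>\<^bsub>N\<^esub> l x')"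
      using n n' x(1) x'(1) lx lx'
      by (simp add: mod_hom_add[OF l] N.M.minus_eq N.M.minus_add N.M.a_ac del: free_module_simps)
    also have "f \<dots> = f (n \<ominus>\<^bsub>N\<^esub> l x) \<oplus>\<^bsub>C\<^esub> f (n' \<ominus>\<^bsub>N\<^esub> l x')"
      using fadd(1)[OF kn kn'] by simp
    finally show "h (n \<oplus>\<^bsub>N\<^esub> n') = h n \<oplus>\<^bsub>C\<^esub> h n'"
      unfolding hn hn' using x(1) x'(1) gx gx' fadd(3)[OF kn kn'] fadd(3)[OF kn' kn]
      by (simp add: mod_hom_add[OF g(1)] C.M.a_ac del: free_module_simps)
  qed
  moreover have "(\<lambda>n\<in>carrier N. h n) n = f n" if "n \<in> carrier N" "\<pi> n = \<zero>\<^bsub>M\<^esub>" for n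
  proof -
    have "h n = g \<zero>\<^bsub>?F\<^esub> \<oplus>\<^bsub>C\<^esub> f (n \<ominus>\<^bsub>N\<^esub> l \<zero>\<^bsub>?F\<^esub>)"
      using that F.M.zero_closed mod_hom_zero[OF F.module_axioms M eps]
      by (intro h) (simp_all del: free_module_simps)
    then show ?thesis
      using that mod_hom_zero[OF F.module_axioms N l] mod_hom_zero[OF F.module_axioms C g(1)] fadd(3)[of n n]
      by (simp add: N.M.minus_eq N.M.minus_equality[of "\<zero>\<^bsub>N\<^esub>" "\<zero>\<^bsub>N\<^esub>"] del: free_module_simps)
  qed
  ultimately show ?thesis by (rule that)
qed

section \<open>Localization and extension modules\<close>

definition restrict_scalars :: "('a \<Rightarrow> 's) \<Rightarrow> ('s, 'm, 'y) module_scheme \<Rightarrow> ('a, 'm) module" where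
  "restrict_scalars \<phi> Y = \<lparr>carrier = carrier Y, mult = undefined, one = undefined,
     zero = \<zero>\<^bsub>Y\<^esub>, add = add Y, smult = (\<lambda>r y. \<phi> r \<odot>\<^bsub>Y\<^esub> y)\<rparr>"

lemma restrict_scalars_simps [simp]:
  "carrier (restrict_scalars \<phi> Y) = carrier Y"
  "zero (restrict_scalars \<phi> Y) = zero Y"
  "add (restrict_scalars \<phi> Y) = add Y"
  "smult (restrict_scalars \<phi> Y) = (\<lambda>r y. \<phi> r \<odot>\<^bsub>Y\<^esub> y)"
  by (simp_all add: restrict_scalars_def)

lemma module_restrict_scalars:
  assumes "cring R" "module T Y" "\<phi> \<in> ring_hom R T"
  shows "module R (restrict_scalars \<phi> Y)"
proof -
  interpret R: cring R by fact
  interpret Y: module T Y by fact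
  note phi = ring_hom_closed[OF assms(3)] ring_hom_add[OF assms(3)] ring_hom_mult[OF assms(3)]
    ring_hom_one[OF assms(3)]
  have "abelian_group (restrict_scalars \<phi> Y)"
    by (rule abelian_groupI) (auto simp: Y.M.a_ac intro!: bexI[of _ "\<ominus>\<^bsub>Y\<^esub> _"] Y.M.r_neg)
  then show ?thesis
    by (rule moduleI[OF assms(1)])
      (auto simp: phi Y.smult_l_distr Y.smult_r_distr Y.smult_assoc1)
qed

lemma mod_hom_restrict_scalars:
  assumes "\<phi> \<in> ring_hom R T" "f \<in> mod_hom T X Y"
  shows "f \<in> mod_hom R (restrict_scalars \<phi> X) (restrict_scalars \<phi> Y)"
  using assms(2) ring_hom_closed[OF assms(1)] by (auto simp: mod_hom_def)

definition pullback_module :: "('a, 'm, 'y) module_scheme \<Rightarrow> ('a, 'n, 'z) module_scheme \<Rightarrow>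
    ('m \<Rightarrow> 'p) \<Rightarrow> ('n \<Rightarrow> 'p) \<Rightarrow> ('a, 'm \<times> 'n) module" where
  "pullback_module M N f g = \<lparr>carrier = {(x, y). x \<in> carrier M \<and> y \<in> carrier N \<and> f x = g y},
     mult = undefined, one = undefined, zero = (\<zero>\<^bsub>M\<^esub>, \<zero>\<^bsub>N\<^esub>),
     add = (\<lambda>(x, y) (x', y'). (x \<oplus>\<^bsub>M\<^esub> x', y \<oplus>\<^bsub>N\<^esub> y')),
     smult = (\<lambda>r (x, y). (r \<odot>\<^bsub>M\<^esub> x, r \<odot>\<^bsub>N\<^esub> y))\<rparr>"

lemma pullback_module_simps [simp]:
  "(x, y) \<in> carrier (pullback_module M N f g) \<longleftrightarrow> x \<in> carrier M \<and> y \<in> carrier N \<and> f x = g y"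
  "zero (pullback_module M N f g) = (\<zero>\<^bsub>M\<^esub>, \<zero>\<^bsub>N\<^esub>)"
  "(x, y) \<oplus>\<^bsub>pullback_module M N f g\<^esub> (x', y') = (x \<oplus>\<^bsub>M\<^esub> x', y \<oplus>\<^bsub>N\<^esub> y')"
  "r \<odot>\<^bsub>pullback_module M N f g\<^esub> (x, y) = (r \<odot>\<^bsub>M\<^esub> x, r \<odot>\<^bsub>N\<^esub> y)"
  by (simp_all add: pullback_module_def)

lemma module_pullback_module:
  assumes M: "module R M" and N: "module R N" and P: "module R P"
    and f: "f \<in> mod_hom R M P" and g: "g \<in> mod_hom R N P"
  shows "module R (pullback_module M N f g)"
proof -
  interpret M: module R M by fact
  interpret N: module R N by fact
  note hom = mod_hom_zero[OF M P f] mod_hom_zero[OF N P g] mod_hom_add[OF f] mod_hom_add[OF g]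
    mod_hom_smult[OF f] mod_hom_smult[OF g] mod_hom_neg[OF M P f] mod_hom_neg[OF N P g]
  have "abelian_group (pullback_module M N f g)"
  proof (rule abelian_groupI)
    fix z assume "z \<in> carrier (pullback_module M N f g)"
    then show "\<exists>z'\<in>carrier (pullback_module M N f g).
        z' \<oplus>\<^bsub>pullback_module M N f g\<^esub> z = \<zero>\<^bsub>pullback_module M N f g\<^esub>"
      by (cases z) (intro bexI[of _ "(\<ominus>\<^bsub>M\<^esub> fst z, \<ominus>\<^bsub>N\<^esub> snd z)"], auto simp: hom M.M.l_neg N.M.l_neg)
  qed (auto simp: hom M.M.a_ac N.M.a_ac)
  then show ?thesis
    by (rule moduleI[OF M.R.is_cring])
      (auto simp: hom M.smult_l_distr M.smult_r_distr M.smult_assoc1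
        N.smult_l_distr N.smult_r_distr N.smult_assoc1)
qed

text \<open>
  The two properties of a ring of fractions that carry homomorphisms of modules from \<open>R\<close> to \<open>T\<close>:
  denominators become invertible, so division by them makes sense in \<open>T\<close>-modules, and every scalar
  of \<open>T\<close> is a fraction, so that \<open>R\<close>-linearity entails \<open>T\<close>-linearity.
\<close>

locale ring_localization = R: cring R + T: cring T
  for R :: "('a, 'x) ring_scheme" and T :: "('s, 'w) ring_scheme" and \<phi> :: "'a \<Rightarrow> 's" and W :: "'a set" +
  assumes hom: "\<phi> \<in> ring_hom R T"
    and W_subset: "W \<subseteq> carrier R"
    and W_one: "\<one>\<^bsub>R\<^esub> \<in> W"
    and W_mult: "\<And>s t. s \<in> W \<Longrightarrow> t \<in> W \<Longrightarrow> s \<otimes>\<^bsub>R\<^esub> t \<in> W"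
    and W_Units: "\<And>s. s \<in> W \<Longrightarrow> \<phi> s \<in> Units T"
    and fraction: "\<And>t. t \<in> carrier T \<Longrightarrow> \<exists>a\<in>carrier R. \<exists>s\<in>W. \<phi> s \<otimes>\<^bsub>T\<^esub> t = \<phi> a"
begin

lemmas phi_simps = ring_hom_closed[OF hom] ring_hom_add[OF hom] ring_hom_mult[OF hom] ring_hom_one[OF hom]

lemma W_closed: "s \<in> W \<Longrightarrow> s \<in> carrier R" using W_subset by blast

text \<open>
  Localizations of modules are described by a property of the map and not by a construction,
  because three different models occur: modules of fractions, the field of quotients of the
  localized ring, and a projection from a pullback.
\<close>

definition module_localization :: "('a, 'm, 'y) module_scheme \<Rightarrow> ('s, 'n, 'z) module_scheme \<Rightarrow>
    ('m \<Rightarrow> 'n) \<Rightarrow> bool" where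
  "module_localization X X' \<iota> \<longleftrightarrow> module R X \<and> module T X' \<and>
     \<iota> \<in> mod_hom R X (restrict_scalars \<phi> X') \<and>
     (\<forall>y\<in>carrier X'. \<exists>x\<in>carrier X. \<exists>s\<in>W. \<phi> s \<odot>\<^bsub>X'\<^esub> y = \<iota> x) \<and>
     (\<forall>x\<in>carrier X. \<iota> x = \<zero>\<^bsub>X'\<^esub> \<longrightarrow> (\<exists>u\<in>W. u \<odot>\<^bsub>X\<^esub> x = \<zero>\<^bsub>X\<^esub>))"

lemma smult_W_inj:
  assumes "module T Y" "s \<in> W" "y \<in> carrier Y" "z \<in> carrier Y" "\<phi> s \<odot>\<^bsub>Y\<^esub> y = \<phi> s \<odot>\<^bsub>Y\<^esub> z"
  shows "y = z"
proof -
  interpret Y: module T Y by fact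
  note u = T.Units_inv_closed[OF W_Units[OF assms(2)]] T.Units_closed[OF W_Units[OF assms(2)]]
    T.Units_l_inv[OF W_Units[OF assms(2)]]
  have "y = (inv\<^bsub>T\<^esub> (\<phi> s) \<otimes>\<^bsub>T\<^esub> \<phi> s) \<odot>\<^bsub>Y\<^esub> y"
    using assms(3) by (simp only: u(3) Y.smult_one)
  also have "\<dots> = inv\<^bsub>T\<^esub> (\<phi> s) \<odot>\<^bsub>Y\<^esub> (\<phi> s \<odot>\<^bsub>Y\<^esub> z)"
    unfolding assms(5)[symmetric] using assms(3) u(1,2) by (simp only: Y.smult_assoc1)
  also have "\<dots> = (inv\<^bsub>T\<^esub> (\<phi> s) \<otimes>\<^bsub>T\<^esub> \<phi> s) \<odot>\<^bsub>Y\<^esub> z" using assms(4) u(1,2) by (simp only: Y.smult_assoc1)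
  finally show ?thesis using assms(4) u by simp
qed

lemma smult_W_surj:
  assumes "module T Y" "s \<in> W" "y \<in> carrier Y"
  shows "\<exists>z\<in>carrier Y. \<phi> s \<odot>\<^bsub>Y\<^esub> z = y"
proof -
  interpret Y: module T Y by fact
  note u = T.Units_inv_closed[OF W_Units[OF assms(2)]] T.Units_closed[OF W_Units[OF assms(2)]]
    T.Units_r_inv[OF W_Units[OF assms(2)]]
  show ?thesis
    using assms(3) u by (intro bexI[of _ "inv\<^bsub>T\<^esub> (\<phi> s) \<odot>\<^bsub>Y\<^esub> y"]) (simp_all add: Y.smult_assoc1[symmetric])
qed

lemma smult_fraction:
  assumes "module T Z" "t \<in> carrier T" "a \<in> carrier R" "b \<in> W" "\<phi> b \<otimes>\<^bsub>T\<^esub> t = \<phi> a"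
    "s \<in> carrier R" "z \<in> carrier Z"
  shows "\<phi> (b \<otimes>\<^bsub>R\<^esub> s) \<odot>\<^bsub>Z\<^esub> (t \<odot>\<^bsub>Z\<^esub> z) = \<phi> a \<odot>\<^bsub>Z\<^esub> (\<phi> s \<odot>\<^bsub>Z\<^esub> z)"
proof -
  interpret Z: module T Z by fact
  have b: "b \<in> carrier R" using assms(4) by (rule W_closed)
  have "(\<phi> b \<otimes>\<^bsub>T\<^esub> \<phi> s) \<otimes>\<^bsub>T\<^esub> t = \<phi> a \<otimes>\<^bsub>T\<^esub> \<phi> s"
    unfolding assms(5)[symmetric] using b assms(2,6) by (simp add: phi_simps T.m_ac)
  then show ?thesis
    using b assms by (simp add: Z.smult_assoc1[symmetric] phi_simps)
qed

text \<open>
  The universal property. An element \<open>y\<close> with \<open>\<phi> s y = \<iota> x\<close> has to be sent to the only \<open>z\<close> with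
  \<open>\<phi> s z = h x\<close>. This \<open>z\<close> is the same for all such \<open>x\<close> and \<open>s\<close>: elements with equal image under
  \<open>\<iota>\<close> have a difference killed by some denominator, and denominators act injectively on \<open>Y\<close>.
\<close>

lemma module_localization_extend:
  assumes loc: "module_localization X X' \<iota>" and Y: "module T Y"
    and h: "h \<in> mod_hom R X (restrict_scalars \<phi> Y)"
  obtains h' where "h' \<in> mod_hom T X' Y" "\<And>x. x \<in> carrier X \<Longrightarrow> h' (\<iota> x) = h x"
proof -
  have X: "module R X" and X': "module T X'" and lam: "\<iota> \<in> mod_hom R X (restrict_scalars \<phi> X')"
    and ex: "\<And>y. y \<in> carrier X' \<Longrightarrow> \<exists>x\<in>carrier X. \<exists>s\<in>W. \<phi> s \<odot>\<^bsub>X'\<^esub> y = \<iota> x"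
    and ker: "\<And>x. x \<in> carrier X \<Longrightarrow> \<iota> x = \<zero>\<^bsub>X'\<^esub> \<Longrightarrow> \<exists>u\<in>W. u \<odot>\<^bsub>X\<^esub> x = \<zero>\<^bsub>X\<^esub>"
    using loc unfolding module_localization_def by auto
  interpret X: module R X by fact
  interpret X': module T X' by fact
  interpret Y: module T Y by fact
  have RY: "module R (restrict_scalars \<phi> Y)" and RX': "module R (restrict_scalars \<phi> X')"
    using module_restrict_scalars[OF R.is_cring _ hom] Y X' by blast+
  note Wc = W_closed
  note lam_simps = mod_hom_closed[OF lam, simplified] mod_hom_add[OF lam, simplified] mod_hom_smult[OF lam, simplified]
  note h_simps = mod_hom_closed[OF h, simplified] mod_hom_add[OF h, simplified] mod_hom_smult[OF h, simplified]
  \<comment> \<open>\<open>h\<close> factors through \<open>\<iota>\<close>.\<close>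
  have hd: "h x = h y" if xy: "x \<in> carrier X" "y \<in> carrier X" and eq: "\<iota> x = \<iota> y" for x y
  proof -
    let ?d = "x \<oplus>\<^bsub>X\<^esub> (\<ominus>\<^bsub>X\<^esub> y)"
    have d: "?d \<in> carrier X" using xy by simp
    have "\<iota> (\<ominus>\<^bsub>X\<^esub> y) \<oplus>\<^bsub>X'\<^esub> \<iota> y = \<iota> \<zero>\<^bsub>X\<^esub>" 
      using xy lam_simps(2)[of "\<ominus>\<^bsub>X\<^esub> y" y] by (simp add: X.M.l_neg)
    then have "\<iota> ?d = \<zero>\<^bsub>X'\<^esub>"
      using xy mod_hom_zero[OF X RX' lam] by (simp add: lam_simps eq X'.M.a_comm)
    then obtain u where u: "u \<in> W" "u \<odot>\<^bsub>X\<^esub> ?d = \<zero>\<^bsub>X\<^esub>" using ker[OF d] by blast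
    have "\<phi> u \<odot>\<^bsub>Y\<^esub> h ?d = h (u \<odot>\<^bsub>X\<^esub> ?d)" using d Wc[OF u(1)] by (simp only: h_simps(3))
    also have "\<dots> = \<phi> u \<odot>\<^bsub>Y\<^esub> \<zero>\<^bsub>Y\<^esub>"
      using u(2) mod_hom_zero[OF X RY h] Wc[OF u(1)] by (simp add: phi_simps)
    finally have "\<phi> u \<odot>\<^bsub>Y\<^esub> h ?d = \<phi> u \<odot>\<^bsub>Y\<^esub> \<zero>\<^bsub>Y\<^esub>" .
    from smult_W_inj[OF Y u(1) h_simps(1)[OF d] Y.M.zero_closed this] have hd0: "h ?d = \<zero>\<^bsub>Y\<^esub>" .
    have "x = ?d \<oplus>\<^bsub>X\<^esub> y" using xy by (simp add: X.M.a_assoc X.M.l_neg)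
    then have "h x = h ?d \<oplus>\<^bsub>Y\<^esub> h y" using h_simps(2)[OF d xy(2)] by simp
    then show ?thesis using hd0 xy h_simps(1) by simp
  qed
  have uniq: "\<exists>z. z \<in> carrier Y \<and> (\<forall>x\<in>carrier X. \<forall>s\<in>W. \<phi> s \<odot>\<^bsub>X'\<^esub> y = \<iota> x \<longrightarrow> \<phi> s \<odot>\<^bsub>Y\<^esub> z = h x)"
    if y: "y \<in> carrier X'" for y
  proof -
    obtain x0 s0 where x0: "x0 \<in> carrier X" and s0: "s0 \<in> W" and e0: "\<phi> s0 \<odot>\<^bsub>X'\<^esub> y = \<iota> x0"
      using ex[OF y] by blast
    obtain z where z: "z \<in> carrier Y" "\<phi> s0 \<odot>\<^bsub>Y\<^esub> z = h x0"
      using smult_W_surj[OF Y s0 h_simps(1)[OF x0]] by blast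
    have "\<phi> s \<odot>\<^bsub>Y\<^esub> z = h x" if x: "x \<in> carrier X" and s: "s \<in> W" and e: "\<phi> s \<odot>\<^bsub>X'\<^esub> y = \<iota> x" for x s
    proof (rule smult_W_inj[OF Y s0])
      have "\<iota> (s \<odot>\<^bsub>X\<^esub> x0) = \<iota> (s0 \<odot>\<^bsub>X\<^esub> x)"
        using Wc[OF s] Wc[OF s0] x x0 y
        by (simp add: lam_simps e[symmetric] e0[symmetric] X'.smult_assoc1[symmetric] phi_simps T.m_comm)
      then have "h (s \<odot>\<^bsub>X\<^esub> x0) = h (s0 \<odot>\<^bsub>X\<^esub> x)"
        using Wc[OF s] Wc[OF s0] x x0 by (intro hd) auto
      then have "\<phi> s \<odot>\<^bsub>Y\<^esub> (\<phi> s0 \<odot>\<^bsub>Y\<^esub> z) = \<phi> s0 \<odot>\<^bsub>Y\<^esub> h x"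
        using Wc[OF s] Wc[OF s0] x x0 by (simp add: h_simps z(2))
      then show "\<phi> s0 \<odot>\<^bsub>Y\<^esub> (\<phi> s \<odot>\<^bsub>Y\<^esub> z) = \<phi> s0 \<odot>\<^bsub>Y\<^esub> h x"
        using Wc[OF s] Wc[OF s0] z(1)
        by (simp add: X'.smult_assoc1 Y.smult_assoc1[symmetric] phi_simps T.m_comm)
    qed (use Wc[OF s] z(1) x in \<open>auto simp: phi_simps h_simps\<close>)
    then show ?thesis using z(1) by blast
  qed
  from bchoice[OF ballI[OF uniq]] obtain h' where h'_all: "\<forall>y\<in>carrier X'. h' y \<in> carrier Y \<and>
      (\<forall>x\<in>carrier X. \<forall>s\<in>W. \<phi> s \<odot>\<^bsub>X'\<^esub> y = \<iota> x \<longrightarrow> \<phi> s \<odot>\<^bsub>Y\<^esub> h' y = h x)"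
    by (rule exE)
  note h'_both = bspec[OF h'_all]
  have h'_closed: "h' y \<in> carrier Y" if "y \<in> carrier X'" for y
    using h'_both[OF that] by blast
  have h'_eq: "\<phi> s \<odot>\<^bsub>Y\<^esub> h' y = h x"
    if "y \<in> carrier X'" "x \<in> carrier X" "s \<in> W" "\<phi> s \<odot>\<^bsub>X'\<^esub> y = \<iota> x" for y x s
    using h'_both[OF that(1)] that(2-4) by blast
  have "(\<lambda>y\<in>carrier X'. h' y) \<in> mod_hom T X' Y"
  proof (rule mod_hom_restrictI[OF X'])
    fix y assume y: "y \<in> carrier X'"
    then show "h' y \<in> carrier Y" by (rule h'_closed)
    obtain x s where x: "x \<in> carrier X" and s: "s \<in> W" and e: "\<phi> s \<odot>\<^bsub>X'\<^esub> y = \<iota> x"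
      using ex[OF y] by blast
    note hy = h'_eq[OF y x s e]
    {
      fix y' assume y': "y' \<in> carrier X'"
      obtain x' s' where x': "x' \<in> carrier X" and s': "s' \<in> W" and e': "\<phi> s' \<odot>\<^bsub>X'\<^esub> y' = \<iota> x'"
        using ex[OF y'] by blast
      note hy' = h'_eq[OF y' x' s' e']
      have "\<phi> (s \<otimes>\<^bsub>R\<^esub> s') \<odot>\<^bsub>X'\<^esub> (y \<oplus>\<^bsub>X'\<^esub> y') = \<phi> s' \<odot>\<^bsub>X'\<^esub> (\<phi> s \<odot>\<^bsub>X'\<^esub> y) \<oplus>\<^bsub>X'\<^esub> \<phi> s \<odot>\<^bsub>X'\<^esub> (\<phi> s' \<odot>\<^bsub>X'\<^esub> y')"
        using Wc[OF s] Wc[OF s'] y y'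
        by (simp add: X'.smult_r_distr X'.smult_assoc1[symmetric] phi_simps T.m_comm)
      also have "\<dots> = \<iota> (s' \<odot>\<^bsub>X\<^esub> x \<oplus>\<^bsub>X\<^esub> s \<odot>\<^bsub>X\<^esub> x')"
        using Wc[OF s] Wc[OF s'] x x' by (simp add: e e' lam_simps)
      finally have "\<phi> (s \<otimes>\<^bsub>R\<^esub> s') \<odot>\<^bsub>Y\<^esub> h' (y \<oplus>\<^bsub>X'\<^esub> y') = h (s' \<odot>\<^bsub>X\<^esub> x \<oplus>\<^bsub>X\<^esub> s \<odot>\<^bsub>X\<^esub> x')"
        using Wc[OF s] Wc[OF s'] x x' y y' W_mult[OF s s'] by (intro h'_eq) auto
      also have "\<dots> = \<phi> s' \<odot>\<^bsub>Y\<^esub> (\<phi> s \<odot>\<^bsub>Y\<^esub> h' y) \<oplus>\<^bsub>Y\<^esub> \<phi> s \<odot>\<^bsub>Y\<^esub> (\<phi> s' \<odot>\<^bsub>Y\<^esub> h' y')"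
        using Wc[OF s] Wc[OF s'] x x' by (simp add: hy hy' h_simps)
      also have "\<dots> = \<phi> (s \<otimes>\<^bsub>R\<^esub> s') \<odot>\<^bsub>Y\<^esub> (h' y \<oplus>\<^bsub>Y\<^esub> h' y')"
        using Wc[OF s] Wc[OF s'] h'_closed[OF y] h'_closed[OF y']
        by (simp add: Y.smult_r_distr Y.smult_assoc1[symmetric] phi_simps T.m_comm)
      finally show "h' (y \<oplus>\<^bsub>X'\<^esub> y') = h' y \<oplus>\<^bsub>Y\<^esub> h' y'"
        using smult_W_inj[OF Y W_mult[OF s s']] h'_closed y y' by simp
    }
    fix t assume t: "t \<in> carrier T"
    obtain a b where a: "a \<in> carrier R" and b: "b \<in> W" and ab: "\<phi> b \<otimes>\<^bsub>T\<^esub> t = \<phi> a" using fraction[OF t] by blast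
    have "\<phi> (b \<otimes>\<^bsub>R\<^esub> s) \<odot>\<^bsub>X'\<^esub> (t \<odot>\<^bsub>X'\<^esub> y) = \<iota> (a \<odot>\<^bsub>X\<^esub> x)"
      using smult_fraction[OF X' t a b ab Wc[OF s] y] a x by (simp add: e lam_simps)
    then have "\<phi> (b \<otimes>\<^bsub>R\<^esub> s) \<odot>\<^bsub>Y\<^esub> h' (t \<odot>\<^bsub>X'\<^esub> y) = h (a \<odot>\<^bsub>X\<^esub> x)"
      using a x t y W_mult[OF b s] by (intro h'_eq) auto
    also have "\<dots> = \<phi> (b \<otimes>\<^bsub>R\<^esub> s) \<odot>\<^bsub>Y\<^esub> (t \<odot>\<^bsub>Y\<^esub> h' y)"
      using smult_fraction[OF Y t a b ab Wc[OF s] h'_closed[OF y]] a x by (simp add: hy h_simps)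
    finally show "h' (t \<odot>\<^bsub>X'\<^esub> y) = t \<odot>\<^bsub>Y\<^esub> h' y"
      using smult_W_inj[OF Y W_mult[OF b s]] h'_closed y t by simp
  qed
  moreover have "(\<lambda>y\<in>carrier X'. h' y) (\<iota> x) = h x" if x: "x \<in> carrier X" for x
    using h'_eq[of "\<iota> x" x "\<one>\<^bsub>R\<^esub>"] x W_one h'_closed[of "\<iota> x"] by (simp add: lam_simps phi_simps)
  ultimately show ?thesis by (rule that)
qed

text \<open>
  Let \<open>0 \<rightarrow> S \<rightarrow> F \<rightarrow> X' \<rightarrow> 0\<close> be the free presentation over \<open>T\<close> and \<open>N\<close> the pullback of \<open>F\<close> along
  \<open>\<iota>\<close>. Then \<open>N \<rightarrow> X\<close> is onto with kernel \<open>S\<close>, so over \<open>R\<close> every homomorphism from \<open>S\<close> to \<open>C\<close> extends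
  to \<open>N\<close>. The other projection \<open>N \<rightarrow> F\<close> is again a localization, because its cokernel and kernel are
  those of \<open>\<iota>\<close>; hence the extension passes from \<open>N\<close> to \<open>F\<close> by the universal property.
\<close>

lemma Ext1_localization:
  assumes loc: "module_localization X X' \<iota>" and C: "module T C"
    and Z: "zero_module (Ext1 R X (restrict_scalars \<phi> C))"
  shows "zero_module (Ext1 T X' C)"
proof -
  have X: "module R X" and X': "module T X'" and iota: "\<iota> \<in> mod_hom R X (restrict_scalars \<phi> X')"
    and ex: "\<And>y. y \<in> carrier X' \<Longrightarrow> \<exists>x\<in>carrier X. \<exists>s\<in>W. \<phi> s \<odot>\<^bsub>X'\<^esub> y = \<iota> x"
    and ker: "\<And>x. x \<in> carrier X \<Longrightarrow> \<iota> x = \<zero>\<^bsub>X'\<^esub> \<Longrightarrow> \<exists>u\<in>W. u \<odot>\<^bsub>X\<^esub> x = \<zero>\<^bsub>X\<^esub>"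
    using loc unfolding module_localization_def by auto
  define F where "F = ext_cover T X'"
  define \<epsilon> where "\<epsilon> = eval_map T X' (carrier X')"
  have F: "module T F" unfolding F_def by (rule module_free_module[OF T.is_cring])
  have eps: "\<epsilon> \<in> mod_hom T F X'" unfolding F_def \<epsilon>_def by (rule eval_map_mod_hom[OF X' order_refl])
  have eps_surj: "\<exists>x\<in>carrier F. \<epsilon> x = y" if "y \<in> carrier X'" for y
    unfolding F_def \<epsilon>_def
    by (rule bexI[where x = "basis_vector T (carrier X') y"])
      (rule eval_map_basis_vector[OF X' order_refl that], rule basis_vector_closed[OF T.is_cring])
  define S where "S = ext_syzygy T X'"
  have S_simps: "k \<in> carrier S \<longleftrightarrow> k \<in> carrier F \<and> \<epsilon> k = \<zero>\<^bsub>X'\<^esub>" "add S = add F" "smult S = smult F" for k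
    by (simp_all add: S_def F_def \<epsilon>_def eval_kernel_def del: free_module_simps)
  interpret X: module R X by fact
  interpret X': module T X' by fact
  interpret F: module T F by fact
  have RC: "module R (restrict_scalars \<phi> C)" and RX': "module R (restrict_scalars \<phi> X')"
    and RF: "module R (restrict_scalars \<phi> F)"
    using module_restrict_scalars[OF R.is_cring _ hom] C X' F by blast+
  define N where "N = pullback_module X (restrict_scalars \<phi> F) \<iota> \<epsilon>"
  have N: "module R N"
    unfolding N_def
    by (rule module_pullback_module[OF X RF RX' iota mod_hom_restrict_scalars[OF hom eps]])
  have N_simps: "(x, y) \<in> carrier N \<longleftrightarrow> x \<in> carrier X \<and> y \<in> carrier F \<and> \<iota> x = \<epsilon> y"
    "(x, y) \<oplus>\<^bsub>N\<^esub> (x', y') = (x \<oplus>\<^bsub>X\<^esub> x', y \<oplus>\<^bsub>F\<^esub> y')"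
    "r \<odot>\<^bsub>N\<^esub> (x, y) = (r \<odot>\<^bsub>X\<^esub> x, \<phi> r \<odot>\<^bsub>F\<^esub> y)" "\<zero>\<^bsub>N\<^esub> = (\<zero>\<^bsub>X\<^esub>, \<zero>\<^bsub>F\<^esub>)" for x y x' y' r
    by (simp_all add: N_def)
  define p where "p = (\<lambda>n\<in>carrier N. fst n)"
  define q where "q = (\<lambda>n\<in>carrier N. snd n)"
  have pq_simps: "(x, y) \<in> carrier N \<Longrightarrow> p (x, y) = x" "(x, y) \<in> carrier N \<Longrightarrow> q (x, y) = y" for x y
    by (simp_all add: p_def q_def)
  have p: "p \<in> mod_hom R N X"
    unfolding p_def by (rule mod_hom_restrictI[OF N]) (auto simp: N_simps)
  have q: "q \<in> mod_hom R N (restrict_scalars \<phi> F)"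
    unfolding q_def by (rule mod_hom_restrictI[OF N]) (auto simp: N_simps)
  have surj: "carrier X \<subseteq> p ` carrier N"
  proof
    fix x assume x: "x \<in> carrier X"
    then obtain y where "y \<in> carrier F" "\<epsilon> y = \<iota> x" using eps_surj mod_hom_closed[OF iota x] by auto
    with x have "(x, y) \<in> carrier N" by (simp add: N_simps)
    then show "x \<in> p ` carrier N" using pq_simps(1) by (intro image_eqI[of _ _ "(x, y)"]) simp_all
  qed
  have locN: "module_localization N F q"
    unfolding module_localization_def
  proof (intro conjI ballI impI N F q)
    fix y assume y: "y \<in> carrier F"
    obtain x s where x: "x \<in> carrier X" "s \<in> W" "\<phi> s \<odot>\<^bsub>X'\<^esub> \<epsilon> y = \<iota> x"
      using ex[OF mod_hom_closed[OF eps y]] by blast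
    have n: "(x, \<phi> s \<odot>\<^bsub>F\<^esub> y) \<in> carrier N"
      using x y W_closed[OF x(2)] by (simp add: N_simps mod_hom_smult[OF eps] phi_simps)
    show "\<exists>n\<in>carrier N. \<exists>s\<in>W. \<phi> s \<odot>\<^bsub>F\<^esub> y = q n"
      by (rule bexI[OF _ n], rule bexI[OF _ x(2)]) (rule pq_simps(2)[OF n, symmetric])
  next
    fix n assume n: "n \<in> carrier N" and qn: "q n = \<zero>\<^bsub>F\<^esub>"
    obtain x y where xy: "n = (x, y)" by (cases n)
    have x: "x \<in> carrier X" "y = \<zero>\<^bsub>F\<^esub>" "\<iota> x = \<zero>\<^bsub>X'\<^esub>"
      using n qn mod_hom_zero[OF F X' eps] by (auto simp: xy pq_simps) (auto simp: N_simps)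
    obtain u where u: "u \<in> W" "u \<odot>\<^bsub>X\<^esub> x = \<zero>\<^bsub>X\<^esub>" using ker[OF x(1,3)] by blast
    then have "u \<odot>\<^bsub>N\<^esub> n = \<zero>\<^bsub>N\<^esub>"
      using W_closed[OF u(1)] by (simp add: xy N_simps x(2) phi_simps)
    then show "\<exists>u\<in>W. u \<odot>\<^bsub>N\<^esub> n = \<zero>\<^bsub>N\<^esub>" using u(1) by blast
  qed
  have "\<exists>g\<in>mod_hom T F C. \<forall>k\<in>carrier S. g k = f k" if f: "f \<in> mod_hom T S C" for f
  proof -
    let ?L = "{n \<in> carrier N. p n = \<zero>\<^bsub>X\<^esub>}"
    have L: "module R (N\<lparr>carrier := ?L\<rparr>)" by (rule module_kernel[OF N X p])
    have LD: "y \<in> carrier S" "(x, y) \<in> carrier N" if "(x, y) \<in> ?L" for x y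
      using that mod_hom_zero[OF X RX' iota] by (auto simp: pq_simps) (auto simp: N_simps S_simps)
    have qfun: "(\<lambda>n\<in>?L. q n) \<in> mod_hom R (N\<lparr>carrier := ?L\<rparr>) (restrict_scalars \<phi> S)"
      using mod_hom_closed[OF q] LD pq_simps(2)
      by (intro mod_hom_restrictI[OF L, simplified])
        (auto simp: S_simps(2,3) mod_hom_add[OF q] mod_hom_smult[OF q])
    have f': "compose ?L f (\<lambda>n\<in>?L. q n) \<in> mod_hom R (N\<lparr>carrier := ?L\<rparr>) (restrict_scalars \<phi> C)"
      using mod_hom_compose[OF L qfun mod_hom_restrict_scalars[OF hom f]] by simp
    obtain h where h: "h \<in> mod_hom R N (restrict_scalars \<phi> C)"
      "\<And>n. n \<in> carrier N \<Longrightarrow> p n = \<zero>\<^bsub>X\<^esub> \<Longrightarrow> h n = compose ?L f (\<lambda>n\<in>?L. q n) n"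
      using Ext1_zero_extend[OF X RC Z N p surj f'] by blast
    obtain g where g: "g \<in> mod_hom T F C" "\<And>n. n \<in> carrier N \<Longrightarrow> g (q n) = h n"
      using module_localization_extend[OF locN C h(1)] by blast
    have "g k = f k" if "k \<in> carrier S" for k
    proof -
      have n: "(\<zero>\<^bsub>X\<^esub>, k) \<in> carrier N"
        using that mod_hom_zero[OF X RX' iota] by (simp add: N_simps S_simps)
      then show ?thesis
        using g(2)[OF n] h(2)[OF n] by (simp add: pq_simps compose_def)
    qed
    then show ?thesis using g(1) by blast
  qed
  then show ?thesis
    unfolding zero_module_Ext1_iff[OF X' C] S_def F_def by blast
qed

text \<open>
  The converse direction. The localization \<open>F'\<close> of the free cover \<open>F\<close> maps onto \<open>X'\<close>, and the kernel
  of this map is a localization of the syzygy. So a homomorphism from the syzygy to \<open>C\<close> extends to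
  this kernel by the universal property, then to \<open>F'\<close> because \<open>Ext\<^sup>1(X', C) = 0\<close> over \<open>T\<close>, and the
  result is restricted along \<open>F \<rightarrow> F'\<close>. The module \<open>F'\<close> is a parameter, so the argument does not
  depend on a model of fractions.
\<close>

lemma Ext1_of_localization:
  assumes loc: "module_localization X X' \<iota>" and C: "module T C"
    and locF: "module_localization (ext_cover R X) F' \<kappa>"
    and Z: "zero_module (Ext1 T X' C)"
  shows "zero_module (Ext1 R X (restrict_scalars \<phi> C))"
proof -
  have X: "module R X" and X': "module T X'" and iota: "\<iota> \<in> mod_hom R X (restrict_scalars \<phi> X')"
    and ex: "\<And>y. y \<in> carrier X' \<Longrightarrow> \<exists>x\<in>carrier X. \<exists>s\<in>W. \<phi> s \<odot>\<^bsub>X'\<^esub> y = \<iota> x"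
    and ker: "\<And>x. x \<in> carrier X \<Longrightarrow> \<iota> x = \<zero>\<^bsub>X'\<^esub> \<Longrightarrow> \<exists>u\<in>W. u \<odot>\<^bsub>X\<^esub> x = \<zero>\<^bsub>X\<^esub>"
    using loc unfolding module_localization_def by auto
  let ?F = "ext_cover R X" and ?eps = "eval_map R X (carrier X)" and ?K = "eval_kernel R X (carrier X)"
  have F: "module R ?F" and F': "module T F'" and kappa: "\<kappa> \<in> mod_hom R ?F (restrict_scalars \<phi> F')"
    and exF: "\<And>y. y \<in> carrier F' \<Longrightarrow> \<exists>x\<in>carrier ?F. \<exists>s\<in>W. \<phi> s \<odot>\<^bsub>F'\<^esub> y = \<kappa> x"
    and kerF: "\<And>x. x \<in> carrier ?F \<Longrightarrow> \<kappa> x = \<zero>\<^bsub>F'\<^esub> \<Longrightarrow> \<exists>u\<in>W. u \<odot>\<^bsub>?F\<^esub> x = \<zero>\<^bsub>?F\<^esub>"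
    using locF unfolding module_localization_def by auto
  have eps: "?eps \<in> mod_hom R ?F X" by (rule eval_map_mod_hom[OF X order_refl])
  interpret X: module R X by fact
  interpret X': module T X' by fact
  interpret F: module R ?F by fact
  interpret F': module T F' by fact
  have S: "module R (ext_syzygy R X)" by (rule module_eval_kernel[OF X order_refl])
  have RC: "module R (restrict_scalars \<phi> C)" and RX': "module R (restrict_scalars \<phi> X')"
    using module_restrict_scalars[OF R.is_cring _ hom] C X' by blast+
  note kappa_simps = mod_hom_closed[OF kappa, simplified] mod_hom_add[OF kappa] mod_hom_smult[OF kappa]
  note Wc = W_closed
  obtain \<pi> where pi: "\<pi> \<in> mod_hom T F' X'" and "\<And>x. x \<in> carrier ?F \<Longrightarrow> \<pi> (\<kappa> x) = compose (carrier ?F) \<iota> ?eps x"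
    using module_localization_extend[OF locF X' mod_hom_compose[OF F eps iota]] by blast
  then have pik: "\<pi> (\<kappa> x) = \<iota> (?eps x)" if "x \<in> carrier ?F" for x using that by (simp add: compose_def)
  have surj: "carrier X' \<subseteq> \<pi> ` carrier F'"
  proof
    fix y assume y: "y \<in> carrier X'"
    obtain x s where x: "x \<in> carrier X" "s \<in> W" "\<phi> s \<odot>\<^bsub>X'\<^esub> y = \<iota> x" using ex[OF y] by blast
    let ?e = "basis_vector R (carrier X) x"
    have e: "?e \<in> carrier ?F" by (rule basis_vector_closed[OF R.is_cring])
    obtain z where z: "z \<in> carrier F'" "\<phi> s \<odot>\<^bsub>F'\<^esub> z = \<kappa> ?e"
      using smult_W_surj[OF F' x(2) kappa_simps(1)[OF e]] by blast
    have "\<phi> s \<odot>\<^bsub>X'\<^esub> \<pi> z = \<pi> (\<kappa> ?e)"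
      unfolding z(2)[symmetric] using z(1) Wc[OF x(2)] by (simp add: mod_hom_smult[OF pi] phi_simps)
    also have "\<dots> = \<phi> s \<odot>\<^bsub>X'\<^esub> y" unfolding pik[OF e] eval_map_basis_vector[OF X order_refl x(1)] x(3) ..
    finally have "\<pi> z = y" using smult_W_inj[OF X' x(2)] mod_hom_closed[OF pi z(1)] y by blast
    then show "y \<in> \<pi> ` carrier F'" using z(1) by blast
  qed
  let ?L = "{n \<in> carrier F'. \<pi> n = \<zero>\<^bsub>X'\<^esub>}"
  have L: "module T (F'\<lparr>carrier := ?L\<rparr>)" by (rule module_kernel[OF F' X' pi])
  have kL: "\<kappa> k \<in> ?L" if "k \<in> ?K" for k
    using that kappa_simps(1) pik mod_hom_zero[OF X RX' iota] by (simp add: eval_kernel_def)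
  have locK: "module_localization (ext_syzygy R X) (F'\<lparr>carrier := ?L\<rparr>) (\<lambda>k\<in>?K. \<kappa> k)"
    unfolding module_localization_def
  proof (intro conjI ballI impI S L)
    have "(\<lambda>k\<in>carrier (ext_syzygy R X). \<kappa> k) \<in> mod_hom R (ext_syzygy R X) (restrict_scalars \<phi> (F'\<lparr>carrier := ?L\<rparr>))"
      by (rule mod_hom_restrictI[OF S])
        (use kL in \<open>auto simp: eval_kernel_def mod_hom_add[OF kappa, simplified] mod_hom_smult[OF kappa, simplified]\<close>)
    then show "(\<lambda>k\<in>?K. \<kappa> k) \<in> mod_hom R (ext_syzygy R X) (restrict_scalars \<phi> (F'\<lparr>carrier := ?L\<rparr>))"
      by simp
  next
    fix n assume "n \<in> carrier (F'\<lparr>carrier := ?L\<rparr>)"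
    then have n: "n \<in> carrier F'" "\<pi> n = \<zero>\<^bsub>X'\<^esub>" by auto
    obtain x s where x: "x \<in> carrier ?F" "s \<in> W" "\<phi> s \<odot>\<^bsub>F'\<^esub> n = \<kappa> x" using exF[OF n(1)] by blast
    have "\<iota> (?eps x) = \<zero>\<^bsub>X'\<^esub>"
      unfolding pik[OF x(1), symmetric] x(3)[symmetric]
      using n Wc[OF x(2)] by (simp add: mod_hom_smult[OF pi] phi_simps)
    then obtain u where u: "u \<in> W" "u \<odot>\<^bsub>X\<^esub> ?eps x = \<zero>\<^bsub>X\<^esub>" using ker mod_hom_closed[OF eps x(1)] by blast
    let ?k = "u \<odot>\<^bsub>?F\<^esub> x"
    have k: "?k \<in> ?K"
      using u Wc[OF u(1)] x(1) F.smult_closed[of u x]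
      by (simp add: eval_kernel_def mod_hom_smult[OF eps] del: free_module_simps)
    have "\<phi> (u \<otimes>\<^bsub>R\<^esub> s) \<odot>\<^bsub>F'\<^esub> n = \<kappa> ?k"
      using Wc[OF u(1)] Wc[OF x(2)] n x(1)
      by (simp add: phi_simps F'.smult_assoc1 x(3) mod_hom_smult[OF kappa] del: free_module_simps)
    then show "\<exists>k\<in>carrier (ext_syzygy R X). \<exists>s\<in>W. \<phi> s \<odot>\<^bsub>F'\<lparr>carrier := ?L\<rparr>\<^esub> n = (\<lambda>k\<in>?K. \<kappa> k) k"
      using k W_mult[OF u(1) x(2)] by (intro bexI[of _ ?k] bexI[of _ "u \<otimes>\<^bsub>R\<^esub> s"]) (simp_all del: free_module_simps)
  next
    fix k assume "k \<in> carrier (ext_syzygy R X)" "(\<lambda>k\<in>?K. \<kappa> k) k = \<zero>\<^bsub>F'\<lparr>carrier := ?L\<rparr>\<^esub>"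
    then show "\<exists>u\<in>W. u \<odot>\<^bsub>ext_syzygy R X\<^esub> k = \<zero>\<^bsub>ext_syzygy R X\<^esub>"
      using kerF[of k] by (simp add: eval_kernel_def)
  qed
  show ?thesis
    unfolding zero_module_Ext1_iff[OF X RC]
  proof
    fix f assume f: "f \<in> mod_hom R (ext_syzygy R X) (restrict_scalars \<phi> C)"
    obtain f' where f': "f' \<in> mod_hom T (F'\<lparr>carrier := ?L\<rparr>) C"
      "\<And>k. k \<in> carrier (ext_syzygy R X) \<Longrightarrow> f' ((\<lambda>k\<in>?K. \<kappa> k) k) = f k"
      using module_localization_extend[OF locK C f] by blast
    obtain h where h: "h \<in> mod_hom T F' C" "\<And>n. n \<in> carrier F' \<Longrightarrow> \<pi> n = \<zero>\<^bsub>X'\<^esub> \<Longrightarrow> h n = f' n"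
      using Ext1_zero_extend[OF X' C Z F' pi surj f'(1)] by blast
    have "compose (carrier ?F) h \<kappa> \<in> mod_hom R ?F (restrict_scalars \<phi> C)"
      by (rule mod_hom_compose[OF F kappa mod_hom_restrict_scalars[OF hom h(1)]])
    moreover have "compose (carrier ?F) h \<kappa> k = f k" if "k \<in> carrier (ext_syzygy R X)" for k
      using that f'(2)[OF that] kL[of k] h(2)[of "\<kappa> k"] by (auto simp: compose_def eval_kernel_def)
    ultimately show "\<exists>g\<in>mod_hom R ?F (restrict_scalars \<phi> C). \<forall>k\<in>carrier (ext_syzygy R X). g k = f k"
      by blast
  qed
qed

end

section \<open>Rings and modules of fractions\<close>

lemma self_module_simps [simp]:
  "carrier (self_module R) = carrier R"
  "zero (self_module R) = zero R"
  "add (self_module R) = add R"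
  "smult (self_module R) = mult R"
  by (simp_all add: self_module_def)

lemma module_self_module:
  assumes "cring R"
  shows "module R (self_module R)"
proof -
  interpret cring R by fact
  have "abelian_group (self_module R)"
    by (rule abelian_groupI) (auto simp: a_ac intro!: bexI[of _ "\<ominus>\<^bsub>R\<^esub> _"] r_neg)
  then show ?thesis
    by (rule moduleI[OF assms]) (auto simp: l_distr r_distr m_assoc)
qed

locale multiplicative_subset = cring R for R (structure) +
  fixes S :: "'a set"
  assumes S_subset: "S \<subseteq> carrier R"
    and S_one: "\<one> \<in> S"
    and S_mult: "\<And>s t. s \<in> S \<Longrightarrow> t \<in> S \<Longrightarrow> s \<otimes> t \<in> S"
begin

lemma S_closed: "s \<in> S \<Longrightarrow> s \<in> carrier R"
  using S_subset by blast

lemma loc_rel_iff: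
  "((x, s), (y, t)) \<in> loc_rel R S M \<longleftrightarrow> x \<in> carrier M \<and> y \<in> carrier M \<and> s \<in> S \<and> t \<in> S \<and>
     (\<exists>u\<in>S. u \<odot>\<^bsub>M\<^esub> (t \<odot>\<^bsub>M\<^esub> x) = u \<odot>\<^bsub>M\<^esub> (s \<odot>\<^bsub>M\<^esub> y))"
  by (simp add: loc_rel_def)

lemma equiv_loc_rel:
  assumes "module R M"
  shows "equiv (carrier M \<times> S) (loc_rel R S M)"
proof -
  interpret M: module R M by fact
  show ?thesis
  proof (rule equivI)
    show "loc_rel R S M \<subseteq> (carrier M \<times> S) \<times> carrier M \<times> S" by (auto simp: loc_rel_def)
    show "refl_on (carrier M \<times> S) (loc_rel R S M)"
      using S_one by (auto simp: refl_on_def loc_rel_def)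
    show "sym (loc_rel R S M)"
      unfolding sym_def by (auto simp: loc_rel_iff) metis
    show "trans (loc_rel R S M)"
    proof (rule transI, clarify)
      fix x s y t z r
      assume "((x, s), (y, t)) \<in> loc_rel R S M" "((y, t), (z, r)) \<in> loc_rel R S M"
      then obtain u v where xyz: "x \<in> carrier M" "y \<in> carrier M" "z \<in> carrier M"
        and str: "s \<in> S" "t \<in> S" "r \<in> S" and uv: "u \<in> S" "v \<in> S"
        and u: "u \<odot>\<^bsub>M\<^esub> (t \<odot>\<^bsub>M\<^esub> x) = u \<odot>\<^bsub>M\<^esub> (s \<odot>\<^bsub>M\<^esub> y)"
        and v: "v \<odot>\<^bsub>M\<^esub> (r \<odot>\<^bsub>M\<^esub> y) = v \<odot>\<^bsub>M\<^esub> (t \<odot>\<^bsub>M\<^esub> z)"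
        by (auto simp: loc_rel_iff)
      note c = S_closed[OF str(1)] S_closed[OF str(2)] S_closed[OF str(3)] S_closed[OF uv(1)] S_closed[OF uv(2)]
      have "(u \<otimes> (v \<otimes> t)) \<odot>\<^bsub>M\<^esub> (r \<odot>\<^bsub>M\<^esub> x) = (v \<otimes> r) \<odot>\<^bsub>M\<^esub> (u \<odot>\<^bsub>M\<^esub> (t \<odot>\<^bsub>M\<^esub> x))"
        using c xyz by (simp add: M.smult_assoc1[symmetric] m_ac)
      also have "\<dots> = (u \<otimes> s) \<odot>\<^bsub>M\<^esub> (v \<odot>\<^bsub>M\<^esub> (r \<odot>\<^bsub>M\<^esub> y))"
        unfolding u using c xyz by (simp add: M.smult_assoc1[symmetric] m_ac)
      also have "\<dots> = (u \<otimes> (v \<otimes> t)) \<odot>\<^bsub>M\<^esub> (s \<odot>\<^bsub>M\<^esub> z)"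
        unfolding v using c xyz by (simp add: M.smult_assoc1[symmetric] m_ac)
      finally show "((x, s), (z, r)) \<in> loc_rel R S M"
        using xyz str uv by (auto simp: loc_rel_iff intro!: bexI[of _ "u \<otimes> (v \<otimes> t)"] S_mult)
    qed
  qed
qed

lemma loc_frac_eq_iff:
  assumes "module R M" "x \<in> carrier M" "y \<in> carrier M" "s \<in> S" "t \<in> S"
  shows "loc_frac R S M x s = loc_frac R S M y t \<longleftrightarrow>
    (\<exists>u\<in>S. u \<odot>\<^bsub>M\<^esub> (t \<odot>\<^bsub>M\<^esub> x) = u \<odot>\<^bsub>M\<^esub> (s \<odot>\<^bsub>M\<^esub> y))"
  unfolding loc_frac_def
  using eq_equiv_class_iff[OF equiv_loc_rel[OF assms(1)], of "(x, s)" "(y, t)"] assms(2-5)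
  by (simp add: loc_rel_iff)

lemma loc_frac_eqI:
  assumes "module R M" "x \<in> carrier M" "y \<in> carrier M" "s \<in> S" "t \<in> S" "u \<in> S"
    "u \<odot>\<^bsub>M\<^esub> (t \<odot>\<^bsub>M\<^esub> x) = u \<odot>\<^bsub>M\<^esub> (s \<odot>\<^bsub>M\<^esub> y)"
  shows "loc_frac R S M x s = loc_frac R S M y t"
  unfolding loc_frac_eq_iff[OF assms(1-5)] using assms(6,7) by (rule bexI[rotated])

lemma loc_frac_mem:
  assumes "module R M" "x \<in> carrier M" "s \<in> S"
  shows "(x, s) \<in> loc_frac R S M x s"
  using assms unfolding loc_frac_def by (intro equiv_class_self[OF equiv_loc_rel]) auto

lemma loc_frac_memD:
  assumes "(y, t) \<in> loc_frac R S M x s"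
  shows "x \<in> carrier M" "s \<in> S" "y \<in> carrier M" "t \<in> S"
    "\<exists>u\<in>S. u \<odot>\<^bsub>M\<^esub> (t \<odot>\<^bsub>M\<^esub> x) = u \<odot>\<^bsub>M\<^esub> (s \<odot>\<^bsub>M\<^esub> y)"
  using assms by (auto simp: loc_frac_def loc_rel_iff)

text \<open>
  The operations on fractions are unions over all representatives. Once the summand is known to
  be the same for all of them, the union is its value at the given representative.
\<close>

lemma loc_frac_UN:
  assumes "module R M" "x \<in> carrier M" "s \<in> S"
    and "\<And>y t. (y, t) \<in> loc_frac R S M x s \<Longrightarrow> f y t = f x s"
  shows "(\<Union>(y, t)\<in>loc_frac R S M x s. f y t) = f x s"
  by (rule UN_constant_eq[OF loc_frac_mem[OF assms(1-3)]]) (use assms(4) in auto)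

lemma loc_module_simps:
  "carrier (loc_module R S M) = (carrier M \<times> S) // loc_rel R S M"
  "\<zero>\<^bsub>loc_module R S M\<^esub> = loc_frac R S M \<zero>\<^bsub>M\<^esub> \<one>"
  by (simp_all add: loc_module_def)

lemma loc_frac_closed:
  assumes "x \<in> carrier M" "s \<in> S"
  shows "loc_frac R S M x s \<in> carrier (loc_module R S M)"
  using assms by (simp add: loc_module_simps loc_frac_def quotientI)

lemma loc_frac_cases:
  assumes "X \<in> carrier (loc_module R S M)"
  obtains x s where "x \<in> carrier M" "s \<in> S" "X = loc_frac R S M x s"
  using assms by (auto simp: loc_module_simps loc_frac_def elim!: quotientE)

lemma loc_add_frac:
  assumes "module R M" "x \<in> carrier M" "s \<in> S" "y \<in> carrier M" "t \<in> S"
  shows "loc_frac R S M x s \<oplus>\<^bsub>loc_module R S M\<^esub> loc_frac R S M y t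
    = loc_frac R S M (t \<odot>\<^bsub>M\<^esub> x \<oplus>\<^bsub>M\<^esub> s \<odot>\<^bsub>M\<^esub> y) (s \<otimes> t)"
proof -
  interpret M: module R M by fact
  let ?f = "\<lambda>x s y t. loc_frac R S M (t \<odot>\<^bsub>M\<^esub> x \<oplus>\<^bsub>M\<^esub> s \<odot>\<^bsub>M\<^esub> y) (s \<otimes> t)"
  have wd: "?f x' s' y' t' = ?f x s y t"
    if "(x', s') \<in> loc_frac R S M x s" "(y', t') \<in> loc_frac R S M y t" for x s y t x' s' y' t'
  proof -
    note a = loc_frac_memD[OF that(1)] and b = loc_frac_memD[OF that(2)]
    obtain u v where uv: "u \<in> S" "v \<in> S" and u: "u \<odot>\<^bsub>M\<^esub> (s' \<odot>\<^bsub>M\<^esub> x) = u \<odot>\<^bsub>M\<^esub> (s \<odot>\<^bsub>M\<^esub> x')"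
      and v: "v \<odot>\<^bsub>M\<^esub> (t' \<odot>\<^bsub>M\<^esub> y) = v \<odot>\<^bsub>M\<^esub> (t \<odot>\<^bsub>M\<^esub> y')" using a(5) b(5) by blast
    note c = S_closed[OF a(2)] S_closed[OF a(4)] S_closed[OF b(2)] S_closed[OF b(4)]
      S_closed[OF uv(1)] S_closed[OF uv(2)]
    have "(u \<otimes> v) \<odot>\<^bsub>M\<^esub> ((s \<otimes> t) \<odot>\<^bsub>M\<^esub> (t' \<odot>\<^bsub>M\<^esub> x' \<oplus>\<^bsub>M\<^esub> s' \<odot>\<^bsub>M\<^esub> y'))
        = (v \<otimes> t' \<otimes> t) \<odot>\<^bsub>M\<^esub> (u \<odot>\<^bsub>M\<^esub> (s \<odot>\<^bsub>M\<^esub> x')) \<oplus>\<^bsub>M\<^esub> (u \<otimes> s' \<otimes> s) \<odot>\<^bsub>M\<^esub> (v \<odot>\<^bsub>M\<^esub> (t \<odot>\<^bsub>M\<^esub> y'))"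
      using c a(1,3) b(1,3) by (simp add: M.smult_r_distr M.smult_assoc1[symmetric] m_ac)
    also have "\<dots> = (u \<otimes> v) \<odot>\<^bsub>M\<^esub> ((s' \<otimes> t') \<odot>\<^bsub>M\<^esub> (t \<odot>\<^bsub>M\<^esub> x \<oplus>\<^bsub>M\<^esub> s \<odot>\<^bsub>M\<^esub> y))"
      unfolding u[symmetric] v[symmetric]
      using c a(1,3) b(1,3) by (simp add: M.smult_r_distr M.smult_assoc1[symmetric] m_ac)
    finally have eq: "(u \<otimes> v) \<odot>\<^bsub>M\<^esub> ((s \<otimes> t) \<odot>\<^bsub>M\<^esub> (t' \<odot>\<^bsub>M\<^esub> x' \<oplus>\<^bsub>M\<^esub> s' \<odot>\<^bsub>M\<^esub> y'))
      = (u \<otimes> v) \<odot>\<^bsub>M\<^esub> ((s' \<otimes> t') \<odot>\<^bsub>M\<^esub> (t \<odot>\<^bsub>M\<^esub> x \<oplus>\<^bsub>M\<^esub> s \<odot>\<^bsub>M\<^esub> y))" .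
    show ?thesis
      by (rule loc_frac_eqI[OF assms(1) _ _ _ _ S_mult[OF uv] eq]) (use c a b S_mult in auto)
  qed
  have "loc_frac R S M x s \<oplus>\<^bsub>loc_module R S M\<^esub> loc_frac R S M y t
    = (\<Union>(x', s')\<in>loc_frac R S M x s. \<Union>(y', t')\<in>loc_frac R S M y t. ?f x' s' y' t')"
    by (simp add: loc_module_def)
  also have "\<dots> = (\<Union>(y', t')\<in>loc_frac R S M y t. ?f x s y' t')"
    by (rule loc_frac_UN[OF assms(1-3)]) 
      (intro SUP_cong refl, clarify, rule wd[OF _ loc_frac_mem[OF assms(1)]], auto dest: loc_frac_memD)
  also have "\<dots> = ?f x s y t"
    by (rule loc_frac_UN[OF assms(1,4,5)]) (rule wd[OF loc_frac_mem[OF assms(1-3)]])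
  finally show ?thesis .
qed

lemma loc_smult_frac:
  assumes "module R M" "a \<in> carrier R" "s \<in> S" "y \<in> carrier M" "t \<in> S"
  shows "loc_frac R S (self_module R) a s \<odot>\<^bsub>loc_module R S M\<^esub> loc_frac R S M y t
    = loc_frac R S M (a \<odot>\<^bsub>M\<^esub> y) (s \<otimes> t)"
proof -
  interpret M: module R M by fact
  have RM: "module R (self_module R)" by (rule module_self_module[OF is_cring])
  let ?A = "loc_frac R S (self_module R)"
  let ?f = "\<lambda>a s y t. loc_frac R S M (a \<odot>\<^bsub>M\<^esub> y) (s \<otimes> t)"
  have wd: "?f a' s' y' t' = ?f a s y t"
    if "(a', s') \<in> ?A a s" "(y', t') \<in> loc_frac R S M y t" for a s y t a' s' y' t'
  proof -
    note a = loc_frac_memD[OF that(1), simplified] and b = loc_frac_memD[OF that(2)]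
    obtain u v where uv: "u \<in> S" "v \<in> S" and u: "u \<otimes> (s' \<otimes> a) = u \<otimes> (s \<otimes> a')"
      and v: "v \<odot>\<^bsub>M\<^esub> (t' \<odot>\<^bsub>M\<^esub> y) = v \<odot>\<^bsub>M\<^esub> (t \<odot>\<^bsub>M\<^esub> y')" using a(5) b(5) by blast
    note c = S_closed[OF a(2)] S_closed[OF a(4)] S_closed[OF b(2)] S_closed[OF b(4)]
      S_closed[OF uv(1)] S_closed[OF uv(2)]
    have "(u \<otimes> v) \<odot>\<^bsub>M\<^esub> ((s \<otimes> t) \<odot>\<^bsub>M\<^esub> (a' \<odot>\<^bsub>M\<^esub> y'))
        = (u \<otimes> (s \<otimes> a')) \<odot>\<^bsub>M\<^esub> (v \<odot>\<^bsub>M\<^esub> (t \<odot>\<^bsub>M\<^esub> y'))"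
      using c a(1,3) b(1,3) by (simp add: M.smult_assoc1[symmetric] m_ac)
    also have "\<dots> = (u \<otimes> v) \<odot>\<^bsub>M\<^esub> ((s' \<otimes> t') \<odot>\<^bsub>M\<^esub> (a \<odot>\<^bsub>M\<^esub> y))"
      unfolding u[symmetric] v[symmetric]
      using c a(1,3) b(1,3) by (simp add: M.smult_assoc1[symmetric] m_ac)
    finally have eq: "(u \<otimes> v) \<odot>\<^bsub>M\<^esub> ((s \<otimes> t) \<odot>\<^bsub>M\<^esub> (a' \<odot>\<^bsub>M\<^esub> y'))
      = (u \<otimes> v) \<odot>\<^bsub>M\<^esub> ((s' \<otimes> t') \<odot>\<^bsub>M\<^esub> (a \<odot>\<^bsub>M\<^esub> y))" .
    show ?thesis
      by (rule loc_frac_eqI[OF assms(1) _ _ _ _ S_mult[OF uv] eq]) (use c a b S_mult in auto)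
  qed
  have "?A a s \<odot>\<^bsub>loc_module R S M\<^esub> loc_frac R S M y t
    = (\<Union>(a', s')\<in>?A a s. \<Union>(y', t')\<in>loc_frac R S M y t. ?f a' s' y' t')"
    by (simp add: loc_module_def)
  also have "\<dots> = (\<Union>(y', t')\<in>loc_frac R S M y t. ?f a s y' t')"
    using assms(2,3)
    by (intro loc_frac_UN[OF RM])
      (simp_all, intro SUP_cong refl, clarify, rule wd[OF _ loc_frac_mem[OF assms(1)]], auto dest: loc_frac_memD)
  also have "\<dots> = ?f a s y t"
    using assms(2,3) by (intro loc_frac_UN[OF assms(1,4,5)] wd loc_frac_mem[OF RM]) simp_all
  finally show ?thesis .
qed

lemma loc_frac_scale:
  assumes "module R M" "x \<in> carrier M" "s \<in> S" "u \<in> S"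
  shows "loc_frac R S M (u \<odot>\<^bsub>M\<^esub> x) (u \<otimes> s) = loc_frac R S M x s"
proof -
  interpret M: module R M by fact
  show ?thesis
    using assms S_closed[OF assms(3)] S_closed[OF assms(4)]
    by (intro loc_frac_eqI[OF assms(1) _ _ _ _ S_one])
      (simp_all add: S_mult M.smult_assoc1[symmetric] m_ac)
qed

lemma loc_add_frac_same:
  assumes "module R M" "x \<in> carrier M" "y \<in> carrier M" "s \<in> S"
  shows "loc_frac R S M x s \<oplus>\<^bsub>loc_module R S M\<^esub> loc_frac R S M y s = loc_frac R S M (x \<oplus>\<^bsub>M\<^esub> y) s"
proof -
  interpret M: module R M by fact
  show ?thesis
    using loc_add_frac[OF assms(1,2,4,3,4)] loc_frac_scale[OF assms(1) _ assms(4,4), of "x \<oplus>\<^bsub>M\<^esub> y"]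
      S_closed[OF assms(4)] assms(2,3)
    by (simp add: M.smult_r_distr)
qed

lemma loc_zero_frac:
  assumes "module R M" "s \<in> S"
  shows "\<zero>\<^bsub>loc_module R S M\<^esub> = loc_frac R S M \<zero>\<^bsub>M\<^esub> s"
proof -
  interpret M: module R M by fact
  show ?thesis
    unfolding loc_module_simps using S_closed[OF assms(2)] assms
    by (intro loc_frac_eqI[OF assms(1) _ _ _ _ S_one]) (simp_all add: S_one)
qed

text \<open>
  Over a common denominator the addition of fractions is the addition of numerators, which reduces
  the group axioms for fractions to those of the given module.
\<close>

lemma common_denominator:
  assumes "module R M" "X \<in> carrier (loc_module R S M)" "Y \<in> carrier (loc_module R S M)"
  obtains x y s where "x \<in> carrier M" "y \<in> carrier M" "s \<in> S"
    "X = loc_frac R S M x s" "Y = loc_frac R S M y s"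
proof -
  interpret M: module R M by fact
  obtain x s where X: "x \<in> carrier M" "s \<in> S" "X = loc_frac R S M x s"
    by (rule loc_frac_cases[OF assms(2)])
  obtain y t where Y: "y \<in> carrier M" "t \<in> S" "Y = loc_frac R S M y t"
    by (rule loc_frac_cases[OF assms(3)])
  show ?thesis
  proof (rule that[of "t \<odot>\<^bsub>M\<^esub> x" "s \<odot>\<^bsub>M\<^esub> y" "t \<otimes> s"])
    show "X = loc_frac R S M (t \<odot>\<^bsub>M\<^esub> x) (t \<otimes> s)"
      using loc_frac_scale[OF assms(1) X(1,2) Y(2)] X(3) by simp
    show "Y = loc_frac R S M (s \<odot>\<^bsub>M\<^esub> y) (t \<otimes> s)"
      using loc_frac_scale[OF assms(1) Y(1,2) X(2)] Y(3) S_closed[OF X(2)] S_closed[OF Y(2)]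
      by (simp add: m_comm)
  qed (use X Y S_closed S_mult in auto)
qed

lemma abelian_group_loc_module:
  assumes "module R M"
  shows "abelian_group (loc_module R S M)"
proof -
  interpret M: module R M by fact
  note add = loc_add_frac_same[OF assms]
  let ?L = "loc_module R S M" and ?q = "loc_frac R S M"
  show ?thesis
  proof (rule abelian_groupI)
    fix X Y assume X: "X \<in> carrier ?L" and Y: "Y \<in> carrier ?L"
    obtain x y s where e: "x \<in> carrier M" "y \<in> carrier M" "s \<in> S" "X = ?q x s" "Y = ?q y s"
      by (rule common_denominator[OF assms X Y])
    show "X \<oplus>\<^bsub>?L\<^esub> Y \<in> carrier ?L" "X \<oplus>\<^bsub>?L\<^esub> Y = Y \<oplus>\<^bsub>?L\<^esub> X"
      using e by (simp_all add: add loc_frac_closed M.M.a_comm)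
    fix Z assume Z: "Z \<in> carrier ?L"
    obtain z t where z: "z \<in> carrier M" "t \<in> S" "Z = ?q z t" by (rule loc_frac_cases[OF Z])
    have "X = ?q (t \<odot>\<^bsub>M\<^esub> x) (t \<otimes> s)" "Y = ?q (t \<odot>\<^bsub>M\<^esub> y) (t \<otimes> s)" "Z = ?q (s \<odot>\<^bsub>M\<^esub> z) (t \<otimes> s)"
      using loc_frac_scale[OF assms e(1,3) z(2)] loc_frac_scale[OF assms e(2,3) z(2)]
        loc_frac_scale[OF assms z(1,2) e(3)] S_closed[OF e(3)] S_closed[OF z(2)] e(4,5) z(3)
      by (simp_all add: m_comm)
    then show "X \<oplus>\<^bsub>?L\<^esub> Y \<oplus>\<^bsub>?L\<^esub> Z = X \<oplus>\<^bsub>?L\<^esub> (Y \<oplus>\<^bsub>?L\<^esub> Z)"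
      using e(1-3) z(1,2) S_closed S_mult by (simp add: add M.M.a_assoc)
  next
    fix X assume "X \<in> carrier ?L"
    then obtain x s where x: "x \<in> carrier M" "s \<in> S" "X = ?q x s" by (rule loc_frac_cases)
    show "\<zero>\<^bsub>?L\<^esub> \<oplus>\<^bsub>?L\<^esub> X = X"
      unfolding loc_zero_frac[OF assms x(2)] using x by (simp add: add)
    have "?q (\<ominus>\<^bsub>M\<^esub> x) s \<oplus>\<^bsub>?L\<^esub> X = \<zero>\<^bsub>?L\<^esub>"
      unfolding loc_zero_frac[OF assms x(2)] using x by (simp add: add M.M.l_neg)
    then show "\<exists>Y\<in>carrier ?L. Y \<oplus>\<^bsub>?L\<^esub> X = \<zero>\<^bsub>?L\<^esub>"
      using x by (intro bexI[of _ "?q (\<ominus>\<^bsub>M\<^esub> x) s"]) (simp_all add: loc_frac_closed)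
  next
    show "\<zero>\<^bsub>?L\<^esub> \<in> carrier ?L" by (simp add: loc_zero_frac[OF assms S_one] loc_frac_closed S_one)
  qed
qed

abbreviation frac :: "'a \<Rightarrow> 'a \<Rightarrow> ('a \<times> 'a) set" where
  "frac \<equiv> loc_frac R S (self_module R)"

lemma module_self: "module R (self_module R)"
  by (rule module_self_module[OF is_cring])

text \<open>
  Addition and multiplication of the ring of fractions are addition and scalar multiplication of
  the module of fractions of the ring, so all computations with representatives are shared.
\<close>

lemma loc_ring_eq:
  "carrier (loc_ring R S) = carrier (loc_module R S (self_module R))"
  "add (loc_ring R S) = add (loc_module R S (self_module R))"
  "\<zero>\<^bsub>loc_ring R S\<^esub> = \<zero>\<^bsub>loc_module R S (self_module R)\<^esub>"
  "mult (loc_ring R S) = smult (loc_module R S (self_module R))"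
  "\<one>\<^bsub>loc_ring R S\<^esub> = frac \<one> \<one>"
  by (simp_all add: loc_ring_def loc_module_def)

lemma frac_closed: "a \<in> carrier R \<Longrightarrow> s \<in> S \<Longrightarrow> frac a s \<in> carrier (loc_ring R S)"
  by (simp add: loc_ring_eq loc_frac_closed)

lemma frac_cases:
  assumes "t \<in> carrier (loc_ring R S)"
  obtains a s where "a \<in> carrier R" "s \<in> S" "t = frac a s"
  using assms by (auto simp: loc_ring_eq elim!: loc_frac_cases)

lemma frac_mult:
  "a \<in> carrier R \<Longrightarrow> s \<in> S \<Longrightarrow> b \<in> carrier R \<Longrightarrow> t \<in> S \<Longrightarrow>
    frac a s \<otimes>\<^bsub>loc_ring R S\<^esub> frac b t = frac (a \<otimes> b) (s \<otimes> t)"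
  using loc_smult_frac[OF module_self, of a s b t] by (simp add: loc_ring_eq)

lemma frac_add:
  "a \<in> carrier R \<Longrightarrow> s \<in> S \<Longrightarrow> b \<in> carrier R \<Longrightarrow> t \<in> S \<Longrightarrow>
    frac a s \<oplus>\<^bsub>loc_ring R S\<^esub> frac b t = frac (t \<otimes> a \<oplus> s \<otimes> b) (s \<otimes> t)"
  using loc_add_frac[OF module_self, of a s b t] by (simp add: loc_ring_eq)

lemma frac_eq_iff:
  "a \<in> carrier R \<Longrightarrow> b \<in> carrier R \<Longrightarrow> s \<in> S \<Longrightarrow> t \<in> S \<Longrightarrow>
    frac a s = frac b t \<longleftrightarrow> (\<exists>u\<in>S. u \<otimes> (t \<otimes> a) = u \<otimes> (s \<otimes> b))"
  using loc_frac_eq_iff[OF module_self, of a b s t] by simp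

lemma frac_scale: "a \<in> carrier R \<Longrightarrow> s \<in> S \<Longrightarrow> u \<in> S \<Longrightarrow> frac (u \<otimes> a) (u \<otimes> s) = frac a s"
  using loc_frac_scale[OF module_self, of a s u] by simp

lemma cring_loc_ring: "cring (loc_ring R S)"
proof (rule cringI)
  let ?T = "loc_ring R S"
  interpret L: abelian_group "loc_module R S (self_module R)"
    by (rule abelian_group_loc_module[OF module_self])
  show "abelian_group ?T"
    by (rule abelian_groupI)
      (auto simp: loc_ring_eq L.a_ac intro!: bexI[of _ "\<ominus>\<^bsub>loc_module R S (self_module R)\<^esub> _"] L.r_neg)
  show "comm_monoid ?T"
  proof (rule comm_monoidI)
    show "\<one>\<^bsub>?T\<^esub> \<in> carrier ?T" using frac_closed S_one by (simp add: loc_ring_eq(5))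
  next
    fix x y assume "x \<in> carrier ?T" "y \<in> carrier ?T"
    then show "x \<otimes>\<^bsub>?T\<^esub> y \<in> carrier ?T" "x \<otimes>\<^bsub>?T\<^esub> y = y \<otimes>\<^bsub>?T\<^esub> x"
      by (auto elim!: frac_cases simp: frac_mult S_mult frac_closed m_comm S_closed)
  next
    fix x y z assume "x \<in> carrier ?T" "y \<in> carrier ?T" "z \<in> carrier ?T"
    then show "x \<otimes>\<^bsub>?T\<^esub> y \<otimes>\<^bsub>?T\<^esub> z = x \<otimes>\<^bsub>?T\<^esub> (y \<otimes>\<^bsub>?T\<^esub> z)"
      by (auto elim!: frac_cases simp: frac_mult S_mult m_assoc S_closed)
  next
    fix x assume "x \<in> carrier ?T"
    then show "\<one>\<^bsub>?T\<^esub> \<otimes>\<^bsub>?T\<^esub> x = x"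
      by (auto elim!: frac_cases simp: loc_ring_eq(5) frac_mult S_one S_closed)
  qed
  fix x y z assume xyz: "x \<in> carrier ?T" "y \<in> carrier ?T" "z \<in> carrier ?T"
  obtain a b s where ab: "a \<in> carrier R" "b \<in> carrier R" "s \<in> S" "x = frac a s" "y = frac b s"
    using common_denominator[OF module_self, of x y] xyz by (auto simp: loc_ring_eq(1))
  obtain c t where c: "c \<in> carrier R" "t \<in> S" "z = frac c t" by (rule frac_cases[OF xyz(3)])
  note add = loc_add_frac_same[OF module_self, simplified]
  show "(x \<oplus>\<^bsub>?T\<^esub> y) \<otimes>\<^bsub>?T\<^esub> z = x \<otimes>\<^bsub>?T\<^esub> z \<oplus>\<^bsub>?T\<^esub> y \<otimes>\<^bsub>?T\<^esub> z"
    using ab(1-3) c(1,2) unfolding ab(4,5) c(3)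
    by (simp add: frac_mult S_mult loc_ring_eq(2) add) (simp add: l_distr)
qed

lemma module_loc_module:
  assumes "module R M"
  shows "module (loc_ring R S) (loc_module R S M)"
proof (rule moduleI[OF cring_loc_ring abelian_group_loc_module[OF assms]])
  interpret M: module R M by fact
  let ?T = "loc_ring R S" and ?L = "loc_module R S M" and ?q = "loc_frac R S M"
  note smult = loc_smult_frac[OF assms] and add = loc_add_frac_same[OF assms]
  {
    fix X assume "X \<in> carrier ?L"
    then show "\<one>\<^bsub>?T\<^esub> \<odot>\<^bsub>?L\<^esub> X = X"
      by (auto elim!: loc_frac_cases simp: loc_ring_eq(5) smult S_one S_closed)
  }
  fix a X assume a: "a \<in> carrier ?T" and X: "X \<in> carrier ?L"
  obtain r s where r: "r \<in> carrier R" "s \<in> S" "a = frac r s" by (rule frac_cases[OF a])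
  show "a \<odot>\<^bsub>?L\<^esub> X \<in> carrier ?L"
    using X r by (auto elim!: loc_frac_cases simp: smult S_mult loc_frac_closed)
  {
    fix Y assume Y: "Y \<in> carrier ?L"
    obtain x y t where "x \<in> carrier M" "y \<in> carrier M" "t \<in> S" "X = ?q x t" "Y = ?q y t"
      by (rule common_denominator[OF assms X Y])
    then show "a \<odot>\<^bsub>?L\<^esub> (X \<oplus>\<^bsub>?L\<^esub> Y) = a \<odot>\<^bsub>?L\<^esub> X \<oplus>\<^bsub>?L\<^esub> a \<odot>\<^bsub>?L\<^esub> Y"
      using r by (simp add: smult add S_mult M.smult_r_distr)
  }
  fix b assume b: "b \<in> carrier ?T"
  obtain x t where x: "x \<in> carrier M" "t \<in> S" "X = ?q x t" by (rule loc_frac_cases[OF X])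
  obtain r' s' where r': "r' \<in> carrier R" "s' \<in> S" "b = frac r' s'" by (rule frac_cases[OF b])
  show "(a \<otimes>\<^bsub>?T\<^esub> b) \<odot>\<^bsub>?L\<^esub> X = a \<odot>\<^bsub>?L\<^esub> (b \<odot>\<^bsub>?L\<^esub> X)"
    using r x r' by (simp add: frac_mult smult S_mult S_closed M.smult_assoc1 m_assoc)
  obtain c d s where cd: "c \<in> carrier R" "d \<in> carrier R" "s \<in> S" "a = frac c s" "b = frac d s"
    using common_denominator[OF module_self, of a b] a b by (auto simp: loc_ring_eq(1))
  show "(a \<oplus>\<^bsub>?T\<^esub> b) \<odot>\<^bsub>?L\<^esub> X = a \<odot>\<^bsub>?L\<^esub> X \<oplus>\<^bsub>?L\<^esub> b \<odot>\<^bsub>?L\<^esub> X"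
    using cd(1-3) x unfolding cd(4,5)
    by (simp add: loc_ring_eq(2) loc_add_frac_same[OF module_self, simplified] smult add S_mult M.smult_l_distr)
qed

lemma frac_one_hom: "(\<lambda>r. frac r \<one>) \<in> ring_hom R (loc_ring R S)"
  using loc_add_frac_same[OF module_self] S_one
  by (intro ring_hom_memI) (simp_all add: frac_closed frac_mult loc_ring_eq(2,5))

lemma ring_localization_loc_ring: "ring_localization R (loc_ring R S) (\<lambda>r. frac r \<one>) S"
proof (intro ring_localization.intro ring_localization_axioms.intro is_cring cring_loc_ring
    frac_one_hom S_subset S_one S_mult)
  let ?T = "loc_ring R S"
  interpret T: cring ?T by (rule cring_loc_ring)
  have cancel: "frac s s = \<one>\<^bsub>?T\<^esub>" if "s \<in> S" for s
    using frac_scale[of \<one> \<one> s] that S_one S_closed by (simp add: loc_ring_eq(5))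
  fix s assume s: "s \<in> S"
  have "frac s \<one> \<otimes>\<^bsub>?T\<^esub> frac \<one> s = \<one>\<^bsub>?T\<^esub>"
    using s S_one S_closed by (simp add: frac_mult cancel)
  then show "frac s \<one> \<in> Units ?T"
    using s S_one S_closed frac_closed T.m_comm[of "frac s \<one>" "frac \<one> s"]
    unfolding Units_def by auto
next
  let ?T = "loc_ring R S"
  fix t assume "t \<in> carrier ?T"
  then obtain a s where a: "a \<in> carrier R" "s \<in> S" "t = frac a s" by (rule frac_cases)
  have "frac s \<one> \<otimes>\<^bsub>?T\<^esub> t = frac a \<one>"
    using frac_scale[of a \<one> s] a S_one S_closed by (simp add: frac_mult)
  then show "\<exists>a\<in>carrier R. \<exists>s\<in>S. frac s \<one> \<otimes>\<^bsub>?T\<^esub> t = frac a \<one>" using a by blast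
qed

sublocale loc: ring_localization R "loc_ring R S" "\<lambda>r. frac r \<one>" S
  by (rule ring_localization_loc_ring)

lemma module_localization_loc_module:
  assumes "module R M"
  shows "loc.module_localization M (loc_module R S M) (\<lambda>x\<in>carrier M. loc_frac R S M x \<one>)"
  unfolding loc.module_localization_def
proof (intro conjI ballI impI assms module_loc_module)
  interpret M: module R M by fact
  let ?L = "loc_module R S M" and ?q = "loc_frac R S M"
  note smult = loc_smult_frac[OF assms] and add = loc_add_frac_same[OF assms]
  show "(\<lambda>x\<in>carrier M. ?q x \<one>) \<in> mod_hom R M (restrict_scalars (\<lambda>r. frac r \<one>) ?L)"
    using S_one by (intro mod_hom_restrictI[OF assms]) (simp_all add: loc_frac_closed add smult)
next
  interpret M: module R M by fact
  let ?L = "loc_module R S M" and ?q = "loc_frac R S M"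
  fix X assume "X \<in> carrier ?L"
  then obtain x s where x: "x \<in> carrier M" "s \<in> S" "X = ?q x s" by (rule loc_frac_cases)
  have "frac s \<one> \<odot>\<^bsub>?L\<^esub> X = (\<lambda>x\<in>carrier M. ?q x \<one>) x"
    using loc_frac_scale[OF assms x(1) S_one x(2)] x S_one S_closed
    by (simp add: loc_smult_frac[OF assms])
  then show "\<exists>x\<in>carrier M. \<exists>s\<in>S. frac s \<one> \<odot>\<^bsub>?L\<^esub> X = (\<lambda>x\<in>carrier M. ?q x \<one>) x" using x by blast
next
  interpret M: module R M by fact
  fix x assume x: "x \<in> carrier M" and "(\<lambda>x\<in>carrier M. loc_frac R S M x \<one>) x = \<zero>\<^bsub>loc_module R S M\<^esub>"
  then have "loc_frac R S M x \<one> = loc_frac R S M \<zero>\<^bsub>M\<^esub> \<one>" by (simp add: loc_module_simps)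
  then obtain u where "u \<in> S" "u \<odot>\<^bsub>M\<^esub> x = u \<odot>\<^bsub>M\<^esub> \<zero>\<^bsub>M\<^esub>"
    using loc_frac_eq_iff[OF assms x M.M.zero_closed S_one S_one] x by auto
  then show "\<exists>u\<in>S. u \<odot>\<^bsub>M\<^esub> x = \<zero>\<^bsub>M\<^esub>" using S_closed by auto
qed

end

section \<open>The field of quotients of a ring of fractions\<close>

context multiplicative_subset
begin

lemma frac_eq_zero_iff:
  assumes "domain R" "\<zero> \<notin> S" "a \<in> carrier R" "s \<in> S"
  shows "frac a s = \<zero>\<^bsub>loc_ring R S\<^esub> \<longleftrightarrow> a = \<zero>"
proof -
  interpret domain R by fact
  have "frac a s = frac \<zero> \<one> \<longleftrightarrow> (\<exists>u\<in>S. u \<otimes> a = \<zero>)"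
    using frac_eq_iff[OF assms(3) zero_closed assms(4) S_one] assms(3) S_closed[OF assms(4)] S_closed
    by (auto cong: bex_cong)
  also have "\<dots> \<longleftrightarrow> a = \<zero>"
    using assms(2,3) S_closed S_one by (auto dest!: integral)
  finally show ?thesis by (simp add: loc_ring_eq(3) loc_module_simps)
qed

lemma domain_loc_ring:
  assumes "domain R" "\<zero> \<notin> S"
  shows "domain (loc_ring R S)"
proof -
  interpret R: domain R by fact
  note z = frac_eq_zero_iff[OF assms]
  show ?thesis
  proof (intro domain.intro domain_axioms.intro cring_loc_ring)
    show "\<one>\<^bsub>loc_ring R S\<^esub> \<noteq> \<zero>\<^bsub>loc_ring R S\<^esub>" using z[OF one_closed S_one] by (simp add: loc_ring_eq(5))
    fix x y assume xy: "x \<otimes>\<^bsub>loc_ring R S\<^esub> y = \<zero>\<^bsub>loc_ring R S\<^esub>"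
      and x: "x \<in> carrier (loc_ring R S)" and y: "y \<in> carrier (loc_ring R S)"
    obtain a s where a: "a \<in> carrier R" "s \<in> S" "x = frac a s" by (rule frac_cases[OF x])
    obtain b t where b: "b \<in> carrier R" "t \<in> S" "y = frac b t" by (rule frac_cases[OF y])
    have "a \<otimes> b = \<zero>"
      using xy a(1,2) b(1,2) unfolding a(3) b(3) by (simp add: frac_mult z S_mult)
    then have "a = \<zero> \<or> b = \<zero>" using a(1) b(1) by (rule R.integral)
    then show "x = \<zero>\<^bsub>loc_ring R S\<^esub> \<or> y = \<zero>\<^bsub>loc_ring R S\<^esub>"
      using a b z by auto
  qed
qed

end

lemma multiplicative_subset_nonzero:
  assumes "domain R"
  shows "multiplicative_subset R (carrier R - {\<zero>\<^bsub>R\<^esub>})"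
proof -
  interpret domain R by fact
  show ?thesis by unfold_locales (auto dest: integral)
qed

lemma quotient_field_module_eq:
  "quotient_field_module R = restrict_scalars
     (\<lambda>r. loc_frac R (carrier R - {\<zero>\<^bsub>R\<^esub>}) (self_module R) r \<one>\<^bsub>R\<^esub>)
     (self_module (loc_ring R (carrier R - {\<zero>\<^bsub>R\<^esub>})))"
  by (simp add: quotient_field_module_def restrict_scalars_def quotient_field_def)

lemma module_quotient_field_module:
  assumes "domain R"
  shows "module R (quotient_field_module R)"
proof -
  interpret multiplicative_subset R "carrier R - {\<zero>\<^bsub>R\<^esub>}"
    by (rule multiplicative_subset_nonzero) fact
  show ?thesis unfolding quotient_field_module_eq
    by (rule module_restrict_scalars[OF is_cring module_self_module[OF cring_loc_ring] frac_one_hom])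
qed

context multiplicative_subset
begin

text \<open>
  The map \<open>a / b \<mapsto> (a / 1) / (b / 1)\<close> from the field of quotients of \<open>R\<close> to the one of the ring of
  fractions. As in the definition of the operations on fractions, the union ranges over all
  representatives.
\<close>

definition quotient_field_map :: "('a \<times> 'a) set \<Rightarrow> (('a \<times> 'a) set \<times> ('a \<times> 'a) set) set" where
  "quotient_field_map = (\<lambda>X\<in>carrier (quotient_field R). \<Union>(a, b)\<in>X.
     loc_frac (loc_ring R S) (carrier (loc_ring R S) - {\<zero>\<^bsub>loc_ring R S\<^esub>})
       (self_module (loc_ring R S)) (frac a \<one>) (frac b \<one>))"

text \<open>
  The map is in fact an isomorphism, so it is a localization trivially: the denominators already
  act bijectively on the field of quotients of \<open>R\<close>. The property is verified directly: in
  \<open>\<alpha> / \<beta>\<close> the denominators of \<open>\<alpha>\<close> and \<open>\<beta>\<close> are cleared by one factor each.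
\<close>

lemma module_localization_quotient_field:
  assumes dom: "domain R" and nz: "\<zero> \<notin> S"
  shows "loc.module_localization (quotient_field_module R) (quotient_field_module (loc_ring R S))
    quotient_field_map"
proof -
  interpret R: domain R by fact
  let ?T = "loc_ring R S"
  interpret T: domain ?T by (rule domain_loc_ring[OF dom nz])
  interpret K: multiplicative_subset R "carrier R - {\<zero>}"
    by (rule multiplicative_subset_nonzero[OF dom])
  interpret KT: multiplicative_subset ?T "carrier ?T - {\<zero>\<^bsub>?T\<^esub>}"
    by (rule multiplicative_subset_nonzero[OF T.domain_axioms])
  define \<phi> where "\<phi> r = frac r \<one>" for r
  have phi: "\<phi> r \<in> carrier ?T" if "r \<in> carrier R" for r
    using that by (simp add: \<phi>_def frac_closed S_one)
  have phi_mult: "\<phi> (r \<otimes> r') = \<phi> r \<otimes>\<^bsub>?T\<^esub> \<phi> r'" if "r \<in> carrier R" "r' \<in> carrier R" for r r'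
    unfolding \<phi>_def using loc.phi_simps(3)[OF that] .
  have phi_add: "\<phi> (r \<oplus> r') = \<phi> r \<oplus>\<^bsub>?T\<^esub> \<phi> r'" if "r \<in> carrier R" "r' \<in> carrier R" for r r'
    unfolding \<phi>_def using loc.phi_simps(2)[OF that] .
  have phi_zero: "\<phi> r = \<zero>\<^bsub>?T\<^esub> \<longleftrightarrow> r = \<zero>" if "r \<in> carrier R" for r
    unfolding \<phi>_def by (rule frac_eq_zero_iff[OF dom nz that S_one])
  have phiK: "\<phi> b \<in> carrier ?T - {\<zero>\<^bsub>?T\<^esub>}" if "b \<in> carrier R - {\<zero>}" for b
    using that phi phi_zero by auto
  have map_frac: "quotient_field_map (K.frac a b) = KT.frac (\<phi> a) (\<phi> b)"
    if a: "a \<in> carrier R" and b: "b \<in> carrier R - {\<zero>}" for a b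
  proof -
    have "(\<Union>(a', b')\<in>K.frac a b. KT.frac (\<phi> a') (\<phi> b')) = KT.frac (\<phi> a) (\<phi> b)"
    proof (rule K.loc_frac_UN[OF K.module_self])
      fix a' b' assume mem: "(a', b') \<in> K.frac a b"
      note m = K.loc_frac_memD[OF mem, simplified]
      obtain u where u: "u \<in> carrier R - {\<zero>}" "u \<otimes> (b' \<otimes> a) = u \<otimes> (b \<otimes> a')"
        using m(5) by blast
      have eq: "\<phi> b' \<otimes>\<^bsub>?T\<^esub> \<phi> a = \<phi> b \<otimes>\<^bsub>?T\<^esub> \<phi> a'"
        using u m(1-4) R.m_lcancel[of u "b' \<otimes> a" "b \<otimes> a'"] by (simp add: phi_mult[symmetric])
      show "KT.frac (\<phi> a') (\<phi> b') = KT.frac (\<phi> a) (\<phi> b)"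
        using m(1-4) phi eq phiK
        by (subst KT.frac_eq_iff) (auto intro!: bexI[of _ "\<one>\<^bsub>?T\<^esub>"])
    qed (use a b in auto)
    moreover have "K.frac a b \<in> carrier (quotient_field R)"
      using K.frac_closed[OF a b] by (simp add: quotient_field_def)
    ultimately show ?thesis by (simp add: quotient_field_map_def \<phi>_def)
  qed
  have QR: "module R (quotient_field_module R)" by (rule module_quotient_field_module[OF dom])
  have QT: "module ?T (quotient_field_module ?T)"
    by (rule module_quotient_field_module[OF T.domain_axioms])
  have Q_simps: "carrier (quotient_field_module R) = carrier (quotient_field R)"
    "add (quotient_field_module R) = add (quotient_field R)"
    "zero (quotient_field_module R) = zero (quotient_field R)"
    "smult (quotient_field_module R) = (\<lambda>r X. K.frac r \<one> \<otimes>\<^bsub>quotient_field R\<^esub> X)"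
    "carrier (quotient_field_module ?T) = carrier (quotient_field ?T)"
    "add (quotient_field_module ?T) = add (quotient_field ?T)"
    "zero (quotient_field_module ?T) = zero (quotient_field ?T)"
    "smult (quotient_field_module ?T) = (\<lambda>r X. KT.frac r \<one>\<^bsub>?T\<^esub> \<otimes>\<^bsub>quotient_field ?T\<^esub> X)"
    by (simp_all add: quotient_field_module_def)
  note mult = K.frac_mult[folded quotient_field_def] KT.frac_mult[folded quotient_field_def]
  note add = K.frac_add[folded quotient_field_def] KT.frac_add[folded quotient_field_def]
  note closed = K.frac_closed[folded quotient_field_def] KT.frac_closed[folded quotient_field_def]
  have hom: "(\<lambda>X\<in>carrier (quotient_field_module R). quotient_field_map X)
      \<in> mod_hom R (quotient_field_module R) (restrict_scalars \<phi> (quotient_field_module ?T))"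
  proof (rule mod_hom_restrictI[OF QR])
    fix X assume "X \<in> carrier (quotient_field_module R)"
    then obtain a b where ab: "a \<in> carrier R" "b \<in> carrier R - {\<zero>}" "X = K.frac a b"
      using K.frac_cases[of X] by (auto simp: Q_simps quotient_field_def)
    show "quotient_field_map X \<in> carrier (restrict_scalars \<phi> (quotient_field_module ?T))"
      using ab phi phiK by (simp only: map_frac restrict_scalars_simps Q_simps closed)
    {
      fix r assume r: "r \<in> carrier R"
      have "quotient_field_map (r \<odot>\<^bsub>quotient_field_module R\<^esub> X) = KT.frac (\<phi> (r \<otimes> a)) (\<phi> (\<one> \<otimes> b))"
        using ab(1,2) r K.S_one by (simp only: ab(3) Q_simps mult m_closed K.S_mult map_frac)
      also have "\<dots> = r \<odot>\<^bsub>restrict_scalars \<phi> (quotient_field_module ?T)\<^esub> quotient_field_map X"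
        using ab(1,2) r KT.S_one phi phiK by (simp add: ab(3) Q_simps mult map_frac phi_mult)
      finally show "quotient_field_map (r \<odot>\<^bsub>quotient_field_module R\<^esub> X)
        = r \<odot>\<^bsub>restrict_scalars \<phi> (quotient_field_module ?T)\<^esub> quotient_field_map X" .
    }
    fix Y assume "Y \<in> carrier (quotient_field_module R)"
    then obtain c d where cd: "c \<in> carrier R" "d \<in> carrier R - {\<zero>}" "Y = K.frac c d"
      using K.frac_cases[of Y] by (auto simp: Q_simps quotient_field_def)
    have "quotient_field_map (X \<oplus>\<^bsub>quotient_field_module R\<^esub> Y)
        = KT.frac (\<phi> (d \<otimes> a \<oplus> b \<otimes> c)) (\<phi> (b \<otimes> d))"
      using ab(1,2) cd(1,2) K.S_mult[OF ab(2) cd(2)] by (simp add: ab(3) cd(3) Q_simps add map_frac)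
    also have "\<dots> = quotient_field_map X \<oplus>\<^bsub>restrict_scalars \<phi> (quotient_field_module ?T)\<^esub> quotient_field_map Y"
      using ab(1,2) cd(1,2) phi phiK by (simp add: ab(3) cd(3) Q_simps add map_frac phi_mult phi_add)
    finally show "quotient_field_map (X \<oplus>\<^bsub>quotient_field_module R\<^esub> Y)
      = quotient_field_map X \<oplus>\<^bsub>restrict_scalars \<phi> (quotient_field_module ?T)\<^esub> quotient_field_map Y" .
  qed
  have map_eq: "(\<lambda>X\<in>carrier (quotient_field_module R). quotient_field_map X) = quotient_field_map"
    by (simp only: quotient_field_map_def Q_simps restrict_restrict Int_absorb)
  show ?thesis
    unfolding loc.module_localization_def unfolding \<phi>_def[symmetric]
  proof (intro conjI ballI impI QR QT hom[unfolded map_eq])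
    fix Y assume "Y \<in> carrier (quotient_field_module ?T)"
    then obtain \<alpha> \<beta> where ab: "\<alpha> \<in> carrier ?T" "\<beta> \<in> carrier ?T - {\<zero>\<^bsub>?T\<^esub>}" "Y = KT.frac \<alpha> \<beta>"
      using KT.frac_cases[of Y] by (auto simp: Q_simps quotient_field_def)
    obtain a s where a: "a \<in> carrier R" "s \<in> S" and as: "\<phi> s \<otimes>\<^bsub>?T\<^esub> \<alpha> = \<phi> a"
      using loc.fraction[OF ab(1)] by (auto simp: \<phi>_def)
    have "\<beta> \<in> carrier ?T" using ab(2) by simp
    then obtain b t where b: "b \<in> carrier R" "t \<in> S" and bt: "\<phi> t \<otimes>\<^bsub>?T\<^esub> \<beta> = \<phi> b"
      using loc.fraction[of \<beta>] by (auto simp: \<phi>_def)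
    have t0: "t \<in> carrier R - {\<zero>}" using b(2) nz S_closed by auto
    then have b0: "b \<in> carrier R - {\<zero>}"
      using b(1) bt phi_zero[OF b(1)] phiK[OF t0] ab(2) T.integral[of "\<phi> t" \<beta>] by auto
    have "\<phi> s \<odot>\<^bsub>quotient_field_module ?T\<^esub> Y = KT.frac (\<phi> a) \<beta>"
      using ab(1,2) phi S_closed[OF a(2)] KT.S_one
      by (simp add: ab(3) Q_simps mult as)
    also have "\<dots> = KT.frac (\<phi> t \<otimes>\<^bsub>?T\<^esub> \<phi> a) (\<phi> t \<otimes>\<^bsub>?T\<^esub> \<beta>)"
      by (rule KT.frac_scale[symmetric]) (use phi a(1) ab(2) phiK[OF t0] in auto)
    also have "\<dots> = quotient_field_map (K.frac (t \<otimes> a) b)"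
      using t0 a(1) b0 by (simp add: bt map_frac phi_mult)
    finally show "\<exists>x\<in>carrier (quotient_field_module R). \<exists>s\<in>S.
        \<phi> s \<odot>\<^bsub>quotient_field_module ?T\<^esub> Y = quotient_field_map x"
      using a t0 b0 closed(1)[of "t \<otimes> a" b] by (auto simp: Q_simps)
  next
    fix X assume "X \<in> carrier (quotient_field_module R)"
      and zero: "quotient_field_map X = \<zero>\<^bsub>quotient_field_module ?T\<^esub>"
    then obtain a b where ab: "a \<in> carrier R" "b \<in> carrier R - {\<zero>}" "X = K.frac a b"
      using K.frac_cases[of X] by (auto simp: Q_simps quotient_field_def)
    have "KT.frac (\<phi> a) (\<phi> b) = \<zero>\<^bsub>loc_ring ?T (carrier ?T - {\<zero>\<^bsub>?T\<^esub>})\<^esub>"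
      using zero map_frac[OF ab(1,2)] by (simp add: ab(3) Q_simps quotient_field_def)
    then have "a = \<zero>"
      using KT.frac_eq_zero_iff[OF T.domain_axioms, of "\<phi> a" "\<phi> b"] phi phiK ab(1,2) phi_zero by simp
    then have "X = \<zero>\<^bsub>quotient_field_module R\<^esub>"
      using K.frac_eq_zero_iff[OF dom, of a b] ab by (simp add: Q_simps quotient_field_def)
    then have "\<one> \<odot>\<^bsub>quotient_field_module R\<^esub> X = \<zero>\<^bsub>quotient_field_module R\<^esub>"
      using module.smult_one[OF QR, of X] \<open>X \<in> carrier (quotient_field_module R)\<close> by simp
    then show "\<exists>u\<in>S. u \<odot>\<^bsub>quotient_field_module R\<^esub> X = \<zero>\<^bsub>quotient_field_module R\<^esub>"
      using S_one by blast
  qed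
qed

end

section \<open>Descent of w-strong flatness to localizations\<close>

text \<open>
  Suppose \<open>J \<subseteq> P\<close>. Since \<open>Ext\<^sup>1(R/J, P) = 0\<close>, the inclusion of \<open>J\<close> into \<open>P\<close> extends to a homomorphism
  \<open>h\<close> from \<open>R\<close> to \<open>P\<close>, which is multiplication by \<open>h 1\<close>. So \<open>a = a (h 1)\<close> for all \<open>a\<close> in \<open>J\<close>. The ideal
  \<open>J\<close> is not zero, because \<open>R\<close> embeds into \<open>Hom(J, R)\<close>; cancelling a nonzero \<open>a\<close> gives \<open>1 = h 1 \<in> P\<close>,
  which is absurd.
\<close>

lemma GV_ideal_not_subset_prime_w_ideal:
  assumes dom: "domain R" and P: "prime_w_ideal P R" and J: "J \<in> GV_ideals R"
  shows "\<exists>s\<in>J. s \<notin> P"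
proof (rule ccontr)
  assume "\<not> (\<exists>s\<in>J. s \<notin> P)"
  then have JP: "J \<subseteq> P" by blast
  interpret R: domain R by fact
  let ?R = "self_module R" and ?P = "(self_module R)\<lparr>carrier := P\<rparr>"
  have Pp: "primeideal P R" and Pw: "module R ?P"
    and Z: "zero_module (Ext1 R (quot_module ?R J) ?P)"
    using P J by (auto simp: prime_w_ideal_def w_ideal_def w_module_def)
  have Ji: "ideal J R" and iso: "inj_on (\<lambda>r\<in>carrier R. \<lambda>a\<in>J. r \<otimes>\<^bsub>R\<^esub> a) (carrier R)"
    using J by (auto simp: GV_ideals_def mod_iso_def bij_betw_def)
  interpret P: primeideal P R by fact
  interpret J: ideal J R by fact
  have RR: "module R ?R" by (rule module_self_module[OF R.is_cring])
  have JR: "module R (?R\<lparr>carrier := J\<rparr>)"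
    by (rule module_restrict_carrier[OF RR]) (auto intro: J.I_l_closed)
  note Q = module_quot_module[OF RR JR]
  have Jsub: "J \<subseteq> carrier ?R" by auto
  let ?\<pi> = "\<lambda>x\<in>carrier ?R. J +>\<^bsub>?R\<^esub> x"
  have ker: "{x \<in> carrier ?R. ?\<pi> x = \<zero>\<^bsub>quot_module ?R J\<^esub>} = J"
    using Q(3)[OF Jsub] by (auto simp: quot_module_def)
  have surj: "carrier (quot_module ?R J) \<subseteq> ?\<pi> ` carrier ?R"
    by (auto simp: quot_module_def A_RCOSETS_def')
  have incl: "(\<lambda>x\<in>J. x) \<in> mod_hom R (?R\<lparr>carrier := {x \<in> carrier ?R. ?\<pi> x = \<zero>\<^bsub>quot_module ?R J\<^esub>}\<rparr>) ?P"
    unfolding ker using JP JR mod_hom_restrictI[OF JR, of "\<lambda>x. x" ?P] by auto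
  obtain h where h: "h \<in> mod_hom R ?R ?P" and hJ: "\<And>n. n \<in> carrier ?R \<Longrightarrow>
      ?\<pi> n = \<zero>\<^bsub>quot_module ?R J\<^esub> \<Longrightarrow> h n = (\<lambda>x\<in>J. x) n"
    using Ext1_zero_extend[OF Q(1)[OF Jsub] Pw Z RR Q(2)[OF Jsub] surj incl] by blast
  have x: "h \<one>\<^bsub>R\<^esub> \<in> P" using mod_hom_closed[OF h, of "\<one>\<^bsub>R\<^esub>"] by simp
  have ax: "a \<otimes>\<^bsub>R\<^esub> \<one>\<^bsub>R\<^esub> = a \<otimes>\<^bsub>R\<^esub> h \<one>\<^bsub>R\<^esub>" if a: "a \<in> J" for a
  proof -
    have "a \<in> {x \<in> carrier ?R. ?\<pi> x = \<zero>\<^bsub>quot_module ?R J\<^esub>}" unfolding ker by (rule a)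
    then have "h a = a" using hJ[of a] a by simp
    then show ?thesis using mod_hom_smult[OF h, of a "\<one>\<^bsub>R\<^esub>"] a by simp
  qed
  show False
  proof (cases "J = {\<zero>\<^bsub>R\<^esub>}")
    case True
    then have "(\<lambda>a\<in>J. \<zero>\<^bsub>R\<^esub> \<otimes>\<^bsub>R\<^esub> a) = (\<lambda>a\<in>J. \<one>\<^bsub>R\<^esub> \<otimes>\<^bsub>R\<^esub> a)" by (auto intro!: restrict_ext)
    then show False using inj_onD[OF iso, of "\<zero>\<^bsub>R\<^esub>" "\<one>\<^bsub>R\<^esub>"] R.one_not_zero by simp
  next
    case False
    then obtain a where a: "a \<in> J" "a \<noteq> \<zero>\<^bsub>R\<^esub>" using J.zero_closed by blast
    then have "\<one>\<^bsub>R\<^esub> = h \<one>\<^bsub>R\<^esub>"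
      using ax[OF a(1)] x R.m_lcancel[of a "\<one>\<^bsub>R\<^esub>" "h \<one>\<^bsub>R\<^esub>"] by simp
    then have "\<one>\<^bsub>R\<^esub> \<in> P" using x by simp
    then show False using P.one_imp_carrier P.I_notcarr by simp
  qed
qed

text \<open>
  Denominators act invertibly on \<open>C\<close> and hence on \<open>Ext\<^sup>1(X, C)\<close>, whereas torsion makes each class
  vanish after multiplication by a denominator: if \<open>g\<close> extends \<open>s f\<close> then \<open>s\<^sup>-\<^sup>1 g\<close> extends \<open>f\<close>.
\<close>

lemma (in ring_localization) Ext1_zero_if_GV_torsion:
  assumes X: "module R X" and C: "module T C"
    and tors: "GV_torsion R (Ext1 R X (restrict_scalars \<phi> C))"
    and meets: "\<And>J. J \<in> GV_ideals R \<Longrightarrow> \<exists>s\<in>J. s \<in> W"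
  shows "zero_module (Ext1 R X (restrict_scalars \<phi> C))"
proof -
  interpret X: module R X by fact
  interpret C: module T C by fact
  have RC: "module R (restrict_scalars \<phi> C)" by (rule module_restrict_scalars[OF R.is_cring C hom])
  have F: "module R (ext_cover R X)" by (rule module_free_module[OF R.is_cring])
  show ?thesis
    unfolding zero_module_Ext1_iff[OF X RC]
  proof
    fix f assume f: "f \<in> mod_hom R (ext_syzygy R X) (restrict_scalars \<phi> C)"
    from GV_torsion_Ext1D[OF X RC tors f]
    obtain J where J: "J \<in> GV_ideals R" "\<forall>a\<in>J. \<exists>g\<in>mod_hom R (ext_cover R X) (restrict_scalars \<phi> C).
        \<forall>k\<in>carrier (ext_syzygy R X). g k = a \<odot>\<^bsub>restrict_scalars \<phi> C\<^esub> f k"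
      by (rule bexE)
    obtain s where s: "s \<in> J" "s \<in> W" using meets[OF J(1)] by blast
    obtain g where g: "g \<in> mod_hom R (ext_cover R X) (restrict_scalars \<phi> C)"
      "\<And>k. k \<in> carrier (ext_syzygy R X) \<Longrightarrow> g k = \<phi> s \<odot>\<^bsub>C\<^esub> f k"
      using bspec[OF J(2) s(1)] by auto
    define v where "v = inv\<^bsub>T\<^esub> (\<phi> s)"
    have v: "v \<in> carrier T" "v \<otimes>\<^bsub>T\<^esub> \<phi> s = \<one>\<^bsub>T\<^esub>"
      using W_Units[OF s(2)] by (simp_all add: v_def)
    have "(\<lambda>x\<in>carrier (ext_cover R X). v \<odot>\<^bsub>C\<^esub> g x) \<in> mod_hom R (ext_cover R X) (restrict_scalars \<phi> C)"
    proof (rule mod_hom_restrictI[OF F])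
      fix x assume x: "x \<in> carrier (ext_cover R X)"
      have gx: "g x \<in> carrier C" using mod_hom_closed[OF g(1) x] by simp
      then show "v \<odot>\<^bsub>C\<^esub> g x \<in> carrier (restrict_scalars \<phi> C)" using v by simp
      fix r assume r: "r \<in> carrier R"
      show "v \<odot>\<^bsub>C\<^esub> g (r \<odot>\<^bsub>ext_cover R X\<^esub> x) = r \<odot>\<^bsub>restrict_scalars \<phi> C\<^esub> (v \<odot>\<^bsub>C\<^esub> g x)"
        unfolding mod_hom_smult[OF g(1) r x] using gx v r
        by (simp add: C.smult_assoc1[symmetric] phi_simps T.m_comm)
    next
      fix x y assume xy: "x \<in> carrier (ext_cover R X)" "y \<in> carrier (ext_cover R X)"
      show "v \<odot>\<^bsub>C\<^esub> g (x \<oplus>\<^bsub>ext_cover R X\<^esub> y) = v \<odot>\<^bsub>C\<^esub> g x \<oplus>\<^bsub>restrict_scalars \<phi> C\<^esub> v \<odot>\<^bsub>C\<^esub> g y"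
        unfolding mod_hom_add[OF g(1) xy]
        using mod_hom_closed[OF g(1) xy(1)] mod_hom_closed[OF g(1) xy(2)] v by (simp add: C.smult_r_distr)
    qed
    moreover have "(\<lambda>x\<in>carrier (ext_cover R X). v \<odot>\<^bsub>C\<^esub> g x) k = f k"
      if k: "k \<in> carrier (ext_syzygy R X)" for k
    proof -
      have "f k \<in> carrier C" using mod_hom_closed[OF f k] by simp
      then have "v \<odot>\<^bsub>C\<^esub> (\<phi> s \<odot>\<^bsub>C\<^esub> f k) = f k"
        using v W_closed[OF s(2)] by (simp add: C.smult_assoc1[symmetric] phi_simps)
      moreover have "k \<in> carrier (ext_cover R X)" using k by (simp add: eval_kernel_def)
      ultimately show ?thesis by (simp add: g(2)[OF k])
    qed
    ultimately show "\<exists>g\<in>mod_hom R (ext_cover R X) (restrict_scalars \<phi> C).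
        \<forall>k\<in>carrier (ext_syzygy R X). g k = f k" by blast
  qed
qed

theorem proposition4p9:
  fixes R :: "('a, 'x) ring_scheme" and M :: "('a, 'm, 'y) module_scheme"
  assumes "domain R"
    and "module R M"
    and "w_strongly_flat TYPE('c) R M"
  shows "\<forall>P. prime_w_ideal P R \<longrightarrow>
    strongly_flat TYPE('c) (prime_loc_ring R P) (prime_loc_module R P M)"
proof (intro allI impI)
  fix P assume P: "prime_w_ideal P R"
  interpret R: domain R by fact
  interpret P: primeideal P R using P by (simp add: prime_w_ideal_def)
  define S where "S = carrier R - P"
  have "\<one>\<^bsub>R\<^esub> \<notin> P" using P.one_imp_carrier P.I_notcarr by auto
  then interpret multiplicative_subset R S
    by unfold_locales (auto simp: S_def dest: P.I_prime)
  have nz: "\<zero>\<^bsub>R\<^esub> \<notin> S" by (simp add: S_def)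
  let ?T = "loc_ring R S"
  let ?\<phi> = "\<lambda>r. frac r \<one>\<^bsub>R\<^esub>"
  have "zero_module (Ext1 ?T (loc_module R S M) C)" if C: "matlis_cotorsion ?T C"
    for C :: "(('a \<times> 'a) set, 'c) module"
  proof -
    have TC: "module ?T C" and Z: "zero_module (Ext1 ?T (quotient_field_module ?T) C)"
      using C by (simp_all add: matlis_cotorsion_def)
    let ?C = "restrict_scalars ?\<phi> C"
    have "zero_module (Ext1 R (quotient_field_module R) ?C)"
      by (rule loc.Ext1_of_localization[OF module_localization_quotient_field[OF assms(1) nz] TC
            module_localization_loc_module[OF module_free_module[OF R.is_cring]] Z])
    then have "matlis_cotorsion R ?C"
      using module_restrict_scalars[OF R.is_cring TC frac_one_hom] by (simp add: matlis_cotorsion_def)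
    then have "GV_torsion R (Ext1 R M ?C)" using assms(3) by (simp add: w_strongly_flat_def)
    then have "zero_module (Ext1 R M ?C)"
    proof (rule loc.Ext1_zero_if_GV_torsion[OF assms(2) TC])
      fix J assume J: "J \<in> GV_ideals R"
      then have "ideal J R" by (simp add: GV_ideals_def)
      then show "\<exists>s\<in>J. s \<in> S"
        using GV_ideal_not_subset_prime_w_ideal[OF assms(1) P J] by (auto simp: S_def ideal.Icarr)
    qed
    then show ?thesis
      by (rule loc.Ext1_localization[OF module_localization_loc_module[OF assms(2)] TC])
  qed
  then show "strongly_flat TYPE('c) (prime_loc_ring R P) (prime_loc_module R P M)"
    using domain_loc_ring[OF assms(1) nz] module_loc_module[OF assms(2)]
    by (simp add: strongly_flat_def prime_loc_ring_def prime_loc_module_def S_def)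
qed

end
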